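(* Let $\phi\in\mathcal K_{R,S}$ be the true interaction kernel. Assume that there exists a sequence of finite-dimensional linear spaces $\{\mathcal L_n\}_{n\in\mathbb N^+}\subset C^{1,1}([0,R])$ for which there are constants $c_1,\gamma>0$ such that $\|\varphi'\|_\infty\le c_1(\dim\mathcal L_n)^\gamma\|\varphi\|_\infty$ for all $n$ and all $\varphi\in\mathcal L_n$, and with the properties that, for some constants $c_0,c_2,s>0$ and every $n\in\mathbb N^+$, (i) $\dim(\mathcal L_n)\le c_0n$; (ii) $\inf_{\varphi\in\mathcal L_n}\|\varphi-\phi\|_\infty\le c_2n^{-s}$. (For example, when $\phi\in C^{k,\alpha}$ with $s=k+\alpha\ge2$, we may choose $\mathcal L_n$ to consist of polynomial splines of degree $\lfloor s-1\rfloor$ with uniform knots on $[0,R]$.) Let $S_0=c_2+S$, let $\mathcal H_n=\{\varphi\in\mathcal L_n:\|\varphi\|_\infty\le S_0\}$, let $n=n(M)\asymp\left(\frac{M}{\log M}\right)^{\frac1{2s+1}}$, and assume that the coercivity condition holds on $\mathcal L:=\bigcup_n\mathcal L_n$ with a constant $c_{\mathcal L}>0$. Let $\widehat\phi_{T,M,\mathcal H_n}$ be a minimizer of $\mathcal E_{T,M}$ over $\mathcal H_n$. Then, for $M\ge2$, $$\mathbb E\Big[\big|\!\big|\!\big|\widehat\phi_{T,M,\mathcal H_n}-\phi\big|\!\big|\!\big|^2\Big]\le\frac{C}{c_{\mathcal L}^2}\left(\frac{\log M}{M}\right)^{\frac{2s}{2s+1}},$$ where $C$ is a constant depending only on $\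sigma,N,T,R,S_0$.
   Context: Fix integers $N\ge2$, $d\ge1$ and reals $\sigma,T,R,S>0$. For $\varphi:[0,\infty)\to\mathbb R$ define $\mathbf f_\varphi:\mathbb R^{dN}\to\mathbb R^{dN}$ by $(\mathbf f_\varphi(\mathbf x))_i=\frac1N\sum_{i'=1}^N\varphi(\|\mathbf x_{i'}-\mathbf x_i\|)(\mathbf x_{i'}-\mathbf x_i)$, $i=1,\dots,N$, where $\mathbf x=(\mathbf x_1,\dots,\mathbf x_N)$, $\mathbf x_i\in\mathbb R^d$. The observed system is $d\mathbf X_t=\mathbf f_\phi(\mathbf X_t)\,dt+\sigma\,d\mathbf B_t$ on $[0,T]$, with $\mathbf B$ a standard Brownian motion in $\mathbb R^{dN}$ and $\mathbf X_0\sim\mu_0$ independent of $\mathbf B$ with finite second moment; $\phi$ is the (true) interaction kernel. Write $\mathbf r_{ii'}(t)=\mathbf x_{i',t}-\mathbf x_{i,t}$ and $r_{ii'}(t)=\|\mathbf r_{ii'}(t)\|$. Admissible set: $\mathcal K_{R,S}=\{\varphi\in C^1(\mathbb R_+):\ \mathrm{supp}(\varphi)\subset[0,R],\ \|\varphi\|_\infty+\|\varphi'\|_\infty\le S\}$. For an integer $k\ge0$ and $0<\alpha\le1$, $C^{k,\alpha}$ is the space of functions whose $k$-th derivative is Hölder continuous of order $\alpha$; in particular $C^{1,1}([0,R])$ is the space of $C^1$ functions on $[0,R]$ with Lipschitz derivative. Functions on $[0,R]$ are regarded as functions on $\mathbb R_+$ by setting them to $0$ outside $[0,R]$. $\|\cdot\|_\infty$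 is the sup norm. $a_M\asymp b_M$ means that $a_M/b_M$ is bounded above and below by positive constants. Measure and norm: $\rho_T(dr)=\frac{1}{\binom N2T}\int_0^T\sum_{1\le i<i'\le N}\mathbb E[\delta_{r_{ii'}(t)}(dr)]\,dt$, and $|\!|\!|\varphi|\!|\!|=\big(\int_{\mathbb R_+}|\varphi(r)r|^2\rho_T(dr)\big)^{1/2}$. Error functional: given $M$ independent copies $\mathbf X^{(1)},\dots,\mathbf X^{(M)}$ of the trajectory $\mathbf X_{[0,T]}$, $\mathcal E_{T,M}(\varphi)=\frac1M\sum_{m=1}^M\mathcal E_{\mathbf X^{(m)}_{[0,T]}}(\varphi)$, where $\mathcal E_{\mathbf X_{[0,T]}}(\varphi)=\frac{1}{2\sigma^2TN}\Big(\int_0^T\|\mathbf f_\varphi(\mathbf X_t)\|^2dt-2\int_0^T\langle\mathbf f_\varphi(\mathbf X_t),d\mathbf X_t\rangle\Big)$. The outer expectation in the claim is over these $M$ trajectories. Coercivity condition on a set $\mathcal H$ of functions on $\mathbb R_+$ with constant $c_{\mathcal H}>0$: $c_{\mathcal H}|\!|\!|\varphi|\!|\!|^2\le\frac{1}{2\sigma^2NT}\int_0^T\sum_{i=1}^N\mathbb E\Big[\big\|\frac1N\sum_{i'=1}^N\varphi(r_{ii'}(t))\mathbf r_{ii'}(t)\big\|^2\Big]dt$ for all $\varphi\in\mathcal H$ with $|\!|\!|\varphi|\!|\!|<\infty$.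
   Formalization: C may also depend on c_0, s and the constants in n(M)≍…; otherwise the claim fails (L_1={0}, L_n=span φ for n≥2, n(M)=1 up to a large M_0). The parenthetical spline example, false e.g. at s=2 since linear splines are not C^{1,1}, is left out. *)

theory Defs
  imports "HOL-Probability.Probability" "HOL-Library.Function_Algebras"
begin

section \<open>Configurations and the interaction drift\<close>

text \<open>
  A point of \<open>(R^d)^N\<close> is a function \<open>x\<close> of which only the values \<open>x i k\<close> with \<open>i < N\<close>, \<open>k < d\<close>
  matter. Numerical \<open>N\<close> and \<open>d\<close> (instead of index types) make it possible to say that
  a constant does not depend on \<open>d\<close>.
\<close>

type_synonym config = "nat \<Rightarrow> nat \<Rightarrow> real"

definition coords :: "nat \<Rightarrow> nat \<Rightarrow> (nat \<times> nat) set" where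
  "coords N d = {..<N} \<times> {..<d}"

definition inner_cfg :: "nat \<Rightarrow> nat \<Rightarrow> config \<Rightarrow> config \<Rightarrow> real" where
  "inner_cfg N d x y = (\<Sum>i<N. \<Sum>k<d. x i k * y i k)"

definition norm_cfg :: "nat \<Rightarrow> nat \<Rightarrow> config \<Rightarrow> real" where
  "norm_cfg N d x = sqrt (inner_cfg N d x x)"

definition pdist :: "nat \<Rightarrow> config \<Rightarrow> nat \<Rightarrow> nat \<Rightarrow> real" where
  "pdist d x i i' = L2_set (\<lambda>k. x i' k - x i k) {..<d}"

definition drift :: "nat \<Rightarrow> nat \<Rightarrow> (real \<Rightarrow> real) \<Rightarrow> config \<Rightarrow> config" where
  "drift N d \<phi> x = (\<lambda>i k. (1 / real N) * (\<Sum>i'<N. \<phi> (pdist d x i i') * (x i' k - x i k)))"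


section \<open>Kernels on the half-line\<close>

text \<open>
  Kernels are functions on \<open>{0..}\<close>; values at negative arguments are never used.
  On intervals, derivatives are taken within the interval, i.e. one-sided at end points.
  The supremum norm below is meaningful only for functions that are bounded on \<open>A\<close>.
\<close>

definition sup_norm :: "real set \<Rightarrow> (real \<Rightarrow> real) \<Rightarrow> real" where
  "sup_norm A f = (SUP r\<in>A. \<bar>f r\<bar>)"

definition deriv_in :: "real set \<Rightarrow> (real \<Rightarrow> real) \<Rightarrow> real \<Rightarrow> real" where
  "deriv_in A f r = vector_derivative f (at r within A)"

definition C1_in :: "real set \<Rightarrow> (real \<Rightarrow> real) \<Rightarrow> bool" where
  "C1_in A f \<longleftrightarrow> f differentiable_on A \<and> continuous_on A (deriv_in A f)"

definition C11_in :: "real set \<Rightarrow> (real \<Rightarrow> real) \<Rightarrow> bool" where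
  "C11_in A f \<longleftrightarrow> C1_in A f \<and> (\<exists>K. K-lipschitz_on A (deriv_in A f))"

definition admissible :: "real \<Rightarrow> real \<Rightarrow> (real \<Rightarrow> real) set" where
  "admissible R S = {\<phi>. C1_in {0..} \<phi> \<and> closure {r \<in> {0..}. \<phi> r \<noteq> 0} \<subseteq> {0..R} \<and>
     sup_norm {0..} \<phi> + sup_norm {0..} (deriv_in {0..} \<phi>) \<le> S}"

text \<open>
  Elements of \<open>C\<^sup>1\<^sup>,\<^sup>1([0,R])\<close>, extended by 0 outside \<open>[0,R]\<close>; the extension may jump at \<open>R\<close>.
\<close>

definition C11_ext :: "real \<Rightarrow> (real \<Rightarrow> real) set" where
  "C11_ext R = {\<phi>. C11_in {0..R} \<phi> \<and> (\<forall>r. r \<notin> {0..R} \<longrightarrow> \<phi> r = 0)}"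

global_interpretation funs: vector_space "\<lambda>(c::real) (f::real \<Rightarrow> real) r. c * f r"
  by unfold_locales (auto simp: fun_eq_iff algebra_simps)

definition finite_dim_subspace :: "(real \<Rightarrow> real) set \<Rightarrow> bool" where
  "finite_dim_subspace V \<longleftrightarrow> funs.subspace V \<and> (\<exists>B. finite B \<and> V = funs.span B)"


section \<open>Brownian motion and the observed system\<close>

definition state_space :: "nat \<Rightarrow> nat \<Rightarrow> (nat \<times> nat \<Rightarrow> real) measure" where
  "state_space N d = PiM (coords N d) (\<lambda>_. borel)"

definition state :: "nat \<Rightarrow> nat \<Rightarrow> config \<Rightarrow> nat \<times> nat \<Rightarrow> real" where
  "state N d x = (\<lambda>(i, k)\<in>coords N d. x i k)"

definition path_space :: "nat \<Rightarrow> nat \<Rightarrow> real \<Rightarrow> (real \<times> nat \<times> nat \<Rightarrow> real) measure" where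
  "path_space N d t = PiM ({0..t} \<times> coords N d) (\<lambda>_. borel)"

definition path :: "nat \<Rightarrow> nat \<Rightarrow> real \<Rightarrow> (real \<Rightarrow> 'w \<Rightarrow> config) \<Rightarrow> 'w \<Rightarrow> real \<times> nat \<times> nat \<Rightarrow> real" where
  "path N d t X \<omega> = (\<lambda>(u, i, k)\<in>{0..t} \<times> coords N d. X u \<omega> i k)"

definition continuous_process ::
    "'w measure \<Rightarrow> nat \<Rightarrow> nat \<Rightarrow> real \<Rightarrow> (real \<Rightarrow> 'w \<Rightarrow> config) \<Rightarrow> bool" where
  "continuous_process P N d T X \<longleftrightarrow>
     (\<forall>i<N. \<forall>k<d. (\<forall>t\<in>{0..T}. (\<lambda>\<omega>. X t \<omega> i k) \<in> borel_measurable P) \<and>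
                  (\<forall>\<omega>\<in>space P. continuous_on {0..T} (\<lambda>t. X t \<omega> i k)))"

text \<open>
  Increments over the intervals of any partition are independent, jointly over intervals and
  coordinates, and the increment from \<open>u\<close> to \<open>t\<close> of each coordinate is \<open>N(0, t - u)\<close>.
\<close>

definition brownian_motion ::
    "'w measure \<Rightarrow> nat \<Rightarrow> nat \<Rightarrow> real \<Rightarrow> (real \<Rightarrow> 'w \<Rightarrow> config) \<Rightarrow> bool" where
  "brownian_motion P N d T B \<longleftrightarrow>
     continuous_process P N d T B \<and>
     (AE \<omega> in P. \<forall>i<N. \<forall>k<d. B 0 \<omega> i k = 0) \<and>
     (\<forall>i<N. \<forall>k<d. \<forall>u t. 0 \<le> u \<and> u < t \<and> t \<le> T \<longrightarrow>
        distributed P lborel (\<lambda>\<omega>. B t \<omega> i k - B u \<omega> i k) (normal_density 0 (sqrt (t - u)))) \<and>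
     (\<forall>K. \<forall>\<tau>::nat \<Rightarrow> real. mono_on {..K} \<tau> \<and> \<tau> ` {..K} \<subseteq> {0..T} \<longrightarrow>
        prob_space.indep_vars P (\<lambda>_. borel)
          (\<lambda>(j, i, k) \<omega>. B (\<tau> (Suc j)) \<omega> i k - B (\<tau> j) \<omega> i k) ({..<K} \<times> coords N d))"

text \<open>
  The system \<open>dX = f_\<phi>(X) dt + \<sigma> dB\<close> on \<open>[0,T]\<close>. As the noise is additive, the equation is a pathwise
  integral equation. For a Lipschitz drift its solution is a functional of \<open>X 0\<close> and \<open>B\<close>,
  so no separate adaptedness condition is needed.
\<close>

definition observed_system ::
    "nat \<Rightarrow> nat \<Rightarrow> real \<Rightarrow> real \<Rightarrow> (real \<Rightarrow> real) \<Rightarrow> (nat \<times> nat \<Rightarrow> real) measure \<Rightarrow>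
     'w measure \<Rightarrow> (real \<Rightarrow> 'w \<Rightarrow> config) \<Rightarrow> (real \<Rightarrow> 'w \<Rightarrow> config) \<Rightarrow> bool" where
  "observed_system N d \<sigma> T \<phi> \<mu>0 P B X \<longleftrightarrow>
     prob_space P \<and>
     brownian_motion P N d T B \<and>
     continuous_process P N d T X \<and>
     distr P (state_space N d) (\<lambda>\<omega>. state N d (X 0 \<omega>)) = \<mu>0 \<and>
     (\<integral>\<^sup>+x. ennreal (\<Sum>p\<in>coords N d. (x p)\<^sup>2) \<partial>\<mu>0) < \<infinity> \<and>
     prob_space.indep_set P
       (sets (vimage_algebra (space P) (\<lambda>\<omega>. state N d (X 0 \<omega>)) (state_space N d)))
       (sets (vimage_algebra (space P) (path N d T B) (path_space N d T))) \<and>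
     (AE \<omega> in P. \<forall>t\<in>{0..T}. \<forall>i<N. \<forall>k<d.
        X t \<omega> i k = X 0 \<omega> i k + (LINT u:{0..t}|lborel. drift N d \<phi> (X u \<omega>) i k) + \<sigma> * B t \<omega> i k)"

definition independent_copies ::
    "nat \<Rightarrow> nat \<Rightarrow> real \<Rightarrow> 'w measure \<Rightarrow> (real \<Rightarrow> 'w \<Rightarrow> config) \<Rightarrow>
     'v measure \<Rightarrow> nat \<Rightarrow> (nat \<Rightarrow> real \<Rightarrow> 'v \<Rightarrow> config) \<Rightarrow> bool" where
  "independent_copies N d T P X Q M Xs \<longleftrightarrow>
     (\<forall>m\<in>{1..M}. distr Q (path_space N d T) (path N d T (Xs m)) =
                 distr P (path_space N d T) (path N d T X)) \<and>
     prob_space.indep_vars Q (\<lambda>_. path_space N d T) (\<lambda>m. path N d T (Xs m)) {1..M}"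


section \<open>Measure, norm and coercivity\<close>

text \<open>\<open>E[\<delta>_r(A)]\<close>, for a random \<open>r\<close>, is written as the expectation of the indicator of \<open>A\<close> at \<open>r\<close>.\<close>

definition rho :: "nat \<Rightarrow> nat \<Rightarrow> real \<Rightarrow> 'w measure \<Rightarrow> (real \<Rightarrow> 'w \<Rightarrow> config) \<Rightarrow> real measure" where
  "rho N d T P X = measure_of UNIV (sets borel)
     (\<lambda>A. ennreal (1 / (real (N choose 2) * T)) *
       (\<integral>\<^sup>+t\<in>{0..T}. (\<Sum>(i, i')\<in>{(i, i'). i < i' \<and> i' < N}.
          \<integral>\<^sup>+\<omega>. indicator A (pdist d (X t \<omega>) i i') \<partial>P) \<partial>lborel))"

definition tri_norm :: "real measure \<Rightarrow> (real \<Rightarrow> real) \<Rightarrow> real" where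
  "tri_norm \<rho> \<phi> = sqrt (LINT r:{0..}|\<rho>. \<bar>\<phi> r * r\<bar>\<^sup>2)"

definition coercive ::
    "nat \<Rightarrow> nat \<Rightarrow> real \<Rightarrow> real \<Rightarrow> 'w measure \<Rightarrow> (real \<Rightarrow> 'w \<Rightarrow> config) \<Rightarrow>
     (real \<Rightarrow> real) set \<Rightarrow> real \<Rightarrow> bool" where
  "coercive N d \<sigma> T P X H c \<longleftrightarrow>
     (\<forall>\<phi>\<in>H. set_integrable (rho N d T P X) {0..} (\<lambda>r. \<bar>\<phi> r * r\<bar>\<^sup>2) \<longrightarrow>
        c * (tri_norm (rho N d T P X) \<phi>)\<^sup>2 \<le>
          1 / (2 * \<sigma>\<^sup>2 * real N * T) *
          (LINT t:{0..T}|lborel. \<Sum>i<N. LINT \<omega>|P. (L2_set (drift N d \<phi> (X t \<omega>) i) {..<d})\<^sup>2))"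


section \<open>Stochastic integrals\<close>

definition history ::
    "nat \<Rightarrow> nat \<Rightarrow> 'w measure \<Rightarrow> (real \<Rightarrow> 'w \<Rightarrow> config) \<Rightarrow> real \<Rightarrow> 'w measure" where
  "history N d P X t = vimage_algebra (space P) (path N d t X) (path_space N d t)"

text \<open>
  A simple process takes the bounded, \<open>history (\<tau> j)\<close>-measurable value \<open>\<xi> j\<close> on \<open>(\<tau> j, \<tau> (j + 1)]\<close>.
\<close>

definition simple_data ::
    "nat \<Rightarrow> nat \<Rightarrow> real \<Rightarrow> 'w measure \<Rightarrow> (real \<Rightarrow> 'w \<Rightarrow> config) \<Rightarrow>
     nat \<Rightarrow> (nat \<Rightarrow> real) \<Rightarrow> (nat \<Rightarrow> 'w \<Rightarrow> config) \<Rightarrow> bool" where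
  "simple_data N d T P X K \<tau> \<xi> \<longleftrightarrow>
     \<tau> 0 = 0 \<and> \<tau> K = T \<and> mono_on {..K} \<tau> \<and>
     (\<forall>j<K. \<forall>i<N. \<forall>k<d. (\<lambda>\<omega>. \<xi> j \<omega> i k) \<in> borel_measurable (history N d P X (\<tau> j)) \<and>
                          (\<exists>c. \<forall>\<omega>\<in>space P. \<bar>\<xi> j \<omega> i k\<bar> \<le> c))"

definition simple_process ::
    "nat \<Rightarrow> (nat \<Rightarrow> real) \<Rightarrow> (nat \<Rightarrow> 'w \<Rightarrow> config) \<Rightarrow> real \<Rightarrow> 'w \<Rightarrow> config" where
  "simple_process K \<tau> \<xi> t \<omega> = (\<lambda>i k. \<Sum>j<K. indicator {\<tau> j<..\<tau> (Suc j)} t * \<xi> j \<omega> i k)"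

definition simple_integral ::
    "nat \<Rightarrow> nat \<Rightarrow> (real \<Rightarrow> 'w \<Rightarrow> config) \<Rightarrow>
     nat \<Rightarrow> (nat \<Rightarrow> real) \<Rightarrow> (nat \<Rightarrow> 'w \<Rightarrow> config) \<Rightarrow> 'w \<Rightarrow> real" where
  "simple_integral N d X K \<tau> \<xi> \<omega> =
     (\<Sum>j<K. inner_cfg N d (\<xi> j \<omega>) (\<lambda>i k. X (\<tau> (Suc j)) \<omega> i k - X (\<tau> j) \<omega> i k))"

text \<open>
  \<open>I\<close> is a version of the Ito integral of \<open>H\<close> against \<open>X\<close> over \<open>[0,T]\<close>: the \<open>L\<^sup>2(P)\<close>-limit of the
  integrals of simple processes tending to \<open>H\<close> in \<open>L\<^sup>2(dt \<times> P)\<close>. When \<open>X\<close> has a bounded drift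
  and constant diffusion, as here, this agrees with the integral against \<open>drift dt + \<sigma> dB\<close>.
  Riemann sums of \<open>H\<close> itself would not do, since \<open>H = f_\<phi>(X)\<close> need not be continuous.
\<close>

definition has_ito_integral ::
    "nat \<Rightarrow> nat \<Rightarrow> real \<Rightarrow> 'w measure \<Rightarrow> (real \<Rightarrow> 'w \<Rightarrow> config) \<Rightarrow>
     (real \<Rightarrow> 'w \<Rightarrow> config) \<Rightarrow> ('w \<Rightarrow> real) \<Rightarrow> bool" where
  "has_ito_integral N d T P X H I \<longleftrightarrow>
     I \<in> borel_measurable P \<and>
     (\<exists>K \<tau> \<xi>. (\<forall>n::nat. simple_data N d T P X (K n) (\<tau> n) (\<xi> n)) \<and>
       (\<lambda>n. \<integral>\<^sup>+t\<in>{0..T}. (\<integral>\<^sup>+\<omega>. ennreal ((norm_cfg N d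
          (\<lambda>i k. simple_process (K n) (\<tau> n) (\<xi> n) t \<omega> i k - H t \<omega> i k))\<^sup>2) \<partial>P) \<partial>lborel)
         \<longlonglongrightarrow> 0 \<and>
       (\<lambda>n. \<integral>\<^sup>+\<omega>. ennreal ((simple_integral N d X (K n) (\<tau> n) (\<xi> n) \<omega> - I \<omega>)\<^sup>2) \<partial>P)
         \<longlonglongrightarrow> 0)"


section \<open>Error functional and its minimizers\<close>

text \<open>
  \<open>J m \<phi>\<close> stands for a version of the stochastic integral of \<open>f_\<phi>(X\<^sup>(\<^sup>m\<^sup>))\<close> against \<open>X\<^sup>(\<^sup>m\<^sup>)\<close>. Each such
  integral is determined only up to a null set, whereas a minimizer compares uncountably many
  \<open>\<phi>\<close> for a fixed outcome. On a finite-dimensional space \<open>V\<close> the versions are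
  chosen as usual: fix them on a basis and extend linearly. Two such choices agree,
  outside one null set, for all elements of \<open>V\<close> at once.
\<close>

definition linear_ito_versions ::
    "nat \<Rightarrow> nat \<Rightarrow> real \<Rightarrow> 'v measure \<Rightarrow> nat \<Rightarrow> (nat \<Rightarrow> real \<Rightarrow> 'v \<Rightarrow> config) \<Rightarrow>
     (real \<Rightarrow> real) set \<Rightarrow> (nat \<Rightarrow> (real \<Rightarrow> real) \<Rightarrow> 'v \<Rightarrow> real) \<Rightarrow> bool" where
  "linear_ito_versions N d T Q M Xs V J \<longleftrightarrow>
     (\<forall>m\<in>{1..M}.
        (\<forall>\<phi>\<in>V. has_ito_integral N d T Q (Xs m) (\<lambda>t \<omega>. drift N d \<phi> (Xs m t \<omega>)) (J m \<phi>)) \<and>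
        (AE \<omega> in Q. \<forall>\<phi>\<in>V. \<forall>\<psi>\<in>V. \<forall>a b.
           J m (\<lambda>r. a * \<phi> r + b * \<psi> r) \<omega> = a * J m \<phi> \<omega> + b * J m \<psi> \<omega>))"

definition path_error ::
    "nat \<Rightarrow> nat \<Rightarrow> real \<Rightarrow> real \<Rightarrow> (real \<Rightarrow> 'v \<Rightarrow> config) \<Rightarrow>
     ((real \<Rightarrow> real) \<Rightarrow> 'v \<Rightarrow> real) \<Rightarrow> (real \<Rightarrow> real) \<Rightarrow> 'v \<Rightarrow> real" where
  "path_error N d \<sigma> T X J \<phi> \<omega> =
     1 / (2 * \<sigma>\<^sup>2 * T * real N) *
       ((LINT t:{0..T}|lborel. (norm_cfg N d (drift N d \<phi> (X t \<omega>)))\<^sup>2) - 2 * J \<phi> \<omega>)"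

definition empirical_error ::
    "nat \<Rightarrow> nat \<Rightarrow> real \<Rightarrow> real \<Rightarrow> nat \<Rightarrow> (nat \<Rightarrow> real \<Rightarrow> 'v \<Rightarrow> config) \<Rightarrow>
     (nat \<Rightarrow> (real \<Rightarrow> real) \<Rightarrow> 'v \<Rightarrow> real) \<Rightarrow> (real \<Rightarrow> real) \<Rightarrow> 'v \<Rightarrow> real" where
  "empirical_error N d \<sigma> T M Xs J \<phi> \<omega> =
     (1 / real M) * (\<Sum>m=1..M. path_error N d \<sigma> T (Xs m) (J m) \<phi> \<omega>)"

text \<open>A (measurably chosen) random function that almost surely minimizes the empirical error.\<close>

definition minimizing_estimator ::
    "'v measure \<Rightarrow> ((real \<Rightarrow> real) \<Rightarrow> 'v \<Rightarrow> real) \<Rightarrow> (real \<Rightarrow> real) set \<Rightarrow>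
     ('v \<Rightarrow> real \<Rightarrow> real) \<Rightarrow> bool" where
  "minimizing_estimator Q err H est \<longleftrightarrow>
     (\<forall>r. (\<lambda>\<omega>. est \<omega> r) \<in> borel_measurable Q) \<and>
     (AE \<omega> in Q. est \<omega> \<in> H \<and> (\<forall>\<phi>\<in>H. err (est \<omega>) \<omega> \<le> err \<phi> \<omega>))"

end

theory Submission
  imports Defs
begin

text \<open>
  Write the empirical error as a quadratic form. As \<open>X\<close> solves the equation, it equals, up to a constant,
  \<open>|h - \<phi>|\<^sup>2\<close> in the empirical energy norm minus twice a term \<open>W h\<close> that is linear in \<open>h\<close> and is a
  stochastic integral against the noise. Minimality of the estimator therefore bounds the empirical energy of
  \<open>g = est - \<psi>\<close>, where \<open>\<psi>\<close> approximates \<open>\<phi>\<close>, by that of \<open>\<psi> - \<phi>\<close> plus \<open>W g\<close>.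

  Take a basis that is orthonormal for the population energy form. By the Ito isometry each coefficient of \<open>W\<close>
  has variance of order \<open>1/M\<close>, so \<open>W\<close> costs \<open>D/M\<close> on a space of dimension \<open>D\<close>. Population and empirical energies
  are compared on a net of about \<open>M\<^sup>D\<close> points in the same coordinates, where the Laplace transform of a bounded
  nonnegative variable gives a one-sided deviation of order \<open>D ln M / M\<close>. Coercivity turns energies into the
  norm of the claim, and \<open>D\<close> of order \<open>(M / ln M) powr (1 / (2 s + 1))\<close> balances both errors.

  The isometry needs increments of \<open>B\<close> to be independent of the past of \<open>X\<close>. Euler schemes exhibit \<open>X\<close> up to time \<open>t\<close>,
  outside a null set, as a limit of functions of \<open>X 0\<close> and of \<open>B\<close> up to time \<open>t\<close>.
\<close>

section \<open>Configurations\<close>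

text \<open>The two random terms call for different tools. \<open>W\<close> is unbounded and defined
  only up to null sets, so a union bound over a net is unsuited to it; but it is linear, and against
  an energy form of dimension D it is controlled by D squared coefficients, that is, by second
  moments. The empirical energy is quadratic but bounded and nonnegative, so a net is affordable.
  There it suffices to exclude that the population energy is much larger than twice the empirical
  one; this one-sided event has a deviation of order 1/M instead of 1/sqrt M, which is what makes
  the rate attainable.

  The energy form may degenerate on the hypothesis space. Its orthonormal bases may therefore
  contain vectors of length 0, along which the empirical form and \<open>W\<close> vanish almost
  surely.

  Coercivity alone would give one factor 1/cL. The second one appears because the norm also
  dominates the energy: this forces \<open>cL\<close> to be at most 1/(2 \<sigma>^2) as soon as some
  element of the spaces has positive norm, so every error term can be written with 1/cL^2.\<close>

lemma inner_cfg_nonneg: "inner_cfg N d x x \<ge> 0"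
  by (auto simp: inner_cfg_def intro!: sum_nonneg)

lemma norm_cfg_sq: "(norm_cfg N d x)\<^sup>2 = inner_cfg N d x x"
  by (simp add: norm_cfg_def inner_cfg_nonneg)

lemma inner_cfg_commute: "inner_cfg N d x y = inner_cfg N d y x"
  by (simp add: inner_cfg_def mult.commute)

lemma inner_cfg_coords: "inner_cfg N d x y = (\<Sum>(i, k)\<in>coords N d. x i k * y i k)"
  by (simp add: inner_cfg_def coords_def sum.cartesian_product)

lemma finite_coords [simp]: "finite (coords N d)"
  by (simp add: coords_def)

lemma inner_cfg_lincomb:
  "inner_cfg N d (\<lambda>i k. a * x i k + b * y i k) z = a * inner_cfg N d x z + b * inner_cfg N d y z"
  by (simp add: inner_cfg_def sum.distrib sum_distrib_left algebra_simps)

lemma inner_cfg_Cauchy_Schwarz: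
  "(inner_cfg N d x y)\<^sup>2 \<le> inner_cfg N d x x * inner_cfg N d y y"
  using Cauchy_Schwarz_ineq_sum[of "\<lambda>p. x (fst p) (snd p)" "\<lambda>p. y (fst p) (snd p)" "coords N d"]
  by (simp add: inner_cfg_coords case_prod_beta power2_eq_square)

lemma inner_cfg_add_le:
  "inner_cfg N d (\<lambda>i k. x i k + y i k) (\<lambda>i k. x i k + y i k)
     \<le> 2 * inner_cfg N d x x + 2 * inner_cfg N d y y"
proof -
  have "(a + b) * (a + b) \<le> 2 * (a * a) + 2 * (b * b)" for a b :: real
    using sum_squares_ge_zero[of "a - b" 0] by (simp add: algebra_simps)
  then show ?thesis
    unfolding inner_cfg_def sum_distrib_left sum.distrib[symmetric]
    by (intro sum_mono) simp
qed

lemma pdist_nonneg [simp]: "pdist d x i i' \<ge> 0"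
  by (simp add: pdist_def L2_set_nonneg)

lemma pdist_commute: "pdist d x i i' = pdist d x i' i"
  by (simp add: pdist_def L2_set_def power2_commute)

lemma pdist_self [simp]: "pdist d x i i = 0"
  by (simp add: pdist_def L2_set_def)

lemma drift_cong:
  assumes "\<And>r. r \<ge> 0 \<Longrightarrow> h r = g r"
  shows "drift N d h = drift N d g"
  by (intro ext) (simp add: drift_def assms)

lemma drift_lincomb:
  "drift N d (\<lambda>r. a * h r + b * g r) x = (\<lambda>i k. a * drift N d h x i k + b * drift N d g x i k)"
proof (intro ext)
  fix i k
  have "(\<Sum>i'<N. (a * h (pdist d x i i') + b * g (pdist d x i i')) * (x i' k - x i k))
      = a * (\<Sum>i'<N. h (pdist d x i i') * (x i' k - x i k)) + b * (\<Sum>i'<N. g (pdist d x i i') * (x i' k - x i k))"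
    by (simp add: sum_distrib_left sum.distrib[symmetric] distrib_right mult.assoc)
  then show "drift N d (\<lambda>r. a * h r + b * g r) x i k = a * drift N d h x i k + b * drift N d g x i k"
    by (simp add: drift_def add_divide_distrib)
qed

text \<open>Cauchy-Schwarz against the constant 1 in the sum over \<open>i'\<close>; summation over
  the coordinates \<open>k\<close> then rebuilds the squared distances.\<close>

lemma drift_sq_le:
  assumes "N > 0"
  shows "inner_cfg N d (drift N d h x) (drift N d h x)
    \<le> 1 / real N * (\<Sum>i<N. \<Sum>i'<N. (h (pdist d x i i') * pdist d x i i')\<^sup>2)"
proof -
  have "(drift N d h x i k)\<^sup>2 \<le> 1 / real N * (\<Sum>i'<N. (h (pdist d x i i') * (x i' k - x i k))\<^sup>2)" for i k
  proof -
    have "(\<Sum>i'<N. h (pdist d x i i') * (x i' k - x i k))\<^sup>2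
        \<le> (\<Sum>i'<N. (h (pdist d x i i') * (x i' k - x i k))\<^sup>2) * real N"
      using Cauchy_Schwarz_ineq_sum[of "\<lambda>i'. h (pdist d x i i') * (x i' k - x i k)" "\<lambda>_. 1" "{..<N}"]
      by (simp add: power2_eq_square)
    then show ?thesis
      using assms by (simp add: drift_def power_mult_distrib power_divide divide_simps power2_eq_square)
  qed
  then have "inner_cfg N d (drift N d h x) (drift N d h x)
      \<le> (\<Sum>i<N. \<Sum>k<d. 1 / real N * (\<Sum>i'<N. (h (pdist d x i i') * (x i' k - x i k))\<^sup>2))"
    unfolding inner_cfg_def by (intro sum_mono) (simp add: power2_eq_square)
  also have "\<dots> = 1 / real N * (\<Sum>i<N. \<Sum>i'<N. \<Sum>k<d. (h (pdist d x i i') * (x i' k - x i k))\<^sup>2)"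
    by (simp add: sum_distrib_left sum.swap[of _ "{..<N}" "{..<d}"])
  also have "\<dots> = 1 / real N * (\<Sum>i<N. \<Sum>i'<N. (h (pdist d x i i') * pdist d x i i')\<^sup>2)"
  proof -
    have "(pdist d x i i')\<^sup>2 = (\<Sum>k<d. (x i' k - x i k)\<^sup>2)" for i i'
      by (simp add: pdist_def L2_set_def sum_nonneg)
    then show ?thesis
      by (simp add: power_mult_distrib sum_distrib_left)
  qed
  finally show ?thesis .
qed

section \<open>Bounded kernels\<close>

text \<open>A common home for the truncated true kernel and for all hypothesis spaces. Continuity is
  not asked, since an extension by 0 may jump at \<open>R\<close>; vanishing at negative arguments
  lets bounds be stated on the whole line.\<close>

definition kernels :: "real \<Rightarrow> (real \<Rightarrow> real) set" where
  "kernels R = {h \<in> borel_measurable borel. (\<exists>c. \<forall>r. \<bar>h r\<bar> \<le> c) \<and> (\<forall>r. r \<notin> {0..R} \<longrightarrow> h r = 0)}"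

lemma kernels_measurable [measurable_dest]: "h \<in> kernels R \<Longrightarrow> h \<in> borel_measurable borel"
  by (simp add: kernels_def)

lemma kernels_lincomb:
  assumes "h \<in> kernels R" "g \<in> kernels R"
  shows "(\<lambda>r. a * h r + b * g r) \<in> kernels R"
proof -
  obtain c c' where c: "\<And>r. \<bar>h r\<bar> \<le> c" "\<And>r. \<bar>g r\<bar> \<le> c'"
    using assms by (auto simp: kernels_def)
  have "\<bar>a * h r + b * g r\<bar> \<le> \<bar>a\<bar> * c + \<bar>b\<bar> * c'" for r
    using mult_left_mono[OF c(1)[of r], of "\<bar>a\<bar>"] mult_left_mono[OF c(2)[of r], of "\<bar>b\<bar>"]
      abs_triangle_ineq[of "a * h r" "b * g r"] by (simp add: abs_mult)
  then show ?thesis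
    using assms by (auto simp: kernels_def)
qed

lemma kernels_diff: "h \<in> kernels R \<Longrightarrow> g \<in> kernels R \<Longrightarrow> (\<lambda>r. h r - g r) \<in> kernels R"
  using kernels_lincomb[of h R g 1 "-1"] by simp

lemma kernels_times_id_le:
  assumes "h \<in> kernels R" "\<And>r. \<bar>h r\<bar> \<le> c" "r \<ge> 0" "R > 0"
  shows "(h r * r)\<^sup>2 \<le> (c * R)\<^sup>2"
proof (cases "r \<le> R")
  case True
  have "\<bar>h r * r\<bar> \<le> c * R"
    unfolding abs_mult using assms(2)[of r] assms True by (intro mult_mono) (auto intro: order_trans[OF abs_ge_zero])
  then show ?thesis
    by (metis abs_le_square_iff abs_of_nonneg abs_ge_zero order_trans)
next
  case False
  then have "h r = 0"
    using assms by (auto simp: kernels_def)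
  then show ?thesis
    by simp
qed

lemma drift_sq_bound:
  assumes "N > 0" "h \<in> kernels R" "\<And>r. \<bar>h r\<bar> \<le> c" "R > 0"
  shows "inner_cfg N d (drift N d h x) (drift N d h x) \<le> real N * (c * R)\<^sup>2"
proof -
  have "inner_cfg N d (drift N d h x) (drift N d h x) \<le> 1 / real N * (\<Sum>i<N. \<Sum>i'<N. (c * R)\<^sup>2)"
    by (rule order_trans[OF drift_sq_le[OF \<open>N > 0\<close>]] mult_left_mono sum_mono
        kernels_times_id_le[OF assms(2,3) _ \<open>R > 0\<close>])+ auto
  then show ?thesis
    using assms by (simp add: divide_simps mult_ac)
qed

lemma pdist_measurable:
  assumes "\<And>i k. i < N \<Longrightarrow> k < d \<Longrightarrow> (\<lambda>\<omega>. Y \<omega> i k) \<in> borel_measurable M" "i < N" "i' < N"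
  shows "(\<lambda>\<omega>. pdist d (Y \<omega>) i i') \<in> borel_measurable M"
proof -
  have "(\<lambda>\<omega>. \<Sum>k<d. (Y \<omega> i' k - Y \<omega> i k)\<^sup>2) \<in> borel_measurable M"
    using assms by (intro borel_measurable_sum borel_measurable_power borel_measurable_diff) auto
  then show ?thesis
    unfolding pdist_def L2_set_def by measurable
qed

lemma drift_measurable:
  assumes "h \<in> borel_measurable borel"
    and "\<And>i k. i < N \<Longrightarrow> k < d \<Longrightarrow> (\<lambda>\<omega>. Y \<omega> i k) \<in> borel_measurable M"
    and "i < N" "k < d"
  shows "(\<lambda>\<omega>. drift N d h (Y \<omega>) i k) \<in> borel_measurable M"
proof -
  have [measurable]: "(\<lambda>\<omega>. pdist d (Y \<omega>) i i') \<in> borel_measurable M" if "i' < N" for i'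
    using assms that by (intro pdist_measurable) auto
  have "(\<lambda>\<omega>. h (pdist d (Y \<omega>) i i') * (Y \<omega> i' k - Y \<omega> i k)) \<in> borel_measurable M" if "i' < N" for i'
    using assms that by (intro borel_measurable_times borel_measurable_diff measurable_compose[OF _ assms(1)]) auto
  then show ?thesis
    unfolding drift_def by (intro borel_measurable_times[OF borel_measurable_const] borel_measurable_sum) auto
qed

lemma inner_cfg_measurable:
  assumes "\<And>i k. i < N \<Longrightarrow> k < d \<Longrightarrow> (\<lambda>\<omega>. Y \<omega> i k) \<in> borel_measurable M"
    and "\<And>i k. i < N \<Longrightarrow> k < d \<Longrightarrow> (\<lambda>\<omega>. Z \<omega> i k) \<in> borel_measurable M"
  shows "(\<lambda>\<omega>. inner_cfg N d (Y \<omega>) (Z \<omega>)) \<in> borel_measurable M"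
  unfolding inner_cfg_def using assms by (intro borel_measurable_sum borel_measurable_times) auto

section \<open>Time integrals of continuous processes\<close>

text \<open>Lebesgue measure on \<open>[0,t]\<close> as a measure space of its own: it is finite,
  which gives Fubini on products with \<open>P\<close> and integrability of bounded
  functions.\<close>

definition time_interval :: "real \<Rightarrow> real measure" where
  "time_interval t = restrict_space lborel {0..t}"

lemma space_time_interval [simp]: "space (time_interval t) = {0..t}"
  by (simp add: time_interval_def space_restrict_space)

lemma emeasure_time_interval: "t \<ge> 0 \<Longrightarrow> emeasure (time_interval t) {0..t} = ennreal t"
  by (simp add: time_interval_def emeasure_restrict_space)

lemma finite_measure_time_interval: "finite_measure (time_interval t)"
  by (rule finite_measureI)
    (cases "t \<ge> 0", auto simp: time_interval_def emeasure_restrict_space space_restrict_space)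

lemma measure_time_interval: "t \<ge> 0 \<Longrightarrow> measure (time_interval t) {0..t} = t"
  by (simp add: measure_def emeasure_time_interval)

lemma set_integral_time_interval: "(LINT u:{0..t}|lborel. f u) = (LINT u|time_interval t. (f u :: real))"
  by (simp add: time_interval_def integral_restrict_space set_lebesgue_integral_def)

lemma set_nn_integral_time_interval:
  "(\<integral>\<^sup>+u\<in>{0..t}. f u \<partial>lborel) = (\<integral>\<^sup>+u. f u \<partial>time_interval t)"
  by (simp add: time_interval_def nn_integral_restrict_space)

lemma measurable_time_interval:
  "f \<in> borel_measurable borel \<Longrightarrow> f \<in> borel_measurable (time_interval t)"
  unfolding time_interval_def by (intro measurable_restrict_space1) simp

text \<open>A process with continuous paths is the pointwise limit of processes that are constant between
  consecutive multiples of \<open>1/n\<close>.\<close>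

lemma continuous_process_jointly_measurable:
  fixes f :: "real \<Rightarrow> 'w \<Rightarrow> real"
  assumes "\<And>u. u \<in> {0..t} \<Longrightarrow> f u \<in> borel_measurable M"
    and "\<And>\<omega>. \<omega> \<in> space M \<Longrightarrow> continuous_on {0..t} (\<lambda>u. f u \<omega>)"
  shows "(\<lambda>(\<omega>, u). f u \<omega>) \<in> borel_measurable (M \<Otimes>\<^sub>M time_interval t)"
proof (cases "t \<ge> 0")
  case True
  \<comment> \<open>The countable case split below ranges over all integers, including those whose
    grid point lies outside \<open>[0,t]\<close>; clamping keeps every piece measurable.\<close>
  define cl where "cl x = max 0 (min t x)" for x
  have cl: "cl x \<in> {0..t}" for x
    using True by (auto simp: cl_def)
  have cl_id: "cl x = x" if "x \<in> {0..t}" for x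
    using that by (auto simp: cl_def)
  let ?g = "\<lambda>n. \<lambda>(\<omega>, u). f (cl (of_int \<lfloor>real (Suc n) * u\<rfloor> / real (Suc n))) \<omega>"
  show ?thesis
  proof (rule borel_measurable_LIMSEQ_real)
    fix n
    have [measurable]: "snd \<in> measurable (M \<Otimes>\<^sub>M time_interval t) borel"
      by (rule measurable_compose[OF measurable_snd measurable_time_interval]) simp
    have "(\<lambda>z. f (cl (of_int \<lfloor>real (Suc n) * snd z\<rfloor> / real (Suc n))) (fst z))
        \<in> borel_measurable (M \<Otimes>\<^sub>M time_interval t)"
    proof (rule measurable_compose_countable[where f = "\<lambda>j z. f (cl (of_int j / real (Suc n))) (fst z)"
            and g = "\<lambda>z. \<lfloor>real (Suc n) * snd z\<rfloor>"])
      show "(\<lambda>z. f (cl (real_of_int i / real (Suc n))) (fst z)) \<in> borel_measurable (M \<Otimes>\<^sub>M time_interval t)" for i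
        using assms(1)[OF cl] by (rule measurable_compose[OF measurable_fst])
    qed measurable
    then show "?g n \<in> borel_measurable (M \<Otimes>\<^sub>M time_interval t)"
      by (simp add: case_prod_beta)
  next
    fix z assume "z \<in> space (M \<Otimes>\<^sub>M time_interval t)"
    then obtain \<omega> u where z: "z = (\<omega>, u)" "\<omega> \<in> space M" "u \<in> {0..t}"
      by (auto simp: space_pair_measure)
    have "(\<lambda>n. of_int \<lfloor>real (Suc n) * u\<rfloor> / real (Suc n)) \<longlonglongrightarrow> u"
    proof (rule real_tendsto_sandwich)
      show "(\<lambda>n. u - 1 / real (Suc n)) \<longlonglongrightarrow> u"
        using tendsto_diff[OF tendsto_const LIMSEQ_inverse_real_of_nat, of u]
        by (simp add: inverse_eq_divide)
      show "\<forall>\<^sub>F n in sequentially. u - 1 / real (Suc n) \<le> of_int \<lfloor>real (Suc n) * u\<rfloor> / real (Suc n)"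
      proof (intro always_eventually allI)
        fix n
        have "(u - 1 / real (Suc n)) * real (Suc n) \<le> of_int \<lfloor>real (Suc n) * u\<rfloor>"
          by (simp add: left_diff_distrib mult.commute[of u])
        then show "u - 1 / real (Suc n) \<le> of_int \<lfloor>real (Suc n) * u\<rfloor> / real (Suc n)"
          by (subst pos_le_divide_eq) simp_all
      qed
      show "\<forall>\<^sub>F n in sequentially. of_int \<lfloor>real (Suc n) * u\<rfloor> / real (Suc n) \<le> u"
        by (intro always_eventually allI) (auto simp: pos_divide_le_eq mult.commute)
    qed (rule tendsto_const)
    then have "(\<lambda>n. cl (of_int \<lfloor>real (Suc n) * u\<rfloor> / real (Suc n))) \<longlonglongrightarrow> cl u"
      unfolding cl_def by (intro tendsto_intros)
    moreover have "continuous_on {0..t} (\<lambda>u. f u \<omega>)"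
      using assms z by auto
    ultimately have "(\<lambda>n. f (cl (of_int \<lfloor>real (Suc n) * u\<rfloor> / real (Suc n))) \<omega>) \<longlonglongrightarrow> f (cl u) \<omega>"
      using cl by (intro continuous_on_tendsto_compose[where f = "\<lambda>u. f u \<omega>"]) auto
    then show "(\<lambda>n. ?g n z) \<longlonglongrightarrow> (case z of (\<omega>, u) \<Rightarrow> f u \<omega>)"
      using z by (simp add: cl_id)
  qed
next
  case False
  then have "space (M \<Otimes>\<^sub>M time_interval t) = {}"
    by (simp add: space_pair_measure)
  then show ?thesis
    by (simp add: measurable_def)
qed

section \<open>Admissible kernels\<close>

lemma sup_norm_upper:
  assumes "\<And>r. r \<in> A \<Longrightarrow> \<bar>f r\<bar> \<le> c" "r \<in> A"
  shows "\<bar>f r\<bar> \<le> sup_norm A f"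
  unfolding sup_norm_def using assms by (intro cSUP_upper bdd_aboveI2[where M = c]) auto

lemma sup_norm_least:
  assumes "A \<noteq> {}" "\<And>r. r \<in> A \<Longrightarrow> \<bar>f r\<bar> \<le> c"
  shows "sup_norm A f \<le> c"
  unfolding sup_norm_def using assms by (intro cSUP_least) auto

lemma admissible_zero:
  assumes "\<phi> \<in> admissible R S" "R > 0" "r > R"
  shows "\<phi> r = 0"
proof (rule ccontr)
  assume "\<phi> r \<noteq> 0"
  then have "r \<in> closure {r \<in> {0..}. \<phi> r \<noteq> 0}"
    using assms by (intro closure_subset[THEN subsetD]) auto
  then show False
    using assms by (auto simp: admissible_def)
qed

lemma admissible_continuous: "\<phi> \<in> admissible R S \<Longrightarrow> continuous_on {0..} \<phi>"
  by (auto simp: admissible_def C1_in_def intro: differentiable_imp_continuous_on)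

text \<open>A supremum in \<open>sup_norm\<close> says nothing until the function is known to be
  bounded, so the bound inside \<open>admissible\<close> cannot be read off directly. Boundedness
  comes from continuity on the compact interval \<open>[0,R]\<close> and from vanishing beyond
  \<open>R\<close>.\<close>

lemma admissible_deriv_bounded:
  assumes "\<phi> \<in> admissible R S" "R > 0"
  obtains K where "K \<ge> 0" "\<And>r. r \<ge> 0 \<Longrightarrow> \<bar>deriv_in {0..} \<phi> r\<bar> \<le> K"
proof -
  have "continuous_on {0..R} (deriv_in {0..} \<phi>)"
    using assms by (auto simp: admissible_def C1_in_def intro: continuous_on_subset)
  then have "bounded (deriv_in {0..} \<phi> ` {0..R})"
    by (intro compact_imp_bounded compact_continuous_image) auto
  then obtain K where K: "K > 0" "\<And>r. r \<in> {0..R} \<Longrightarrow> \<bar>deriv_in {0..} \<phi> r\<bar> \<le> K"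
    by (auto simp: bounded_pos)
  have "deriv_in {0..} \<phi> r = 0" if "r > R" for r
  proof -
    have "((\<lambda>_. 0) has_vector_derivative 0) (at r)"
      by (rule has_vector_derivative_const)
    then have "(\<phi> has_vector_derivative 0) (at r)"
      using that admissible_zero[OF assms]
      by (subst has_vector_derivative_cong_ev[where g = "\<lambda>_. 0"])
        (auto intro!: eventually_mono[OF eventually_nhds_in_open[of "{R<..}"]])
    then have "vector_derivative \<phi> (at r) = 0"
      by (rule vector_derivative_at)
    moreover have "at r within {0..} = at r"
      using that assms by (intro at_within_interior) simp
    ultimately show ?thesis
      by (simp add: deriv_in_def)
  qed
  with K have "\<bar>deriv_in {0..} \<phi> r\<bar> \<le> K" if "r \<ge> 0" for r
    using that by (cases "r \<le> R") (auto simp: less_imp_le)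
  with K show thesis
    by (intro that[of K]) auto
qed

lemma admissible_Lipschitz:
  assumes "\<phi> \<in> admissible R S" "R > 0"
  obtains K where "K \<ge> 0" "\<And>r r'. r \<ge> 0 \<Longrightarrow> r' \<ge> 0 \<Longrightarrow> \<bar>\<phi> r - \<phi> r'\<bar> \<le> K * \<bar>r - r'\<bar>"
proof -
  obtain K where K: "K \<ge> 0" "\<And>r. r \<ge> 0 \<Longrightarrow> \<bar>deriv_in {0..} \<phi> r\<bar> \<le> K"
    using admissible_deriv_bounded[OF assms] by blast
  have "(\<phi> has_vector_derivative deriv_in {0..} \<phi> r) (at r within {0..})" if "r \<ge> 0" for r
    using assms that
    by (auto simp: admissible_def C1_in_def differentiable_on_def deriv_in_def vector_derivative_works)
  then have "\<bar>\<phi> r - \<phi> r'\<bar> \<le> K * \<bar>r - r'\<bar>" if "r \<ge> 0" "r' \<ge> 0" for r r'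
    using that K field_differentiable_bound[of "{0..}" \<phi> "deriv_in {0..} \<phi>" K r r']
    by (auto simp: has_real_derivative_iff_has_vector_derivative)
  with K show thesis
    by (intro that[of K]) auto
qed

lemma admissible_bound:
  assumes "\<phi> \<in> admissible R S" "R > 0" "r \<ge> 0"
  shows "\<bar>\<phi> r\<bar> \<le> S"
proof -
  obtain K where K: "K \<ge> 0" "\<And>r. r \<ge> 0 \<Longrightarrow> \<bar>deriv_in {0..} \<phi> r\<bar> \<le> K"
    using admissible_deriv_bounded[OF assms(1,2)] by blast
  have "continuous_on {0..R} \<phi>"
    using admissible_continuous[OF assms(1)] by (rule continuous_on_subset) auto
  then have "bounded (\<phi> ` {0..R})"
    by (intro compact_imp_bounded compact_continuous_image) auto
  then obtain c where c: "c > 0" "\<And>r. r \<in> {0..R} \<Longrightarrow> \<bar>\<phi> r\<bar> \<le> c"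
    by (auto simp: bounded_pos)
  then have "\<bar>\<phi> r\<bar> \<le> c" if "r \<ge> 0" for r
    using that admissible_zero[OF assms(1,2), of r] by (cases "r \<le> R") auto
  then have "\<bar>\<phi> r\<bar> \<le> sup_norm {0..} \<phi>"
    using assms by (intro sup_norm_upper) auto
  moreover have "0 \<le> sup_norm {0..} (deriv_in {0..} \<phi>)"
    using sup_norm_upper[of "{0..}" "deriv_in {0..} \<phi>" K 0] K by (auto intro: order_trans[OF abs_ge_zero])
  moreover have "sup_norm {0..} \<phi> + sup_norm {0..} (deriv_in {0..} \<phi>) \<le> S"
    using assms by (simp add: admissible_def)
  ultimately show ?thesis
    by linarith
qed

text \<open>At negative arguments \<open>\<phi>\<close> is arbitrary. Cutting it off places it in
  \<open>kernels R\<close> and leaves every drift unchanged, because distances are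
  nonnegative.\<close>

definition truncate :: "real \<Rightarrow> (real \<Rightarrow> real) \<Rightarrow> real \<Rightarrow> real" where
  "truncate R \<phi> r = (if r \<in> {0..R} then \<phi> r else 0)"

lemma truncate_in_kernels:
  assumes "continuous_on {0..R} \<phi>"
  shows "truncate R \<phi> \<in> kernels R"
proof -
  have "(\<lambda>r. indicator {0..R} r *\<^sub>R \<phi> r) \<in> borel_measurable borel"
    using assms by (intro borel_measurable_continuous_on_indicator) auto
  moreover have "(\<lambda>r. indicator {0..R} r *\<^sub>R \<phi> r) = truncate R \<phi>"
    by (auto simp: truncate_def fun_eq_iff)
  moreover obtain c where "c > 0" "\<And>r. r \<in> {0..R} \<Longrightarrow> \<bar>\<phi> r\<bar> \<le> c"
    using compact_imp_bounded[OF compact_continuous_image[OF assms compact_Icc]] by (auto simp: bounded_pos)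
  ultimately show ?thesis
    by (auto simp: kernels_def truncate_def intro!: exI[of _ c])
qed

lemma truncate_admissible:
  assumes "\<phi> \<in> admissible R S" "R > 0"
  shows "truncate R \<phi> \<in> kernels R" "\<And>r. r \<ge> 0 \<Longrightarrow> truncate R \<phi> r = \<phi> r" "\<And>r. \<bar>truncate R \<phi> r\<bar> \<le> S"
    "drift N d (truncate R \<phi>) = drift N d \<phi>"
proof -
  show "truncate R \<phi> \<in> kernels R"
    using admissible_continuous[OF assms(1)] by (intro truncate_in_kernels) (auto intro: continuous_on_subset)
  show *: "truncate R \<phi> r = \<phi> r" if "r \<ge> 0" for r
    using that admissible_zero[OF assms, of r] by (auto simp: truncate_def)
  show "\<bar>truncate R \<phi> r\<bar> \<le> S" for r
    using admissible_bound[OF assms, of r] admissible_bound[OF assms, of 0] by (auto simp: truncate_def)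
  show "drift N d (truncate R \<phi>) = drift N d \<phi>"
    using * by (rule drift_cong)
qed

section \<open>Lipschitz continuity of the drift\<close>

text \<open>The l1 distance of configurations, in which coordinatewise error bounds simply add
  up.\<close>

definition dist1 :: "nat \<Rightarrow> nat \<Rightarrow> config \<Rightarrow> config \<Rightarrow> real" where
  "dist1 N d x y = (\<Sum>i<N. \<Sum>k<d. \<bar>x i k - y i k\<bar>)"

lemma dist1_triangle: "dist1 N d x z \<le> dist1 N d x y + dist1 N d y z"
  unfolding dist1_def sum.distrib[symmetric] by (intro sum_mono) auto

lemma dist1_row: "i < N \<Longrightarrow> (\<Sum>k<d. \<bar>x i k - y i k\<bar>) \<le> dist1 N d x y"
  unfolding dist1_def by (rule member_le_sum) (auto intro: sum_nonneg)

lemma dist1_component: "i < N \<Longrightarrow> k < d \<Longrightarrow> \<bar>x i k - y i k\<bar> \<le> dist1 N d x y"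
  by (rule order_trans[OF _ dist1_row[of i]])
    (auto intro!: member_le_sum[where f = "\<lambda>k. \<bar>x i k - y i k\<bar>"])

lemma pdist_diff_le:
  assumes "i < N" "i' < N"
  shows "\<bar>pdist d x i i' - pdist d y i i'\<bar> \<le> 2 * dist1 N d x y"
proof -
  let ?u = "\<lambda>x k. x i' k - x i k :: real"
  have tri: "L2_set (?u x) {..<d} \<le> L2_set (?u y) {..<d} + L2_set (\<lambda>k. ?u x k - ?u y k) {..<d}" for x y
    using L2_set_triangle_ineq[of "?u y" "\<lambda>k. ?u x k - ?u y k" "{..<d}"] by simp
  have "L2_set (\<lambda>k. ?u x k - ?u y k) {..<d} \<le> 2 * dist1 N d x y" for x y
  proof -
    have "L2_set (\<lambda>k. ?u x k - ?u y k) {..<d} \<le> (\<Sum>k<d. \<bar>?u x k - ?u y k\<bar>)"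
      by (rule L2_set_le_sum_abs)
    also have "\<dots> \<le> (\<Sum>k<d. \<bar>x i' k - y i' k\<bar> + \<bar>x i k - y i k\<bar>)"
      by (intro sum_mono) auto
    also have "\<dots> \<le> 2 * dist1 N d x y"
      using dist1_row[OF assms(1), of x y d] dist1_row[OF assms(2), of x y d] by (simp add: sum.distrib)
    finally show ?thesis .
  qed
  from this[of x y] this[of y x] tri[of x y] tri[of y x] show ?thesis
    by (auto simp: pdist_def dist1_def abs_minus_commute)
qed

text \<open>The map u -> \<phi>(|u|) u is Lipschitz although u is unbounded. If one of the two
  distances is at most \<open>R\<close>, the difference of kernel values is multiplied by the
  coordinate that belongs to this distance; if neither is, both terms vanish.\<close>

lemma drift_Lipschitz:
  assumes "\<phi> \<in> admissible R S" "R > 0"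
  obtains L where "L \<ge> 0"
    "\<And>x y i k. i < N \<Longrightarrow> k < d \<Longrightarrow> \<bar>drift N d \<phi> x i k - drift N d \<phi> y i k\<bar> \<le> L * dist1 N d x y"
proof -
  obtain K where K: "K \<ge> 0" "\<And>r r'. r \<ge> 0 \<Longrightarrow> r' \<ge> 0 \<Longrightarrow> \<bar>\<phi> r - \<phi> r'\<bar> \<le> K * \<bar>r - r'\<bar>"
    using admissible_Lipschitz[OF assms] by blast
  have S: "S \<ge> 0"
    using admissible_bound[OF assms, of 0] by simp
  have one: "\<bar>\<phi> r * u - \<phi> r' * v\<bar> \<le> K * \<bar>r - r'\<bar> * R + S * \<bar>u - v\<bar>"
    if "r \<ge> 0" "0 \<le> r'" "r' \<le> R" "\<bar>v\<bar> \<le> r'" for r r' u v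
  proof -
    have "\<phi> r * u - \<phi> r' * v = (\<phi> r - \<phi> r') * v + \<phi> r * (u - v)"
      by (simp add: algebra_simps)
    also have "\<bar>\<dots>\<bar> \<le> \<bar>\<phi> r - \<phi> r'\<bar> * \<bar>v\<bar> + \<bar>\<phi> r\<bar> * \<bar>u - v\<bar>"
      by (metis abs_mult abs_triangle_ineq)
    also have "\<dots> \<le> K * \<bar>r - r'\<bar> * R + S * \<bar>u - v\<bar>"
      using that K S admissible_bound[OF assms, of r] by (intro add_mono mult_mono) auto
    finally show ?thesis .
  qed
  have two: "\<bar>\<phi> r * u - \<phi> r' * v\<bar> \<le> K * \<bar>r - r'\<bar> * R + S * \<bar>u - v\<bar>"
    if "\<bar>u\<bar> \<le> r" "\<bar>v\<bar> \<le> r'" for r r' u v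
  proof -
    have "r \<ge> 0" "r' \<ge> 0"
      using that by auto
    consider "r' \<le> R" | "r \<le> R" | "r > R" "r' > R"
      by linarith
    then show ?thesis
    proof cases
      case 1
      then show ?thesis
        using one[of r r' v u] that \<open>r \<ge> 0\<close> \<open>r' \<ge> 0\<close> by auto
    next
      case 2
      then show ?thesis
        using one[of r' r u v] that \<open>r \<ge> 0\<close> \<open>r' \<ge> 0\<close> by (simp add: abs_minus_commute)
    next
      case 3
      then show ?thesis
        using K S \<open>R > 0\<close> by (simp add: admissible_zero[OF assms])
    qed
  qed
  \<comment> \<open>Distances and coordinate differences each change by at most twice
    \<open>dist1\<close>, whence the two factors 2.\<close>
  define L where "L = 2 * K * R + 2 * S"
  have "\<bar>drift N d \<phi> x i k - drift N d \<phi> y i k\<bar> \<le> L * dist1 N d x y" if ik: "i < N" "k < d" for x y i k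
  proof -
    have summand: "\<bar>\<phi> (pdist d x i i') * (x i' k - x i k) - \<phi> (pdist d y i i') * (y i' k - y i k)\<bar> \<le> L * dist1 N d x y"
      if "i' < N" for i'
    proof -
      have le: "\<bar>z i' k - z i k\<bar> \<le> pdist d z i i'" for z :: config
      proof -
        have "L2_set (\<lambda>k. \<bar>z i' k - z i k\<bar>) {..<d} = pdist d z i i'"
          by (simp add: pdist_def L2_set_def)
        then show ?thesis
          using member_le_L2_set[of "{..<d}" k "\<lambda>k. \<bar>z i' k - z i k\<bar>"] ik by simp
      qed
      have "\<bar>\<phi> (pdist d x i i') * (x i' k - x i k) - \<phi> (pdist d y i i') * (y i' k - y i k)\<bar>
        \<le> K * \<bar>pdist d x i i' - pdist d y i i'\<bar> * R + S * \<bar>(x i' k - x i k) - (y i' k - y i k)\<bar>"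
        by (rule two) (rule le)+
      also have "\<dots> \<le> K * (2 * dist1 N d x y) * R + S * (2 * dist1 N d x y)"
        using K S \<open>R > 0\<close> pdist_diff_le[OF ik(1) that, of d x y]
          dist1_component[OF ik, of x y] dist1_component[OF that ik(2), of x y]
        by (intro add_mono mult_mono) auto
      finally show ?thesis
        by (simp add: L_def algebra_simps)
    qed
    have "\<bar>drift N d \<phi> x i k - drift N d \<phi> y i k\<bar> = \<bar>1 / real N * (\<Sum>i'<N. \<phi> (pdist d x i i') * (x i' k - x i k) - \<phi> (pdist d y i i') * (y i' k - y i k))\<bar>"
      by (simp add: drift_def sum_subtractf diff_divide_distrib)
    also have "\<dots> \<le> 1 / real N * (\<Sum>i'<N. L * dist1 N d x y)"
      unfolding abs_mult using summand
      by (intro mult_mono order_trans[OF sum_abs sum_mono]) auto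
    also have "\<dots> = L * dist1 N d x y"
      using ik by simp
    finally show ?thesis .
  qed
  moreover have "L \<ge> 0"
    using K S assms by (simp add: L_def)
  ultimately show thesis
    by (intro that)
qed

section \<open>Euler approximation\<close>

text \<open>The explicit Euler scheme with exact noise increments. After \<open>j\<close> steps it
  depends only on \<open>x0\<close> and on the increments of \<open>b\<close> over the first
  \<open>j\<close> grid cells.\<close>

primrec euler :: "nat \<Rightarrow> nat \<Rightarrow> (real \<Rightarrow> real) \<Rightarrow> real \<Rightarrow> real \<Rightarrow> config \<Rightarrow> (real \<Rightarrow> config) \<Rightarrow> nat \<Rightarrow> config" where
  "euler N d \<phi> \<sigma> \<delta> x0 b 0 = x0"
| "euler N d \<phi> \<sigma> \<delta> x0 b (Suc j) = (\<lambda>i k. euler N d \<phi> \<sigma> \<delta> x0 b j i k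
     + \<delta> * drift N d \<phi> (euler N d \<phi> \<sigma> \<delta> x0 b j) i k
     + \<sigma> * (b (\<delta> * real (Suc j)) i k - b (\<delta> * real j) i k))"

text \<open>One fixed trajectory. The noise is additive, so its increments cancel in the difference
  of solution and scheme, and only the oscillation of \<open>x\<close> over one step enters the
  error.\<close>

locale integral_path =
  fixes N d :: nat and \<phi> :: "real \<Rightarrow> real" and \<sigma> T L :: real and x b :: "real \<Rightarrow> config"
  assumes L: "L \<ge> 0"
    and Lip: "\<And>x y i k. i < N \<Longrightarrow> k < d \<Longrightarrow> \<bar>drift N d \<phi> x i k - drift N d \<phi> y i k\<bar> \<le> L * dist1 N d x y"
    and cont: "\<And>i k. i < N \<Longrightarrow> k < d \<Longrightarrow> continuous_on {0..T} (\<lambda>t. x t i k)"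
    and eq: "\<And>t i k. t \<in> {0..T} \<Longrightarrow> i < N \<Longrightarrow> k < d \<Longrightarrow>
      x t i k = x 0 i k + (LINT u:{0..t}|lborel. drift N d \<phi> (x u) i k) + \<sigma> * b t i k"
begin

lemma dist1_continuous: "continuous_on {0..T} (\<lambda>t. dist1 N d (x t) y)"
  unfolding dist1_def by (intro continuous_intros cont) auto

lemma dist1_tendsto:
  assumes "s \<in> {0..T}"
  shows "((\<lambda>t. dist1 N d (x t) (x s)) \<longlongrightarrow> 0) (at s within {0..T})"
proof -
  have "dist1 N d (x s) (x s) = 0"
    by (simp add: dist1_def)
  moreover have "((\<lambda>t. dist1 N d (x t) (x s)) \<longlongrightarrow> dist1 N d (x s) (x s)) (at s within {0..T})"
    using dist1_continuous[of "x s"] assms unfolding continuous_on_def by blast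
  ultimately show ?thesis
    by simp
qed

lemma drift_continuous:
  assumes "i < N" "k < d"
  shows "continuous_on {0..T} (\<lambda>t. drift N d \<phi> (x t) i k)"
  unfolding continuous_on_def
proof
  fix s assume s: "s \<in> {0..T}"
  have "((\<lambda>t. drift N d \<phi> (x t) i k - drift N d \<phi> (x s) i k) \<longlongrightarrow> 0) (at s within {0..T})"
  proof (rule Lim_null_comparison)
    show "\<forall>\<^sub>F t in at s within {0..T}. norm (drift N d \<phi> (x t) i k - drift N d \<phi> (x s) i k) \<le> L * dist1 N d (x t) (x s)"
      using Lip assms by (auto intro!: always_eventually)
    show "((\<lambda>t. L * dist1 N d (x t) (x s)) \<longlongrightarrow> 0) (at s within {0..T})"
      using tendsto_mult_left[OF dist1_tendsto[OF s], of L] by simp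
  qed
  then show "((\<lambda>t. drift N d \<phi> (x t) i k) \<longlongrightarrow> drift N d \<phi> (x s) i k) (at s within {0..T})"
    by (simp add: LIM_zero_iff)
qed

lemma drift_integrable:
  assumes "i < N" "k < d" "{s..t} \<subseteq> {0..T}"
  shows "set_integrable lborel {s..t} (\<lambda>u. drift N d \<phi> (x u) i k)"
  using drift_continuous[OF assms(1,2)] assms(3) by (intro borel_integrable_atLeastAtMost') (auto intro: continuous_on_subset)

lemma increment_eq:
  assumes "i < N" "k < d" "0 \<le> s" "s \<le> t" "t \<le> T"
  shows "x t i k - x s i k - \<sigma> * (b t i k - b s i k) = integral {s..t} (\<lambda>u. drift N d \<phi> (x u) i k)"
proof -
  have int: "(LINT u:{0..r}|lborel. drift N d \<phi> (x u) i k) = integral {0..r} (\<lambda>u. drift N d \<phi> (x u) i k)"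
    if "r \<le> T" for r
    using that assms by (intro set_borel_integral_eq_integral drift_integrable) auto
  have "integral {0..s} (\<lambda>u. drift N d \<phi> (x u) i k) + integral {s..t} (\<lambda>u. drift N d \<phi> (x u) i k)
      = integral {0..t} (\<lambda>u. drift N d \<phi> (x u) i k)"
    using assms by (intro Henstock_Kurzweil_Integration.integral_combine integrable_continuous_interval
        continuous_on_subset[OF drift_continuous]) auto
  then show ?thesis
    using eq[of s i k] eq[of t i k] int[of s] int[of t] assms by (simp add: algebra_simps)
qed

text \<open>Discrete Gronwall: adding the oscillation \<open>w\<close> to the error turns an affine
  recursion into a purely multiplicative one.\<close>

lemma euler_step:
  assumes \<delta>: "\<delta> \<ge> 0" "\<delta> * real (Suc j) \<le> T" and w: "w \<ge> 0"
    and osc: "\<And>u. u \<in> {\<delta> * real j..\<delta> * real (Suc j)} \<Longrightarrow> dist1 N d (x u) (x (\<delta> * real j)) \<le> w"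
  defines "e \<equiv> \<lambda>j. dist1 N d (x (\<delta> * real j)) (euler N d \<phi> \<sigma> \<delta> (x 0) b j)"
  defines "c \<equiv> real N * real d * L"
  shows "e (Suc j) + w \<le> (1 + c * \<delta>) * (e j + w)"
proof -
  let ?y = "euler N d \<phi> \<sigma> \<delta> (x 0) b"
  let ?s = "\<delta> * real j" and ?t = "\<delta> * real (Suc j)"
  have st: "0 \<le> ?s" "?s \<le> ?t" "?t - ?s = \<delta>"
    using \<delta> by (auto simp: algebra_simps)
  have "\<bar>x ?t i k - ?y (Suc j) i k\<bar> \<le> \<bar>x ?s i k - ?y j i k\<bar> + L * (w + e j) * \<delta>" if ik: "i < N" "k < d" for i k
  proof -
    have cont': "continuous_on {?s..?t} (\<lambda>u. drift N d \<phi> (x u) i k)"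
      by (rule continuous_on_subset[OF drift_continuous[OF ik]]) (use st \<delta> in \<open>auto simp del: of_nat_Suc\<close>)
    have "integral {?s..?t} (\<lambda>u. drift N d \<phi> (x u) i k - drift N d \<phi> (?y j) i k)
        = integral {?s..?t} (\<lambda>u. drift N d \<phi> (x u) i k) - \<delta> * drift N d \<phi> (?y j) i k"
      using st by (subst Henstock_Kurzweil_Integration.integral_diff)
        (auto simp del: of_nat_Suc intro!: integrable_continuous_interval cont')
    then have "x ?t i k - ?y (Suc j) i k - (x ?s i k - ?y j i k)
        = integral {?s..?t} (\<lambda>u. drift N d \<phi> (x u) i k - drift N d \<phi> (?y j) i k)"
      using increment_eq[OF ik st(1,2)] \<delta> by simp
    moreover have "norm (integral {?s..?t} (\<lambda>u. drift N d \<phi> (x u) i k - drift N d \<phi> (?y j) i k)) \<le> L * (w + e j) * (?t - ?s)"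
    proof (rule integral_bound[OF st(2)])
      show "continuous_on {?s..?t} (\<lambda>u. drift N d \<phi> (x u) i k - drift N d \<phi> (?y j) i k)"
        by (intro continuous_intros cont')
      fix u assume "u \<in> {?s..?t}"
      then have "dist1 N d (x u) (?y j) \<le> w + e j"
        using dist1_triangle[of N d "x u" "?y j" "x ?s"] osc[of u] by (simp add: e_def)
      then have "L * dist1 N d (x u) (?y j) \<le> L * (w + e j)"
        using L by (rule mult_left_mono)
      then show "norm (drift N d \<phi> (x u) i k - drift N d \<phi> (?y j) i k) \<le> L * (w + e j)"
        using Lip[OF ik, of "x u" "?y j"] by simp
    qed
    ultimately have "\<bar>x ?t i k - ?y (Suc j) i k - (x ?s i k - ?y j i k)\<bar> \<le> L * (w + e j) * \<delta>"
      using st by simp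
    then show ?thesis
      by linarith
  qed
  then have "e (Suc j) \<le> (\<Sum>i<N. \<Sum>k<d. \<bar>x ?s i k - ?y j i k\<bar> + L * (w + e j) * \<delta>)"
    unfolding e_def dist1_def by (intro sum_mono) auto
  also have "\<dots> = e j + c * (w + e j) * \<delta>"
    by (simp add: e_def dist1_def c_def sum.distrib)
  finally show ?thesis
    by (simp add: algebra_simps)
qed

lemma euler_error:
  assumes \<delta>: "\<delta> \<ge> 0" "\<delta> * real j \<le> T" and w: "w \<ge> 0"
    and osc: "\<And>s u. s \<in> {0..T} \<Longrightarrow> u \<in> {0..T} \<Longrightarrow> \<bar>u - s\<bar> \<le> \<delta> \<Longrightarrow> dist1 N d (x u) (x s) \<le> w"
  shows "dist1 N d (x (\<delta> * real j)) (euler N d \<phi> \<sigma> \<delta> (x 0) b j) \<le> w * exp (real N * real d * L * T)"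
proof -
  let ?e = "\<lambda>j. dist1 N d (x (\<delta> * real j)) (euler N d \<phi> \<sigma> \<delta> (x 0) b j)"
  let ?c = "real N * real d * L"
  have c: "?c \<ge> 0"
    using L by simp
  have "?e j + w \<le> (1 + ?c * \<delta>) ^ j * w"
    using \<delta>(2)
  proof (induction j)
    case 0
    show ?case
      by (simp add: dist1_def)
  next
    case (Suc j)
    have le: "\<delta> * real j \<le> \<delta> * real (Suc j)"
      using \<delta> by (simp add: mult_left_mono)
    have "?e (Suc j) + w \<le> (1 + ?c * \<delta>) * (?e j + w)"
      using Suc.prems \<delta> le by (intro euler_step w osc)
        (auto simp: algebra_simps intro: order_trans[of 0 "\<delta> * real j"])
    also have "\<dots> \<le> (1 + ?c * \<delta>) * ((1 + ?c * \<delta>) ^ j * w)"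
      using Suc le c \<delta> by (intro mult_left_mono Suc.IH) auto
    finally show ?case
      by simp
  qed
  also have "(1 + ?c * \<delta>) ^ j \<le> exp (?c * \<delta>) ^ j"
    using c \<delta> by (intro power_mono) auto
  also have "exp (?c * \<delta>) ^ j = exp (?c * (\<delta> * real j))"
    by (simp add: exp_of_nat_mult[symmetric] mult_ac)
  also have "\<dots> \<le> exp (?c * T)"
    using \<delta> c by (simp only: exp_le_cancel_iff) (rule mult_left_mono)
  finally show ?thesis
    using w by (simp add: mult_ac mult_right_mono)
qed

text \<open>Uniform continuity on \<open>[0,T]\<close> makes the oscillation over one step small.
  The step is a dyadic fraction of \<open>t\<close>, so that the grid ends exactly at
  \<open>t\<close> and grids of successive levels are nested; the value at \<open>u\<close> thus
  uses no noise after time \<open>t\<close>.\<close>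

lemma euler_tendsto:
  assumes t: "0 < t" "t \<le> T" and u: "u \<in> {0..t}" and ik: "i < N" "k < d"
  shows "(\<lambda>n. euler N d \<phi> \<sigma> (t / 2 ^ n) (x 0) b (nat \<lfloor>u / (t / 2 ^ n)\<rfloor>) i k) \<longlonglongrightarrow> x u i k"
proof (rule LIMSEQ_I)
  fix r :: real assume "r > 0"
  \<comment> \<open>Chosen so that the Euler error at the last grid point together with the
    oscillation over the remaining part of a step (the summand 1) amounts to
    \<open>r / 2\<close>.\<close>
  define w where "w = r / (2 * (exp (real N * real d * L * T) + 1))"
  have w: "w > 0"
    using \<open>r > 0\<close> by (auto simp: w_def intro!: divide_pos_pos add_pos_pos)
  have "\<exists>\<eta>>0. \<forall>s\<in>{0..T}. \<forall>u\<in>{0..T}. \<bar>u - s\<bar> < \<eta> \<longrightarrow> dist1 N d (x u) (x s) \<le> w"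
  proof -
    have "\<exists>\<eta>>0. \<forall>s\<in>{0..T}. \<forall>u\<in>{0..T}. \<bar>u - s\<bar> < \<eta> \<longrightarrow> \<bar>x u (fst p) (snd p) - x s (fst p) (snd p)\<bar> \<le> w / (real N * real d)"
      if "p \<in> coords N d" for p
    proof -
      have "uniformly_continuous_on {0..T} (\<lambda>t. x t (fst p) (snd p))"
        using that by (intro compact_uniformly_continuous cont) (auto simp: coords_def)
      moreover have "w / (real N * real d) > 0"
        using w ik by simp
      ultimately show ?thesis
        unfolding uniformly_continuous_on_def dist_real_def by (meson less_imp_le)
    qed
    then obtain \<eta> where \<eta>: "\<And>p. p \<in> coords N d \<Longrightarrow> \<eta> p > 0 \<and> (\<forall>s\<in>{0..T}. \<forall>u\<in>{0..T}. \<bar>u - s\<bar> < \<eta> p \<longrightarrow>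
        \<bar>x u (fst p) (snd p) - x s (fst p) (snd p)\<bar> \<le> w / (real N * real d))"
      by metis
    have ne: "coords N d \<noteq> {}"
      using ik by (auto simp: coords_def)
    define \<eta>0 where "\<eta>0 = Min (\<eta> ` coords N d)"
    have "\<eta>0 > 0"
      using \<eta> ne by (auto simp: \<eta>0_def)
    moreover have "dist1 N d (x u) (x s) \<le> w" if "s \<in> {0..T}" "u \<in> {0..T}" "\<bar>u - s\<bar> < \<eta>0" for s u
    proof -
      have "\<bar>x u i k - x s i k\<bar> \<le> w / (real N * real d)" if "i < N" "k < d" for i k
      proof -
        have "(i, k) \<in> coords N d"
          using that by (auto simp: coords_def)
        moreover have "\<eta>0 \<le> \<eta> (i, k)"
          using calculation by (auto simp: \<eta>0_def)
        ultimately show ?thesis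
          using \<eta>[of "(i, k)"] \<open>s \<in> _\<close> \<open>u \<in> {0..T}\<close> \<open>\<bar>u - s\<bar> < \<eta>0\<close> by auto
      qed
      then have "dist1 N d (x u) (x s) \<le> (\<Sum>i<N. \<Sum>k<d. w / (real N * real d))"
        unfolding dist1_def by (intro sum_mono) auto
      then show ?thesis
        using ik by simp
    qed
    ultimately show ?thesis
      by blast
  qed
  then obtain \<eta> where \<eta>: "\<eta> > 0"
    "\<And>s u. s \<in> {0..T} \<Longrightarrow> u \<in> {0..T} \<Longrightarrow> \<bar>u - s\<bar> < \<eta> \<Longrightarrow> dist1 N d (x u) (x s) \<le> w"
    by blast
  have "(\<lambda>n. t * (1 / 2) ^ n) \<longlonglongrightarrow> t * 0"
    by (intro tendsto_intros) auto
  then have "(\<lambda>n. t / 2 ^ n) \<longlonglongrightarrow> 0"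
    by (simp only: power_one_over times_divide_eq_right mult_1_right mult_zero_right)
  from order_tendstoD(2)[OF this \<eta>(1)] obtain n0 where n0: "\<And>n. n \<ge> n0 \<Longrightarrow> t / 2 ^ n < \<eta>"
    unfolding eventually_sequentially by blast
  have "norm (euler N d \<phi> \<sigma> (t / 2 ^ n) (x 0) b (nat \<lfloor>u / (t / 2 ^ n)\<rfloor>) i k - x u i k) < r" if "n \<ge> n0" for n
  proof -
    define \<delta> where "\<delta> = t / 2 ^ n"
    define j where "j = nat \<lfloor>u / \<delta>\<rfloor>"
    have \<delta>: "\<delta> > 0" "\<delta> < \<eta>"
      using t n0[OF that] by (auto simp: \<delta>_def)
    have "0 \<le> u / \<delta>"
      using u \<delta> by simp
    then have "real j \<le> u / \<delta>" "u / \<delta> \<le> real j + 1"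
      unfolding j_def by linarith+
    then have j: "\<delta> * real j \<le> u" "u \<le> \<delta> * real j + \<delta>"
      using \<delta> by (simp_all add: field_simps)
    have "dist1 N d (x (\<delta> * real j)) (euler N d \<phi> \<sigma> \<delta> (x 0) b j) \<le> w * exp (real N * real d * L * T)"
      using \<delta> w j u t by (intro euler_error \<eta>(2)) auto
    moreover have "dist1 N d (x u) (x (\<delta> * real j)) \<le> w"
      using \<delta> j u t by (intro \<eta>(2)) auto
    ultimately have "dist1 N d (x u) (euler N d \<phi> \<sigma> \<delta> (x 0) b j) \<le> w * (exp (real N * real d * L * T) + 1)"
      using dist1_triangle[of N d "x u" "euler N d \<phi> \<sigma> \<delta> (x 0) b j" "x (\<delta> * real j)"] by (simp add: algebra_simps)
    also have "\<dots> = r / 2"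
    proof -
      have "r / (2 * E) * E = r / 2" if "E > 0" for E :: real
        using that by simp
      then show ?thesis
        unfolding w_def by (simp only: add_pos_pos[OF exp_gt_zero zero_less_one])
    qed
    finally have "\<bar>x u i k - euler N d \<phi> \<sigma> \<delta> (x 0) b j i k\<bar> \<le> r / 2"
      using dist1_component[OF ik, of "x u" "euler N d \<phi> \<sigma> \<delta> (x 0) b j"] by linarith
    then show ?thesis
      using \<open>r > 0\<close> by (simp add: \<delta>_def j_def abs_minus_commute)
  qed
  then show "\<exists>n0. \<forall>n\<ge>n0. norm (euler N d \<phi> \<sigma> (t / 2 ^ n) (x 0) b (nat \<lfloor>u / (t / 2 ^ n)\<rfloor>) i k - x u i k) < r"
    by blast
qed

end

lemma euler_measurable:
  assumes "\<phi> \<in> borel_measurable borel"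
    and "\<And>i k. i < N \<Longrightarrow> k < d \<Longrightarrow> (\<lambda>\<omega>. X0 \<omega> i k) \<in> borel_measurable M"
    and "\<And>i k l. i < N \<Longrightarrow> k < d \<Longrightarrow> l < j \<Longrightarrow>
      (\<lambda>\<omega>. B (\<delta> * real (Suc l)) \<omega> i k - B (\<delta> * real l) \<omega> i k) \<in> borel_measurable M"
    and "i < N" "k < d"
  shows "(\<lambda>\<omega>. euler N d \<phi> \<sigma> \<delta> (X0 \<omega>) (\<lambda>t. B t \<omega>) j i k) \<in> borel_measurable M"
  using assms(3-5)
proof (induction j arbitrary: i k)
  case 0
  then show ?case
    using assms(2) by simp
next
  case (Suc j)
  have "(\<lambda>\<omega>. euler N d \<phi> \<sigma> \<delta> (X0 \<omega>) (\<lambda>t. B t \<omega>) j i k) \<in> borel_measurable M" if "i < N" "k < d" for i k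
    using Suc.prems that by (intro Suc.IH) auto
  then show ?case
    unfolding euler.simps using Suc.prems
    by (intro borel_measurable_add borel_measurable_times[OF borel_measurable_const] drift_measurable[OF assms(1)]) auto
qed

section \<open>Histories\<close>

lemma path_measurable:
  assumes "\<And>u i k. u \<in> {0..t} \<Longrightarrow> i < N \<Longrightarrow> k < d \<Longrightarrow> (\<lambda>\<omega>. X u \<omega> i k) \<in> borel_measurable M"
  shows "path N d t X \<in> measurable M (path_space N d t)"
  unfolding path_def path_space_def using assms
  by (intro measurable_restrict) (auto simp: coords_def)

lemma space_history [simp]: "space (history N d P X t) = space P"
  by (simp add: history_def)

lemma history_le:
  assumes "\<And>u i k. u \<in> {0..t} \<Longrightarrow> i < N \<Longrightarrow> k < d \<Longrightarrow> (\<lambda>\<omega>. X u \<omega> i k) \<in> borel_measurable M"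
    and "space M = space P"
  shows "sets (history N d P X t) \<subseteq> sets M"
  unfolding history_def using assms by (intro sets_image_in_sets path_measurable) auto

lemma vimage_restrict_component:
  assumes "p \<in> I"
  shows "(\<lambda>\<omega>. Y \<omega> p) \<in> borel_measurable (vimage_algebra \<Omega> (\<lambda>\<omega>. \<lambda>p\<in>I. Y \<omega> p) (PiM I (\<lambda>_. borel)))"
proof -
  have "(\<lambda>\<omega>. (\<lambda>p\<in>I. Y \<omega> p) p) \<in> borel_measurable (vimage_algebra \<Omega> (\<lambda>\<omega>. \<lambda>p\<in>I. Y \<omega> p) (PiM I (\<lambda>_. borel)))"
    using assms
    by (intro measurable_compose[OF measurable_vimage_algebra1 measurable_component_singleton])
      (auto simp: space_PiM)
  then show ?thesis
    using assms by simp
qed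

lemma history_component:
  assumes "u \<in> {0..t}" "i < N" "k < d"
  shows "(\<lambda>\<omega>. X u \<omega> i k) \<in> borel_measurable (history N d P X t)"
  using vimage_restrict_component[of "(u, i, k)" "{0..t} \<times> coords N d" "\<lambda>\<omega> (u, i, k). X u \<omega> i k" "space P"] assms
  by (simp add: history_def path_space_def coords_def path_def[abs_def] case_prod_beta' split_beta')

lemma history_mono:
  assumes "s \<le> t"
  shows "sets (history N d P X s) \<subseteq> sets (history N d P X t)"
  using assms by (intro history_le history_component) auto

lemma measurable_sub:
  assumes "f \<in> borel_measurable M" "sets M \<subseteq> sets M'" "space M = space M'"
  shows "f \<in> borel_measurable M'"
  using assms unfolding measurable_def by auto

lemma (in prob_space) indep_set_mono:
  assumes "indep_set A B" "A' \<subseteq> A" "B' \<subseteq> B"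
  shows "indep_set A' B'"
proof (rule indep_setI)
  show "A' \<subseteq> events" "B' \<subseteq> events"
    using indep_setD_ev1[OF assms(1)] indep_setD_ev2[OF assms(1)] assms(2,3) by blast+
  show "prob (a \<inter> b) = prob a * prob b" if "a \<in> A'" "b \<in> B'" for a b
    using indep_setD[OF assms(1)] that assms(2,3) by blast
qed

section \<open>Independence of later Brownian increments from the driving data\<close>

locale observation = prob_space P
  for P :: "'w measure" +
  fixes N d :: nat and \<sigma> T R S :: real and \<phi> :: "real \<Rightarrow> real"
    and \<mu>0 :: "(nat \<times> nat \<Rightarrow> real) measure" and B X :: "real \<Rightarrow> 'w \<Rightarrow> config"
  assumes obs: "observed_system N d \<sigma> T \<phi> \<mu>0 P B X"
    and adm: "\<phi> \<in> admissible R S"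
    and T: "T > 0" and R: "R > 0" and N: "N > 0"
begin

abbreviation "hist \<equiv> history N d P X"

definition B_incr :: "real \<Rightarrow> real \<Rightarrow> 'w \<Rightarrow> nat \<times> nat \<Rightarrow> real" where
  "B_incr t u \<omega> = (\<lambda>p\<in>coords N d. B u \<omega> (fst p) (snd p) - B t \<omega> (fst p) (snd p))"

abbreviation "incr_algebra t u \<equiv> vimage_algebra (space P) (B_incr t u) (state_space N d)"

lemma X_measurable: "t \<in> {0..T} \<Longrightarrow> i < N \<Longrightarrow> k < d \<Longrightarrow> (\<lambda>\<omega>. X t \<omega> i k) \<in> borel_measurable P"
  using obs by (auto simp: observed_system_def continuous_process_def)

lemma X_continuous: "\<omega> \<in> space P \<Longrightarrow> i < N \<Longrightarrow> k < d \<Longrightarrow> continuous_on {0..T} (\<lambda>t. X t \<omega> i k)"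
  using obs by (auto simp: observed_system_def continuous_process_def)

lemma history_le_events: "t \<le> T \<Longrightarrow> sets (hist t) \<subseteq> events"
  by (intro history_le X_measurable) auto

lemma B_indep:
  assumes "mono_on {..K} \<tau>" "\<tau> ` {..K} \<subseteq> {0..T}"
  shows "indep_vars (\<lambda>_. borel) (\<lambda>(j, i, k) \<omega>. B (\<tau> (Suc j)) \<omega> i k - B (\<tau> j) \<omega> i k) ({..<K} \<times> coords N d)"
  using obs assms by (auto simp: observed_system_def brownian_motion_def)

text \<open>Increments from time 0 are taken because \<open>B 0\<close> vanishes only almost surely.
  The dyadic fractions of \<open>t\<close> are exactly the times that the Euler schemes
  read.\<close>

definition grid_events :: "real \<Rightarrow> nat \<Rightarrow> 'w set set" where
  "grid_events t n = sigma_sets (space P)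
     {(\<lambda>\<omega>. B (t / 2 ^ n * real j) \<omega> i k - B 0 \<omega> i k) -` A \<inter> space P | j i k A.
        j \<le> 2 ^ n \<and> i < N \<and> k < d \<and> A \<in> sets borel}"

lemma grid_events_subset:
  assumes "\<And>j i k. j \<le> 2 ^ n \<Longrightarrow> i < N \<Longrightarrow> k < d \<Longrightarrow>
      (\<lambda>\<omega>. B (t / 2 ^ n * real j) \<omega> i k - B 0 \<omega> i k) \<in> borel_measurable M"
    and "space M = space P"
  shows "grid_events t n \<subseteq> sets M"
proof -
  have "{(\<lambda>\<omega>. B (t / 2 ^ n * real j) \<omega> i k - B 0 \<omega> i k) -` A \<inter> space P | j i k A.
        j \<le> 2 ^ n \<and> i < N \<and> k < d \<and> A \<in> sets borel} \<subseteq> sets M"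
    using measurable_sets[OF assms(1)] assms(2) by auto
  from sets.sigma_sets_subset[OF this] show ?thesis
    unfolding grid_events_def assms(2) .
qed

lemma grid_in:
  assumes "t \<ge> 0" "t \<le> T" "j \<le> 2 ^ n"
  shows "t / 2 ^ n * real j \<in> {0..T}" "t / 2 ^ n * real j \<le> t"
proof -
  have "real j \<le> 2 ^ n"
    using assms(3) by (metis of_nat_le_iff of_nat_numeral of_nat_power)
  then have "t * real j \<le> t * 2 ^ n"
    using assms by (intro mult_left_mono) auto
  then show "t / 2 ^ n * real j \<le> t"
    by (simp add: divide_simps)
  then show "t / 2 ^ n * real j \<in> {0..T}"
    using assms by auto
qed

lemma incr_measurable:
  assumes "\<And>p. p \<in> coords N d \<Longrightarrow> (\<lambda>\<omega>. B u \<omega> (fst p) (snd p) - B t \<omega> (fst p) (snd p)) \<in> borel_measurable M"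
  shows "B_incr t u \<in> measurable M (state_space N d)"
  unfolding B_incr_def[abs_def] state_space_def using assms by (rule measurable_restrict)

text \<open>Appending \<open>u\<close> as one more partition point after the grid of
  \<open>[0,t]\<close> makes the later increment a member of the same independent family. The past
  uses the indices below \<open>2 ^ n\<close>, the later increment has index \<open>2 ^ n\<close>,
  and disjoint blocks of an independent family are independent.\<close>

lemma grid_incr_indep:
  assumes t: "0 \<le> t" "t \<le> u" "u \<le> T"
  shows "indep_set (grid_events t n) (sets (incr_algebra t u))"
proof -
  define \<tau> where "\<tau> j = (if j \<le> 2 ^ n then t / 2 ^ n * real j else u)" for j :: nat
  let ?D = "\<lambda>(j, i, k) \<omega>. B (\<tau> (Suc j)) \<omega> i k - B (\<tau> j) \<omega> i k"
  let ?A = "{..<2 ^ n} \<times> coords N d" and ?C = "{2 ^ n} \<times> coords N d"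
  let ?V = "\<lambda>I. vimage_algebra (space P) (\<lambda>\<omega>. \<lambda>p\<in>I. ?D p \<omega>) (PiM I (\<lambda>_. borel))"
  have "mono_on {..Suc (2 ^ n)} \<tau>"
  proof (rule mono_onI)
    fix r s :: nat assume "r \<le> s"
    have "t / 2 ^ n * real r \<le> t / 2 ^ n * real s"
      using t \<open>r \<le> s\<close> by (intro mult_left_mono) auto
    moreover have "t / 2 ^ n * real r \<le> u" if "r \<le> 2 ^ n"
      using grid_in(2)[of t r n] that t by linarith
    ultimately show "\<tau> r \<le> \<tau> s"
      using \<open>r \<le> s\<close> by (auto simp: \<tau>_def)
  qed
  moreover have "\<tau> ` {..Suc (2 ^ n)} \<subseteq> {0..T}"
    using t grid_in(1)[of t _ n] by (auto simp: \<tau>_def)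
  ultimately have "indep_vars (\<lambda>_. borel) ?D ({..<Suc (2 ^ n)} \<times> coords N d)"
    by (rule B_indep)
  then have "indep_var (PiM ?A (\<lambda>_. borel)) (\<lambda>\<omega>. \<lambda>p\<in>?A. ?D p \<omega>) (PiM ?C (\<lambda>_. borel)) (\<lambda>\<omega>. \<lambda>p\<in>?C. ?D p \<omega>)"
    by (rule indep_var_restrict) auto
  then have ind: "indep_set (sets (?V ?A)) (sets (?V ?C))"
    by (simp add: indep_var_eq sets_vimage_algebra)
  have D: "(\<lambda>\<omega>. B (\<tau> (Suc j)) \<omega> i k - B (\<tau> j) \<omega> i k) \<in> borel_measurable (?V I)" if "(j, i, k) \<in> I" for j i k I
    using vimage_restrict_component[OF that, of "\<lambda>\<omega> p. ?D p \<omega>"] by simp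
  have "grid_events t n \<subseteq> sets (?V ?A)"
  proof -
    have "(\<lambda>\<omega>. B (t / 2 ^ n * real j) \<omega> i k - B 0 \<omega> i k) \<in> borel_measurable (?V ?A)"
      if "j \<le> 2 ^ n" "i < N" "k < d" for j i k
    proof -
      have "(\<lambda>\<omega>. \<Sum>l<j. B (\<tau> (Suc l)) \<omega> i k - B (\<tau> l) \<omega> i k) \<in> borel_measurable (?V ?A)"
        using that by (intro borel_measurable_sum D) (auto simp: coords_def)
      moreover have "(\<Sum>l<j. B (\<tau> (Suc l)) \<omega> i k - B (\<tau> l) \<omega> i k) = B (\<tau> j) \<omega> i k - B (\<tau> 0) \<omega> i k" for \<omega>
        by (rule sum_lessThan_telescope)
      \<comment> \<open>Increments from time 0 are recovered from those over single cells by
        telescoping.\<close>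
      ultimately show ?thesis
        using that by (simp add: \<tau>_def)
    qed
    then show ?thesis
      by (rule grid_events_subset) auto
  qed
  moreover have "sets (incr_algebra t u) \<subseteq> sets (?V ?C)"
  proof (rule sets_image_in_sets[OF _ incr_measurable])
    fix p assume "p \<in> coords N d"
    then show "(\<lambda>\<omega>. B u \<omega> (fst p) (snd p) - B t \<omega> (fst p) (snd p)) \<in> borel_measurable (?V ?C)"
      using D[of "2 ^ n" "fst p" "snd p" ?C] by (simp add: \<tau>_def)
  qed simp
  ultimately show ?thesis
    by (rule indep_set_mono[OF ind])
qed

text \<open>Point \<open>j\<close> of one level is point \<open>2 * j\<close> of the next. This
  nesting is what makes the rectangles below stable under intersection.\<close>

lemma grid_events_mono: "grid_events t n \<subseteq> grid_events t (Suc n)"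
  unfolding grid_events_def
proof (rule sigma_sets_mono'; clarsimp)
  fix j i k A assume "j \<le> (2::nat) ^ n" "i < N" "k < d" "A \<in> sets (borel :: real measure)"
  then show "\<exists>j' i' k' A'. (\<lambda>\<omega>. B (t * real j / 2 ^ n) \<omega> i k - B 0 \<omega> i k) -` A \<inter> space P
      = (\<lambda>\<omega>. B (t * real j' / (2 * 2 ^ n)) \<omega> i' k' - B 0 \<omega> i' k') -` A' \<inter> space P
      \<and> j' \<le> 2 * 2 ^ n \<and> i' < N \<and> k' < d \<and> A' \<in> sets borel"
    by (intro exI[of _ "2 * j"] exI[of _ i] exI[of _ k] exI[of _ A]) auto
qed

definition start_events :: "'w set set" where
  "start_events = sets (vimage_algebra (space P) (\<lambda>\<omega>. state N d (X 0 \<omega>)) (state_space N d))"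

text \<open>A pi-system for the joint information in \<open>X 0\<close> and the dyadic increments of
  \<open>B\<close>; independence is verified here and then extended to the generated
  sigma-algebra.\<close>

definition driving_rectangles :: "real \<Rightarrow> 'w set set" where
  "driving_rectangles t = {a \<inter> c | a c n. a \<in> start_events \<and> c \<in> grid_events t n}"

lemma grid_events_events:
  assumes "0 \<le> t" "t \<le> T"
  shows "grid_events t n \<subseteq> events"
  using indep_setD_ev1[OF grid_incr_indep[of t t n]] assms by auto

lemma start_events_indep:
  "indep_set start_events (sets (vimage_algebra (space P) (path N d T B) (path_space N d T)))"
  using obs by (simp add: observed_system_def start_events_def)

text \<open>Two rectangles may come from different levels; both grid events are lifted to the larger
  level before they are intersected.\<close>

lemma Int_stable_driving_rectangles: "Int_stable (driving_rectangles t)"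
proof (rule Int_stableI)
  fix x y assume "x \<in> driving_rectangles t" "y \<in> driving_rectangles t"
  then obtain a c n a' c' n' where *: "x = a \<inter> c" "y = a' \<inter> c'" "a \<in> start_events" "a' \<in> start_events"
    "c \<in> grid_events t n" "c' \<in> grid_events t n'"
    by (auto simp: driving_rectangles_def)
  have mono: "grid_events t m \<subseteq> grid_events t m'" if "m \<le> m'" for m m'
    using that by (rule lift_Suc_mono_le[of "grid_events t", OF grid_events_mono])
  interpret G: sigma_algebra "space P" "grid_events t (max n n')"
    unfolding grid_events_def by (rule sigma_algebra_sigma_sets) auto
  have "c \<in> grid_events t (max n n')" "c' \<in> grid_events t (max n n')"
    using * mono[of n "max n n'"] mono[of n' "max n n'"] by auto
  then have "c \<inter> c' \<in> grid_events t (max n n')"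
    by (rule G.Int)
  moreover have "a \<inter> a' \<in> start_events"
    using * by (auto simp: start_events_def)
  moreover have "x \<inter> y = (a \<inter> a') \<inter> (c \<inter> c')"
    using * by auto
  ultimately show "x \<inter> y \<in> driving_rectangles t"
    unfolding driving_rectangles_def by blast
qed

text \<open>Two independences are combined: that of \<open>X 0\<close> from the whole path of
  \<open>B\<close>, and that of past from later increments of \<open>B\<close>. On a rectangle the
  probability factorises in two steps, because the grid event and the later increment both belong to
  the path of \<open>B\<close>.\<close>

lemma driving_indep:
  assumes t: "0 \<le> t" "t \<le> u" "u \<le> T"
  shows "indep_set (sigma_sets (space P) (driving_rectangles t)) (sets (incr_algebra t u))"
proof -
  let ?PB = "vimage_algebra (space P) (path N d T B) (path_space N d T)"
  have path: "(\<lambda>\<omega>. B s \<omega> i k) \<in> borel_measurable ?PB" if "s \<in> {0..T}" "i < N" "k < d" for s i k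
    using history_component[OF that, of B P] by (simp add: history_def)
  have incr_PB: "sets (incr_algebra t u) \<subseteq> sets ?PB"
    using t by (intro sets_image_in_sets incr_measurable borel_measurable_diff path) (auto simp: coords_def)
  have grid_PB: "grid_events t n \<subseteq> sets ?PB" for n
    using t grid_in(1)[of t _ n] by (intro grid_events_subset borel_measurable_diff path) auto
  have "indep_set (driving_rectangles t) (sets (incr_algebra t u))"
  proof (rule indep_setI)
    show "driving_rectangles t \<subseteq> events"
      using indep_setD_ev1[OF start_events_indep] grid_events_events t
      by (fastforce simp: driving_rectangles_def)
    show "sets (incr_algebra t u) \<subseteq> events"
      using incr_PB indep_setD_ev2[OF start_events_indep] by auto
  next
    fix x y assume x: "x \<in> driving_rectangles t" and y: "y \<in> sets (incr_algebra t u)"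
    then obtain a c n where *: "x = a \<inter> c" "a \<in> start_events" "c \<in> grid_events t n"
      by (auto simp: driving_rectangles_def)
    have cy: "c \<inter> y \<in> sets ?PB"
      using * y grid_PB incr_PB by (intro sets.Int) auto
    have "prob (x \<inter> y) = prob (a \<inter> (c \<inter> y))"
      using * by (simp add: Int_assoc)
    also have "\<dots> = prob a * prob (c \<inter> y)"
      using indep_setD[OF start_events_indep *(2) cy] .
    also have "prob (c \<inter> y) = prob c * prob y"
      using indep_setD[OF grid_incr_indep[OF t] *(3) y] .
    also have "prob a * (prob c * prob y) = prob (a \<inter> c) * prob y"
      using indep_setD[OF start_events_indep *(2) subsetD[OF grid_PB *(3)]] by simp
    finally show "prob (x \<inter> y) = prob x * prob y"
      using * by simp
  qed
  then have "indep_set (sigma_sets (space P) (driving_rectangles t)) (sigma_sets (space P) (sets (incr_algebra t u)))"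
    by (intro indep_set_sigma_sets Int_stable_driving_rectangles sets.Int_stable)
  moreover have "sigma_sets (space P) (sets (incr_algebra t u)) = sets (incr_algebra t u)"
    using sets.sigma_sets_eq[of "incr_algebra t u"] by simp
  ultimately show ?thesis
    by simp
qed

end

lemma borel_measurable_time_integral:
  fixes f :: "real \<Rightarrow> 'w \<Rightarrow> real"
  assumes "(\<lambda>(\<omega>, u). f u \<omega>) \<in> borel_measurable (M \<Otimes>\<^sub>M time_interval t)"
  shows "(\<lambda>\<omega>. LINT u|time_interval t. f u \<omega>) \<in> borel_measurable M"
proof -
  interpret finite_measure "time_interval t"
    by (rule finite_measure_time_interval)
  show ?thesis
    using assms by (intro borel_measurable_lebesgue_integral)
qed

section \<open>From the driving data to the past of \<open>X\<close>\<close>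

context observation
begin

definition driving :: "real \<Rightarrow> 'w measure" where
  "driving t = sigma (space P) (driving_rectangles t)"

lemma driving_rectangles_space: "driving_rectangles t \<subseteq> Pow (space P)"
  using sets.sets_into_space by (fastforce simp: driving_rectangles_def start_events_def)

lemma space_driving [simp]: "space (driving t) = space P"
  using driving_rectangles_space by (simp add: driving_def)

lemma sets_driving: "sets (driving t) = sigma_sets (space P) (driving_rectangles t)"
  using driving_rectangles_space by (simp add: driving_def)

lemma driving_le_events: "0 \<le> t \<Longrightarrow> t \<le> T \<Longrightarrow> sets (driving t) \<subseteq> events"
  using indep_setD_ev1[OF driving_indep[of t t]] by (simp add: sets_driving)

lemma start_driving:
  assumes "i < N" "k < d"
  shows "(\<lambda>\<omega>. X 0 \<omega> i k) \<in> borel_measurable (driving t)"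
proof -
  let ?V = "vimage_algebra (space P) (\<lambda>\<omega>. state N d (X 0 \<omega>)) (state_space N d)"
  have "(\<lambda>\<omega>. X 0 \<omega> i k) \<in> borel_measurable ?V"
    using vimage_restrict_component[of "(i, k)" "coords N d" "\<lambda>\<omega> (i, k). X 0 \<omega> i k" "space P"] assms
    by (simp add: state_space_def coords_def state_def[abs_def])
  moreover have "sets ?V \<subseteq> sets (driving t)"
  proof
    fix A assume A: "A \<in> sets ?V"
    then have "A \<inter> space P = A"
      using sets.sets_into_space[OF A] by auto
    moreover have "space P \<in> grid_events t 0"
      unfolding grid_events_def by (rule sigma_sets_top)
    ultimately have "A \<in> driving_rectangles t"
      using A unfolding driving_rectangles_def start_events_def by blast
    then show "A \<in> sets (driving t)"
      by (simp add: sets_driving)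
  qed
  ultimately show ?thesis
    by (rule measurable_sub) simp
qed

lemma grid_driving:
  assumes "j \<le> 2 ^ n" "i < N" "k < d"
  shows "(\<lambda>\<omega>. B (t / 2 ^ n * real j) \<omega> i k - B 0 \<omega> i k) \<in> borel_measurable (driving t)"
proof (rule measurableI)
  fix A :: "real set" assume A: "A \<in> sets borel"
  let ?c = "(\<lambda>\<omega>. B (t / 2 ^ n * real j) \<omega> i k - B 0 \<omega> i k) -` A \<inter> space P"
  have "?c \<in> grid_events t n"
    unfolding grid_events_def using assms A by (intro sigma_sets.Basic) blast
  moreover have "space P \<in> start_events"
    using sets.top[of "vimage_algebra (space P) (\<lambda>\<omega>. state N d (X 0 \<omega>)) (state_space N d)"]
    by (simp add: start_events_def)
  moreover have "?c = space P \<inter> ?c"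
    by auto
  ultimately have "?c \<in> driving_rectangles t"
    unfolding driving_rectangles_def by blast
  then show "(\<lambda>\<omega>. B (t / 2 ^ n * real j) \<omega> i k - B 0 \<omega> i k) -` A \<inter> space (driving t) \<in> sets (driving t)"
    by (simp add: sets_driving)
qed simp

lemma X_eq: "AE \<omega> in P. \<forall>t\<in>{0..T}. \<forall>i<N. \<forall>k<d.
    X t \<omega> i k = X 0 \<omega> i k + (LINT u:{0..t}|lborel. drift N d \<phi> (X u \<omega>) i k) + \<sigma> * B t \<omega> i k"
  using obs by (simp add: observed_system_def)

text \<open>The limit of the Euler schemes is a version of \<open>X u\<close>. It agrees with
  \<open>X u\<close> only almost surely, since the integral equation may fail on a null set;
  \<open>lim\<close> is measurable also where the schemes do not converge.\<close>

lemma X_driving: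
  assumes u: "u \<in> {0..t}" "t \<le> T" and ik: "i < N" "k < d"
  shows "\<exists>Y\<in>borel_measurable (driving t). AE \<omega> in P. Y \<omega> = X u \<omega> i k"
proof (cases "t = 0")
  case True
  then show ?thesis
    using start_driving[OF ik] u by auto
next
  case False
  then have t: "0 < t"
    using u by auto
  \<comment> \<open>\<open>\<phi>\<close> is controlled on nonnegative arguments only; its
    truncation is Borel measurable and has the same drift.\<close>
  let ?\<psi> = "truncate R \<phi>"
  obtain L where L: "L \<ge> 0"
    "\<And>x y i k. i < N \<Longrightarrow> k < d \<Longrightarrow> \<bar>drift N d \<phi> x i k - drift N d \<phi> y i k\<bar> \<le> L * dist1 N d x y"
    using drift_Lipschitz[OF adm R] by blast
  define E where "E n \<omega> = euler N d ?\<psi> \<sigma> (t / 2 ^ n) (X 0 \<omega>) (\<lambda>s. B s \<omega>) (nat \<lfloor>u / (t / 2 ^ n)\<rfloor>) i k" for n \<omega>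
  have E_meas: "E n \<in> borel_measurable (driving t)" for n
    unfolding E_def
  proof (rule euler_measurable[OF _ start_driving _ ik])
    show "?\<psi> \<in> borel_measurable borel"
      using truncate_admissible(1)[OF adm R] by (simp add: kernels_def)
    fix i k l assume *: "i < N" "k < d" "l < nat \<lfloor>u / (t / 2 ^ n)\<rfloor>"
    have "u / (t / 2 ^ n) \<le> 2 ^ n"
      using u t by (simp add: field_simps)
    then have "real_of_int \<lfloor>u / (t / 2 ^ n)\<rfloor> \<le> real_of_int (2 ^ n)"
      by (intro order_trans[OF of_int_floor_le]) simp
    then have "\<lfloor>u / (t / 2 ^ n)\<rfloor> \<le> 2 ^ n"
      by (simp only: of_int_le_iff)
    then have "nat \<lfloor>u / (t / 2 ^ n)\<rfloor> \<le> 2 ^ n"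
      by (simp add: nat_le_iff)
    then have "Suc l \<le> 2 ^ n"
      using *(3) by linarith
    then have "(\<lambda>\<omega>. (B (t / 2 ^ n * real (Suc l)) \<omega> i k - B 0 \<omega> i k) - (B (t / 2 ^ n * real l) \<omega> i k - B 0 \<omega> i k))
        \<in> borel_measurable (driving t)"
      using * by (intro borel_measurable_diff grid_driving) auto
    then show "(\<lambda>\<omega>. B (t / 2 ^ n * real (Suc l)) \<omega> i k - B (t / 2 ^ n * real l) \<omega> i k) \<in> borel_measurable (driving t)"
      by simp
  qed auto
  have "AE \<omega> in P. lim (\<lambda>n. E n \<omega>) = X u \<omega> i k"
    using X_eq AE_space
  proof eventually_elim
    case (elim \<omega>)
    interpret integral_path N d ?\<psi> \<sigma> T L "\<lambda>s. X s \<omega>" "\<lambda>s. B s \<omega>"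
    proof
      show "continuous_on {0..T} (\<lambda>t. X t \<omega> i k)" if "i < N" "k < d" for i k
        using X_continuous elim(2) that by simp
      show "X t \<omega> i k = X 0 \<omega> i k + (LINT u:{0..t}|lborel. drift N d ?\<psi> (X u \<omega>) i k) + \<sigma> * B t \<omega> i k"
        if "t \<in> {0..T}" "i < N" "k < d" for t i k
        using elim(1) that unfolding truncate_admissible(4)[OF adm R] by blast
      show "\<bar>drift N d ?\<psi> x i k - drift N d ?\<psi> y i k\<bar> \<le> L * dist1 N d x y" if "i < N" "k < d" for x y i k
        unfolding truncate_admissible(4)[OF adm R] by (rule L(2)[OF that])
    qed (rule L(1))
    show ?case
      unfolding E_def using euler_tendsto[OF t _ u(1) ik] u by (intro limI) auto
  qed
  moreover have "(\<lambda>\<omega>. lim (\<lambda>n. E n \<omega>)) \<in> borel_measurable (driving t)"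
    using E_meas by (rule borel_measurable_lim_metric)
  ultimately show ?thesis
    by (intro bexI[where x = "\<lambda>\<omega>. lim (\<lambda>n. E n \<omega>)"])
qed

text \<open>The sets that agree almost surely with a member of \<open>driving t\<close> form a
  sigma-algebra \<open>G\<close>, and each \<open>X u\<close> with \<open>u\<close> up to
  \<open>t\<close> is measurable for \<open>G\<close> through its version. Thus \<open>G\<close>
  plays the role of a completion of \<open>driving t\<close> by null sets.\<close>

lemma history_driving:
  assumes t: "0 \<le> t" "t \<le> T" and A: "A \<in> sets (hist t)"
  shows "\<exists>A'\<in>sets (driving t). AE \<omega> in P. \<omega> \<in> A \<longleftrightarrow> \<omega> \<in> A'"
proof -
  define G where "G = {A \<in> Pow (space P). \<exists>A'\<in>sets (driving t). AE \<omega> in P. \<omega> \<in> A \<longleftrightarrow> \<omega> \<in> A'}"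
  have GI: "A \<in> G" if "A \<subseteq> space P" "A' \<in> sets (driving t)" "AE \<omega> in P. \<omega> \<in> A \<longleftrightarrow> \<omega> \<in> A'" for A A'
    unfolding G_def by (rule CollectI, rule conjI, rule PowI, rule that, rule bexI, rule that, rule that)
  have GE: "A \<subseteq> space P" "\<exists>A'\<in>sets (driving t). AE \<omega> in P. \<omega> \<in> A \<longleftrightarrow> \<omega> \<in> A'" if "A \<in> G" for A
    using that unfolding G_def by simp_all
  have "sigma_algebra (space P) G"
    unfolding sigma_algebra_iff2
  proof (intro conjI ballI allI impI)
    show "{} \<in> G"
      unfolding G_def by (auto intro: bexI[of _ "{}"])
    show "space P - s \<in> G" if "s \<in> G" for s
    proof -
      have "\<exists>A'\<in>sets (driving t). AE \<omega> in P. \<omega> \<in> s \<longleftrightarrow> \<omega> \<in> A'"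
        by (rule GE(2)[OF that])
      then obtain A' where "A' \<in> sets (driving t)" "AE \<omega> in P. \<omega> \<in> s \<longleftrightarrow> \<omega> \<in> A'"
        by (elim bexE)
      moreover from this(2) have "AE \<omega> in P. \<omega> \<in> space P - s \<longleftrightarrow> \<omega> \<in> space P - A'"
        by eventually_elim auto
      moreover have "space P - A' \<in> sets (driving t)"
        using sets.compl_sets[OF calculation(1)] by simp
      ultimately show ?thesis
        by (intro GI[of _ "space P - A'"] Diff_subset)
    qed
    show "(\<Union>i. A i) \<in> G" if "range A \<subseteq> G" for A :: "nat \<Rightarrow> _"
    proof -
      have "\<forall>i. \<exists>A'\<in>sets (driving t). AE \<omega> in P. \<omega> \<in> A i \<longleftrightarrow> \<omega> \<in> A'"
        using that by (intro allI GE(2)) auto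
      then obtain A' where A': "\<And>i. A' i \<in> sets (driving t)" "\<And>i. AE \<omega> in P. \<omega> \<in> A i \<longleftrightarrow> \<omega> \<in> A' i"
        by metis
      have "AE \<omega> in P. \<forall>i. \<omega> \<in> A i \<longleftrightarrow> \<omega> \<in> A' i"
        using A'(2) by (simp add: AE_all_countable)
      then have "AE \<omega> in P. \<omega> \<in> (\<Union>i. A i) \<longleftrightarrow> \<omega> \<in> (\<Union>i. A' i)"
        by eventually_elim auto
      moreover have "(\<Union>i. A' i) \<in> sets (driving t)"
        using A'(1) by auto
      moreover have "(\<Union>i. A i) \<subseteq> space P"
        using that GE(1) by blast
      ultimately show ?thesis
        by (intro GI[of _ "\<Union>i. A' i"])
    qed
  qed (auto simp: G_def)
  then have sets_G: "sets (sigma (space P) G) = G"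
    by (intro sigma_algebra.sets_measure_of_eq)
  have space_G: "space (sigma (space P) G) = space P"
    by (rule space_measure_of) (auto simp: G_def)
  have "sets (hist t) \<subseteq> sets (sigma (space P) G)"
  proof (rule history_le[OF _ space_G])
    fix u i k assume uik: "u \<in> {0..t}" "i < N" "k < d"
    obtain Y where Y: "Y \<in> borel_measurable (driving t)" "AE \<omega> in P. Y \<omega> = X u \<omega> i k"
      using X_driving[OF uik(1) t(2) uik(2,3)] by blast
    show "(\<lambda>\<omega>. X u \<omega> i k) \<in> borel_measurable (sigma (space P) G)"
    proof (rule measurableI)
      fix C :: "real set" assume "C \<in> sets borel"
      then have "Y -` C \<inter> space P \<in> sets (driving t)"
        using measurable_sets[OF Y(1)] by simp
      moreover from Y(2) have "AE \<omega> in P. \<omega> \<in> (\<lambda>\<omega>. X u \<omega> i k) -` C \<inter> space P \<longleftrightarrow> \<omega> \<in> Y -` C \<inter> space P"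
        by eventually_elim auto
      ultimately show "(\<lambda>\<omega>. X u \<omega> i k) -` C \<inter> space (sigma (space P) G) \<in> sets (sigma (space P) G)"
        unfolding sets_G space_G by (intro GI[of _ "Y -` C \<inter> space P"] Int_lower2)
    qed simp
  qed
  then show ?thesis
    using A unfolding sets_G by (intro GE(2)) (rule subsetD)
qed

text \<open>Independence only concerns probabilities, so an event of the history may be replaced by
  one of \<open>driving t\<close> that equals it almost surely.\<close>

lemma history_incr_indep:
  assumes t: "0 \<le> t" "t \<le> u" "u \<le> T"
  shows "indep_set (sets (hist t)) (sets (incr_algebra t u))"
proof (rule indep_setI)
  note ind = driving_indep[OF t, folded sets_driving]
  show "sets (hist t) \<subseteq> events" "sets (incr_algebra t u) \<subseteq> events"
    using history_le_events[of t] indep_setD_ev2[OF ind] t by auto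
  fix A D assume A: "A \<in> sets (hist t)" and D: "D \<in> sets (incr_algebra t u)"
  obtain A' where A': "A' \<in> sets (driving t)" "AE \<omega> in P. \<omega> \<in> A \<longleftrightarrow> \<omega> \<in> A'"
    using history_driving[OF _ _ A] t by auto
  have ev: "A \<in> events" "A' \<in> events" "D \<in> events"
    using A A' D history_le_events[of t] driving_le_events[of t] indep_setD_ev2[OF ind] t by auto
  have "prob (A \<inter> D) = prob (A' \<inter> D)"
    using ev A'(2) by (intro finite_measure_eq_AE) auto
  also have "\<dots> = prob A' * prob D"
    using indep_setD[OF ind A'(1) D] .
  also have "prob A' = prob A"
    using ev A'(2) by (intro finite_measure_eq_AE) auto
  finally show "prob (A \<inter> D) = prob A * prob D" .
qed

lemma indep_integral:
  fixes f g :: "'w \<Rightarrow> real"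
  assumes t: "0 \<le> t" "t \<le> u" "u \<le> T"
    and f: "f \<in> borel_measurable (hist t)" "integrable P f"
    and g: "g \<in> borel_measurable (incr_algebra t u)" "integrable P g"
  shows "integrable P (\<lambda>\<omega>. f \<omega> * g \<omega>)" "expectation (\<lambda>\<omega>. f \<omega> * g \<omega>) = expectation f * expectation g"
proof -
  have "indep_set (sigma_sets (space P) {f -` A \<inter> space P | A. A \<in> sets borel})
      (sigma_sets (space P) {g -` A \<inter> space P | A. A \<in> sets borel})"
  proof (rule indep_set_mono[OF history_incr_indep[OF t]])
    have "{f -` A \<inter> space P | A. A \<in> sets borel} \<subseteq> sets (hist t)"
      using measurable_sets[OF f(1)] by auto
    from sets.sigma_sets_subset[OF this] show "sigma_sets (space P) {f -` A \<inter> space P | A. A \<in> sets borel} \<subseteq> sets (hist t)"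
      by simp
    have "{g -` A \<inter> space P | A. A \<in> sets borel} \<subseteq> sets (incr_algebra t u)"
      using measurable_sets[OF g(1)] by auto
    from sets.sigma_sets_subset[OF this] show "sigma_sets (space P) {g -` A \<inter> space P | A. A \<in> sets borel} \<subseteq> sets (incr_algebra t u)"
      by simp
  qed
  then have "indep_var borel f borel g"
    using f(2) g(2) unfolding indep_var_eq by auto
  from indep_var_integrable[OF this f(2) g(2)] indep_var_lebesgue_integral[OF this f(2) g(2)]
  show "integrable P (\<lambda>\<omega>. f \<omega> * g \<omega>)" "expectation (\<lambda>\<omega>. f \<omega> * g \<omega>) = expectation f * expectation g"
    by simp_all
qed

section \<open>The noise in a history\<close>

text \<open>A version of \<open>\<sigma>\<close> times \<open>B\<close> built from \<open>X\<close>
  alone. It is measurable in the history of \<open>X\<close> for every outcome, which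
  \<open>B\<close> is not known to be; this is needed when earlier sums multiply later increments,
  and again when independence of the trajectories has to yield independence of the noise.\<close>

definition noise :: "real \<Rightarrow> 'w \<Rightarrow> config" where
  "noise t \<omega> = (\<lambda>i k. X t \<omega> i k - X 0 \<omega> i k - (LINT u|time_interval t. drift N d \<phi> (X u \<omega>) i k))"

lemma history_jointly_measurable:
  assumes "t \<le> s" "t \<le> T" "i < N" "k < d"
  shows "(\<lambda>(\<omega>, u). X u \<omega> i k) \<in> borel_measurable (hist s \<Otimes>\<^sub>M time_interval t)"
  using assms
  by (intro continuous_process_jointly_measurable history_component)
    (auto intro: continuous_on_subset[OF X_continuous])

lemma history_drift_measurable:
  assumes "h \<in> kernels R" "t \<le> s" "t \<le> T" "i < N" "k < d"
  shows "(\<lambda>(\<omega>, u). drift N d h (X u \<omega>) i k) \<in> borel_measurable (hist s \<Otimes>\<^sub>M time_interval t)"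
proof -
  have "(\<lambda>z. drift N d h (X (snd z) (fst z)) i k) \<in> borel_measurable (hist s \<Otimes>\<^sub>M time_interval t)"
    using history_jointly_measurable[of t s] assms
    by (intro drift_measurable kernels_measurable) (auto simp: case_prod_beta')
  then show ?thesis
    by (simp add: case_prod_beta')
qed

lemma noise_measurable:
  assumes "0 \<le> t" "t \<le> s" "t \<le> T" "i < N" "k < d"
  shows "(\<lambda>\<omega>. noise t \<omega> i k) \<in> borel_measurable (hist s)"
proof -
  have "(\<lambda>(\<omega>, u). drift N d \<phi> (X u \<omega>) i k) \<in> borel_measurable (hist s \<Otimes>\<^sub>M time_interval t)"
    using history_drift_measurable[OF truncate_admissible(1)[OF adm R], of t s i k] assms
    by (simp add: truncate_admissible(4)[OF adm R])
  then show ?thesis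
    unfolding noise_def using assms
    by (intro borel_measurable_diff history_component borel_measurable_time_integral) auto
qed

lemma noise_eq: "AE \<omega> in P. \<forall>t\<in>{0..T}. \<forall>i<N. \<forall>k<d. noise t \<omega> i k = \<sigma> * B t \<omega> i k"
  using X_eq
proof eventually_elim
  case (elim \<omega>)
  show ?case
  proof (intro ballI allI impI)
    fix t i k assume "t \<in> {0..T}" "i < N" "k < d"
    then have "X t \<omega> i k = X 0 \<omega> i k + (LINT u:{0..t}|lborel. drift N d \<phi> (X u \<omega>) i k) + \<sigma> * B t \<omega> i k"
      using elim by blast
    then show "noise t \<omega> i k = \<sigma> * B t \<omega> i k"
      unfolding noise_def set_integral_time_interval by linarith
  qed
qed

lemma B_incr_component:
  assumes "i < N" "k < d"
  shows "(\<lambda>\<omega>. B u \<omega> i k - B t \<omega> i k) \<in> borel_measurable (incr_algebra t u)"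
  using vimage_restrict_component[of "(i, k)" "coords N d" "\<lambda>\<omega> p. B u \<omega> (fst p) (snd p) - B t \<omega> (fst p) (snd p)" "space P"] assms
  by (simp add: state_space_def coords_def B_incr_def[abs_def])

lemma B_incr_moments:
  assumes t: "0 \<le> t" "t \<le> u" "u \<le> T" and ik: "i < N" "k < d"
  shows "integrable P (\<lambda>\<omega>. B u \<omega> i k - B t \<omega> i k)" "expectation (\<lambda>\<omega>. B u \<omega> i k - B t \<omega> i k) = 0"
    "integrable P (\<lambda>\<omega>. (B u \<omega> i k - B t \<omega> i k)\<^sup>2)" "expectation (\<lambda>\<omega>. (B u \<omega> i k - B t \<omega> i k)\<^sup>2) = u - t"
proof -
  let ?D = "\<lambda>\<omega>. B u \<omega> i k - B t \<omega> i k"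
  have "integrable P ?D \<and> expectation ?D = 0 \<and> integrable P (\<lambda>\<omega>. (?D \<omega>)\<^sup>2) \<and> expectation (\<lambda>\<omega>. (?D \<omega>)\<^sup>2) = u - t"
  \<comment> \<open>Brownian increments have a density only over intervals of positive length,
    whereas partitions of simple processes may repeat a point.\<close>
  proof (cases "t = u")
    case False
    then have D: "distributed P lborel ?D (normal_density 0 (sqrt (u - t)))" and "t < u"
      using obs t ik by (auto simp: observed_system_def brownian_motion_def)
    then have pos: "0 < sqrt (u - t)"
      by simp
    have "expectation ?D = 0" "variance ?D = (sqrt (u - t))\<^sup>2"
      using normal_distributed_expectation[OF pos D] normal_distributed_variance[OF pos D] by auto
    moreover have "integrable P (\<lambda>\<omega>. (?D \<omega>) ^ n)" for n
      using integrable_normal_moment[OF pos, of 0 n]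
      by (subst distributed_integrable[OF D, of "\<lambda>x. x ^ n", symmetric]) (auto simp: mult.commute)
    from this[of 1] this[of 2] have "integrable P ?D" "integrable P (\<lambda>\<omega>. (?D \<omega>)\<^sup>2)"
      by auto
    ultimately show ?thesis
      using \<open>t < u\<close> by simp
  qed simp
  then show "integrable P ?D" "expectation ?D = 0" "integrable P (\<lambda>\<omega>. (?D \<omega>)\<^sup>2)" "expectation (\<lambda>\<omega>. (?D \<omega>)\<^sup>2) = u - t"
    by auto
qed

lemma B_incr_cross:
  assumes t: "0 \<le> t" "t \<le> u" "u \<le> T" and p: "i < N" "k < d" and q: "i' < N" "k' < d"
  shows "integrable P (\<lambda>\<omega>. (B u \<omega> i k - B t \<omega> i k) * (B u \<omega> i' k' - B t \<omega> i' k'))"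
    and "expectation (\<lambda>\<omega>. (B u \<omega> i k - B t \<omega> i k) * (B u \<omega> i' k' - B t \<omega> i' k')) = (if (i, k) = (i', k') then u - t else 0)"
proof -
  let ?p = "\<lambda>\<omega>. B u \<omega> i k - B t \<omega> i k" and ?q = "\<lambda>\<omega>. B u \<omega> i' k' - B t \<omega> i' k'"
  have "integrable P (\<lambda>\<omega>. ?p \<omega> * ?q \<omega>) \<and> expectation (\<lambda>\<omega>. ?p \<omega> * ?q \<omega>) = (if (i, k) = (i', k') then u - t else 0)"
  proof (cases "(i, k) = (i', k')")
    case True
    then show ?thesis
      using B_incr_moments(3,4)[OF t p] by (auto simp: power2_eq_square)
  next
    case False
    \<comment> \<open>A partition with the single cell from \<open>t\<close> to \<open>u\<close>:
      the independent family then consists of the coordinates of one increment.\<close>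
    define \<tau> where "\<tau> j = (if j = 0 then t else u)" for j :: nat
    let ?D = "\<lambda>(j, i, k) \<omega>. B (\<tau> (Suc j)) \<omega> i k - B (\<tau> j) \<omega> i k"
    let ?a = "(0::nat, i, k)" and ?b = "(0::nat, i', k')"
    have "mono_on {..1} \<tau>" "\<tau> ` {..1} \<subseteq> {0..T}"
      using t by (auto simp: \<tau>_def mono_on_def)
    then have "indep_vars (\<lambda>_. borel) (\<lambda>(j, i, k) \<omega>. B (\<tau> (Suc j)) \<omega> i k - B (\<tau> j) \<omega> i k) ({..<1} \<times> coords N d)"
      by (rule B_indep)
    then have "indep_vars (\<lambda>_. borel) ?D {?a, ?b}"
      by (rule indep_vars_subset) (use p q in \<open>auto simp: coords_def\<close>)
    then have ind: "indep_vars (\<lambda>_. borel) ?D {?a, ?b}" .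
    have D: "?D ?a = ?p" "?D ?b = ?q"
      by (simp_all add: \<tau>_def)
    have int: "integrable P (?D z)" if "z \<in> {?a, ?b}" for z
      using that B_incr_moments(1)[OF t p] B_incr_moments(1)[OF t q] D by (elim insertE) (simp_all only: empty_iff)
    have prod: "(\<Prod>z\<in>{?a, ?b}. F z) = F ?a * F ?b" for F :: "_ \<Rightarrow> real"
      using False by auto
    show ?thesis
      using indep_vars_integrable[OF _ ind int] indep_vars_lebesgue_integral[OF _ ind int] False
      unfolding prod D B_incr_moments(2)[OF t p] by (simp only: finite.intros mult_zero_left if_False simp_thms)
  qed
  then show "integrable P (\<lambda>\<omega>. ?p \<omega> * ?q \<omega>)" "expectation (\<lambda>\<omega>. ?p \<omega> * ?q \<omega>) = (if (i, k) = (i', k') then u - t else 0)"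
    by auto
qed

lemma noise_incr_AE:
  assumes "0 \<le> t" "t \<le> u" "u \<le> T"
  shows "AE \<omega> in P. \<forall>i<N. \<forall>k<d. noise u \<omega> i k - noise t \<omega> i k = \<sigma> * (B u \<omega> i k - B t \<omega> i k)"
  using noise_eq by eventually_elim (use assms in \<open>auto simp: right_diff_distrib\<close>)

lemma noise_measurable_P:
  assumes "0 \<le> t" "t \<le> T" "i < N" "k < d"
  shows "(\<lambda>\<omega>. noise t \<omega> i k) \<in> borel_measurable P"
proof (rule measurable_sub)
  show "(\<lambda>\<omega>. noise t \<omega> i k) \<in> borel_measurable (hist t)"
    using assms by (intro noise_measurable) auto
  show "sets (hist t) \<subseteq> events"
    using assms by (intro history_le_events)
qed simp

text \<open>The martingale property of the noise for the history of \<open>X\<close>. The factor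
  \<open>f\<close> is only assumed integrable, because it will be an earlier stochastic sum times a
  bounded integrand.\<close>

lemma history_noise_mean:
  assumes t: "0 \<le> t" "t \<le> u" "u \<le> T" and ik: "i < N" "k < d"
    and f: "f \<in> borel_measurable (hist t)" "integrable P f"
  shows "integrable P (\<lambda>\<omega>. f \<omega> * (noise u \<omega> i k - noise t \<omega> i k))"
    "expectation (\<lambda>\<omega>. f \<omega> * (noise u \<omega> i k - noise t \<omega> i k)) = 0"
proof -
  let ?D = "\<lambda>\<omega>. \<sigma> * (B u \<omega> i k - B t \<omega> i k)"
  have f': "f \<in> borel_measurable P"
    using f(2) by auto
  have ae: "AE \<omega> in P. f \<omega> * (noise u \<omega> i k - noise t \<omega> i k) = f \<omega> * ?D \<omega>"
    using noise_incr_AE[OF t] by eventually_elim (use ik in auto)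
  have D: "?D \<in> borel_measurable (incr_algebra t u)" "integrable P ?D" "expectation ?D = 0"
    using B_incr_component[OF ik, of u t] B_incr_moments[OF t ik] by auto
  have m: "(\<lambda>\<omega>. f \<omega> * (noise u \<omega> i k - noise t \<omega> i k)) \<in> borel_measurable P" "(\<lambda>\<omega>. f \<omega> * ?D \<omega>) \<in> borel_measurable P"
    using t ik
    by (intro borel_measurable_times[OF f' borel_measurable_diff] borel_measurable_times[OF f' borel_measurable_integrable[OF D(2)]]
        noise_measurable_P; simp)+
  show "integrable P (\<lambda>\<omega>. f \<omega> * (noise u \<omega> i k - noise t \<omega> i k))"
    using indep_integral(1)[OF t f D(1,2)] integrable_cong_AE[OF m ae] by simp
  show "expectation (\<lambda>\<omega>. f \<omega> * (noise u \<omega> i k - noise t \<omega> i k)) = 0"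
    using indep_integral(2)[OF t f D(1,2)] integral_cong_AE[OF m ae] D(3) by simp
qed

text \<open>The conditional covariance of a noise increment is \<sigma>^2 times its length times the
  identity; \<open>f\<close> plays the role of a product of two integrand coordinates.\<close>

lemma history_noise_cross:
  assumes t: "0 \<le> t" "t \<le> u" "u \<le> T" and p: "i < N" "k < d" and q: "i' < N" "k' < d"
    and f: "f \<in> borel_measurable (hist t)" "integrable P f"
  shows "integrable P (\<lambda>\<omega>. f \<omega> * ((noise u \<omega> i k - noise t \<omega> i k) * (noise u \<omega> i' k' - noise t \<omega> i' k')))"
    "expectation (\<lambda>\<omega>. f \<omega> * ((noise u \<omega> i k - noise t \<omega> i k) * (noise u \<omega> i' k' - noise t \<omega> i' k')))
      = (if (i, k) = (i', k') then \<sigma>\<^sup>2 * (u - t) * expectation f else 0)"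
proof -
  let ?D = "\<lambda>\<omega>. \<sigma>\<^sup>2 * ((B u \<omega> i k - B t \<omega> i k) * (B u \<omega> i' k' - B t \<omega> i' k'))"
  let ?n = "\<lambda>\<omega>. f \<omega> * ((noise u \<omega> i k - noise t \<omega> i k) * (noise u \<omega> i' k' - noise t \<omega> i' k'))"
  have f': "f \<in> borel_measurable P"
    using f(2) by auto
  have ae: "AE \<omega> in P. ?n \<omega> = f \<omega> * ?D \<omega>"
    using noise_incr_AE[OF t] by eventually_elim (use p q in \<open>auto simp: power2_eq_square\<close>)
  have D: "?D \<in> borel_measurable (incr_algebra t u)" "integrable P ?D"
    "expectation ?D = (if (i, k) = (i', k') then \<sigma>\<^sup>2 * (u - t) else 0)"
    using B_incr_component[OF p, of u t] B_incr_component[OF q, of u t] B_incr_cross[OF t p q] by auto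
  have m: "?n \<in> borel_measurable P" "(\<lambda>\<omega>. f \<omega> * ?D \<omega>) \<in> borel_measurable P"
    using t p q
    by (intro borel_measurable_times[OF f' borel_measurable_times[OF borel_measurable_diff borel_measurable_diff]]
        borel_measurable_times[OF f' borel_measurable_integrable[OF D(2)]] noise_measurable_P; simp)+
  show "integrable P ?n"
    using indep_integral(1)[OF t f D(1,2)] integrable_cong_AE[OF m ae] by simp
  show "expectation ?n = (if (i, k) = (i', k') then \<sigma>\<^sup>2 * (u - t) * expectation f else 0)"
    using indep_integral(2)[OF t f D(1,2)] integral_cong_AE[OF m ae] D(3) by simp
qed

end

section \<open>Integrals of simple processes\<close>

lemma integrable_times_bounded:
  fixes f g :: "'a \<Rightarrow> real"
  assumes "integrable M f" "g \<in> borel_measurable M" "\<And>x. x \<in> space M \<Longrightarrow> \<bar>g x\<bar> \<le> c"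
  shows "integrable M (\<lambda>x. f x * g x)"
proof (rule Bochner_Integration.integrable_bound)
  show "integrable M (\<lambda>x. c * f x)"
    using assms(1) by simp
  show "(\<lambda>x. f x * g x) \<in> borel_measurable M"
    by (rule borel_measurable_times[OF borel_measurable_integrable[OF assms(1)] assms(2)])
  show "AE x in M. norm (f x * g x) \<le> norm (c * f x)"
  proof (rule AE_I2)
    fix x assume "x \<in> space M"
    then have "\<bar>g x\<bar> \<le> \<bar>c\<bar>"
      using assms(3)[of x] by linarith
    then show "norm (f x * g x) \<le> norm (c * f x)"
      by (simp add: abs_mult mult.commute[of "\<bar>c\<bar>"] mult_left_mono)
  qed
qed

lemma (in finite_measure) integral_sq_le:
  fixes f :: "'a \<Rightarrow> real"
  assumes "integrable M f" "integrable M (\<lambda>x. (f x)\<^sup>2)"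
  shows "(LINT x|M. f x)\<^sup>2 \<le> measure M (space M) * (LINT x|M. (f x)\<^sup>2)"
proof -
  let ?m = "LINT x|M. f x" and ?V = "measure M (space M)"
  have V: "?V \<ge> 0"
    by simp
  show ?thesis
  proof (cases "?V = 0")
    case True
    then have "emeasure M (space M) = 0"
      by (simp add: emeasure_eq_measure)
    then have "AE x in M. f x = 0"
      by (intro AE_I[of _ _ "space M"]) auto
    then have "?m = (LINT x|M. 0)"
      using assms by (intro integral_cong_AE) auto
    then show ?thesis
      by simp
  next
    case False
    have "0 \<le> (LINT x|M. (?V * f x - ?m)\<^sup>2)"
      by (rule integral_nonneg_AE) auto
    also have "\<dots> = (LINT x|M. ?V\<^sup>2 * (f x)\<^sup>2 - 2 * ?V * ?m * f x + ?m\<^sup>2)"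
      by (intro Bochner_Integration.integral_cong refl) (simp add: power2_diff power_mult_distrib algebra_simps)
    also have "\<dots> = ?V\<^sup>2 * (LINT x|M. (f x)\<^sup>2) - 2 * ?V * ?m * ?m + ?m\<^sup>2 * ?V"
      using assms by (simp add: mult.commute)
    also have "\<dots> = ?V * (?V * (LINT x|M. (f x)\<^sup>2) - ?m\<^sup>2)"
      by (simp add: power2_eq_square algebra_simps)
    finally show ?thesis
      using False V by (simp add: zero_le_mult_iff)
  qed
qed

lemma ennreal_sq_add_le: "ennreal ((a + b)\<^sup>2) \<le> 2 * ennreal (a\<^sup>2) + 2 * ennreal (b\<^sup>2)"
proof -
  have "(a + b)\<^sup>2 \<le> 2 * a\<^sup>2 + 2 * b\<^sup>2"
    using sum_squares_ge_zero[of "a - b" 0] by (simp add: power2_eq_square algebra_simps)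
  then have "ennreal ((a + b)\<^sup>2) \<le> ennreal (2 * a\<^sup>2 + 2 * b\<^sup>2)"
    by (rule ennreal_leI)
  then show ?thesis
    by (simp add: ennreal_mult)
qed

context observation
begin

lemma history_measurable_events:
  assumes "f \<in> borel_measurable (hist t)" "t \<le> T"
  shows "f \<in> borel_measurable P"
  by (rule measurable_sub[OF assms(1) history_le_events[OF assms(2)]]) simp

lemma history_measurable_mono:
  assumes "f \<in> borel_measurable (hist s)" "s \<le> t"
  shows "f \<in> borel_measurable (hist t)"
  by (rule measurable_sub[OF assms(1) history_mono[OF assms(2)]]) simp

lemma drift_phi_sq_bound: "inner_cfg N d (drift N d \<phi> x) (drift N d \<phi> x) \<le> real N * (S * R)\<^sup>2"
  using drift_sq_bound[OF N truncate_admissible(1)[OF adm R] truncate_admissible(3)[OF adm R] R, of d x]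
  by (simp add: truncate_admissible(4)[OF adm R])

lemma history_phi_drift_measurable:
  assumes "t \<le> s" "t \<le> T" "i < N" "k < d"
  shows "(\<lambda>(\<omega>, u). drift N d \<phi> (X u \<omega>) i k) \<in> borel_measurable (hist s \<Otimes>\<^sub>M time_interval t)"
  using history_drift_measurable[OF truncate_admissible(1)[OF adm R] assms]
  by (simp add: truncate_admissible(4)[OF adm R])

lemma component_sq_le:
  assumes "i < N" "k < d"
  shows "(x i k)\<^sup>2 \<le> inner_cfg N d x x"
  using member_le_sum[of "(i, k)" "coords N d" "\<lambda>(i, k). x i k * x i k"] assms
  by (simp add: inner_cfg_coords power2_eq_square coords_def case_prod_beta)

lemma drift_phi_integrable:
  assumes "\<omega> \<in> space P" "i < N" "k < d"
  shows "integrable (time_interval T) (\<lambda>u. drift N d \<phi> (X u \<omega>) i k)"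
proof -
  interpret TI: finite_measure "time_interval T"
    by (rule finite_measure_time_interval)
  show ?thesis
  proof (rule TI.integrable_const_bound)
    show "AE u in time_interval T. norm (drift N d \<phi> (X u \<omega>) i k) \<le> sqrt (real N * (S * R)\<^sup>2)"
      using order_trans[OF component_sq_le[OF assms(2,3)] drift_phi_sq_bound]
      by (intro AE_I2) (simp only: real_norm_def real_le_rsqrt real_sqrt_abs[symmetric] real_sqrt_le_iff)
    show "(\<lambda>u. drift N d \<phi> (X u \<omega>) i k) \<in> borel_measurable (time_interval T)"
      using measurable_Pair2[OF history_phi_drift_measurable[of T T i k], of \<omega>] assms by simp
  qed
qed

lemma drift_phi_increment:
  assumes "\<omega> \<in> space P" "i < N" "k < d" "0 \<le> s" "s \<le> t" "t \<le> T"
  shows "(LINT u|time_interval t. drift N d \<phi> (X u \<omega>) i k) - (LINT u|time_interval s. drift N d \<phi> (X u \<omega>) i k)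
    = (LINT u|time_interval T. indicator {s<..t} u * drift N d \<phi> (X u \<omega>) i k)"
proof -
  let ?g = "\<lambda>u. drift N d \<phi> (X u \<omega>) i k"
  have eq: "(LINT u|time_interval r. ?g u) = (LINT u|time_interval T. indicator {0..r} u * ?g u)" if "r \<le> T" for r
    unfolding set_integral_time_interval[symmetric] set_lebesgue_integral_def
    by (intro Bochner_Integration.integral_cong refl) (use that in \<open>auto simp: indicator_def\<close>)
  have int: "integrable (time_interval T) (\<lambda>u. indicator {0..r} u * ?g u)" for r
    using integrable_times_bounded[OF drift_phi_integrable[OF assms(1-3)], of "indicator {0..r}" 1]
    by (simp add: mult.commute measurable_time_interval indicator_def)
  have "(LINT u|time_interval t. ?g u) - (LINT u|time_interval s. ?g u)
      = (LINT u|time_interval T. indicator {0..t} u * ?g u - indicator {0..s} u * ?g u)"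
    using assms int by (simp add: eq)
  also have "\<dots> = (LINT u|time_interval T. indicator {s<..t} u * ?g u)"
    using assms by (intro Bochner_Integration.integral_cong refl) (auto simp: indicator_def)
  finally show ?thesis .
qed

end

section \<open>Ito isometry for simple integrands\<close>

locale simple_integrand = observation +
  fixes K :: nat and \<tau> :: "nat \<Rightarrow> real" and \<xi> :: "nat \<Rightarrow> 'a \<Rightarrow> config"
  assumes simple: "simple_data N d T P X K \<tau> \<xi>"
begin

lemma \<tau>_mono: "i \<le> j \<Longrightarrow> j \<le> K \<Longrightarrow> \<tau> i \<le> \<tau> j"
  using simple by (auto simp: simple_data_def intro: mono_onD)

lemma \<tau>_range: "j \<le> K \<Longrightarrow> 0 \<le> \<tau> j" "j \<le> K \<Longrightarrow> \<tau> j \<le> T"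
  using \<tau>_mono[of 0 j] \<tau>_mono[of j K] simple by (auto simp: simple_data_def)

lemma \<xi>_measurable: "j < K \<Longrightarrow> i < N \<Longrightarrow> k < d \<Longrightarrow> (\<lambda>\<omega>. \<xi> j \<omega> i k) \<in> borel_measurable (hist (\<tau> j))"
  using simple by (simp add: simple_data_def)

lemma \<xi>_bounded:
  obtains c where "c \<ge> 0" "\<And>j i k \<omega>. j < K \<Longrightarrow> i < N \<Longrightarrow> k < d \<Longrightarrow> \<omega> \<in> space P \<Longrightarrow> \<bar>\<xi> j \<omega> i k\<bar> \<le> c"
proof -
  have "\<forall>p\<in>{..<K} \<times> coords N d. \<exists>c. \<forall>\<omega>\<in>space P. \<bar>\<xi> (fst p) \<omega> (fst (snd p)) (snd (snd p))\<bar> \<le> c"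
    using simple by (auto simp: simple_data_def coords_def)
  then obtain c where c: "\<And>p \<omega>. p \<in> {..<K} \<times> coords N d \<Longrightarrow> \<omega> \<in> space P \<Longrightarrow>
      \<bar>\<xi> (fst p) \<omega> (fst (snd p)) (snd (snd p))\<bar> \<le> c p"
    by metis
  have "\<bar>\<xi> j \<omega> i k\<bar> \<le> (\<Sum>p\<in>{..<K} \<times> coords N d. \<bar>c p\<bar>)" if "j < K" "i < N" "k < d" "\<omega> \<in> space P" for j i k \<omega>
  proof -
    have p: "(j, i, k) \<in> {..<K} \<times> coords N d"
      using that by (auto simp: coords_def)
    then have "\<bar>\<xi> j \<omega> i k\<bar> \<le> \<bar>c (j, i, k)\<bar>"
      using c[OF p that(4)] by simp
    also have "\<dots> \<le> (\<Sum>p\<in>{..<K} \<times> coords N d. \<bar>c p\<bar>)"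
      using p by (intro member_le_sum) auto
    finally show ?thesis .
  qed
  then show thesis
    by (intro that[of "\<Sum>p\<in>{..<K} \<times> coords N d. \<bar>c p\<bar>"]) (auto intro: sum_nonneg)
qed

definition \<Delta> :: "nat \<Rightarrow> 'a \<Rightarrow> nat \<times> nat \<Rightarrow> real" where
  "\<Delta> j \<omega> p = noise (\<tau> (Suc j)) \<omega> (fst p) (snd p) - noise (\<tau> j) \<omega> (fst p) (snd p)"

text \<open>The martingale part of the simple integral: the same sum, with increments of
  \<open>noise\<close> in place of those of \<open>X\<close>.\<close>

definition partial_sum :: "nat \<Rightarrow> 'a \<Rightarrow> real" where
  "partial_sum m \<omega> = (\<Sum>j<m. \<Sum>p\<in>coords N d. \<xi> j \<omega> (fst p) (snd p) * \<Delta> j \<omega> p)"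

text \<open>The squared norm of the simple process in L^2(dt x P) up to time
  \<open>\<tau> m\<close>.\<close>

definition energy :: "nat \<Rightarrow> real" where
  "energy m = (\<Sum>j<m. (\<tau> (Suc j) - \<tau> j) * expectation (\<lambda>\<omega>. inner_cfg N d (\<xi> j \<omega>) (\<xi> j \<omega>)))"

lemma \<xi>_events: "j < K \<Longrightarrow> i < N \<Longrightarrow> k < d \<Longrightarrow> (\<lambda>\<omega>. \<xi> j \<omega> i k) \<in> borel_measurable P"
  using \<tau>_range(2)[of j] by (intro history_measurable_events[OF \<xi>_measurable]) simp_all

lemma \<Delta>_measurable: "Suc j \<le> K \<Longrightarrow> p \<in> coords N d \<Longrightarrow> (\<lambda>\<omega>. \<Delta> j \<omega> p) \<in> borel_measurable (hist (\<tau> (Suc j)))"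
  unfolding \<Delta>_def using \<tau>_range[of j] \<tau>_range[of "Suc j"] \<tau>_mono[of j "Suc j"]
  by (intro borel_measurable_diff noise_measurable) (auto simp: coords_def)

text \<open>The isometry by induction on the number of cells. The cross term vanishes because the
  earlier sum times the new integrand is known at time \<open>\<tau> m\<close>, and the square of
  the new term is diagonal because different coordinates of an increment are uncorrelated.
  Measurability in the history has to be carried along for the next step.\<close>

lemma partial_sum_moments:
  assumes "m \<le> K"
  shows "partial_sum m \<in> borel_measurable (hist (\<tau> m)) \<and> integrable P (\<lambda>\<omega>. (partial_sum m \<omega>)\<^sup>2)
    \<and> expectation (partial_sum m) = 0 \<and> expectation (\<lambda>\<omega>. (partial_sum m \<omega>)\<^sup>2) = \<sigma>\<^sup>2 * energy m"
  using assms
proof (induction m)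
  case 0
  then show ?case
    by (simp add: partial_sum_def[abs_def] energy_def)
next
  case (Suc m)
  then have m: "m < K" "m \<le> K"
    by auto
  note IH = Suc.IH[OF m(2)]
  have t: "0 \<le> \<tau> m" "\<tau> m \<le> \<tau> (Suc m)" "\<tau> (Suc m) \<le> T"
    using \<tau>_range[of m] \<tau>_range[of "Suc m"] \<tau>_mono[of m "Suc m"] Suc.prems by auto
  let ?S = "partial_sum m" and ?C = "coords N d"
  let ?x = "\<lambda>p \<omega>. \<xi> m \<omega> (fst p) (snd p)"
  define Y where "Y \<omega> = (\<Sum>p\<in>?C. ?x p \<omega> * \<Delta> m \<omega> p)" for \<omega>
  have step: "partial_sum (Suc m) \<omega> = ?S \<omega> + Y \<omega>" for \<omega>
    by (simp add: partial_sum_def Y_def)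
  obtain c where c: "c \<ge> 0" "\<And>j i k \<omega>. j < K \<Longrightarrow> i < N \<Longrightarrow> k < d \<Longrightarrow> \<omega> \<in> space P \<Longrightarrow> \<bar>\<xi> j \<omega> i k\<bar> \<le> c"
    using \<xi>_bounded by blast
  have S_meas: "?S \<in> borel_measurable P"
    using IH t by (intro history_measurable_events[of ?S "\<tau> m"]) simp_all
  have S_int: "integrable P ?S"
    using S_meas IH by (intro square_integrable_imp_integrable[of ?S]) auto
  have x_meas: "?x p \<in> borel_measurable (hist (\<tau> m))" "?x p \<in> borel_measurable P" if "p \<in> ?C" for p
    using \<xi>_measurable[OF m(1)] \<xi>_events[OF m(1)] that by (auto simp: coords_def)
  have x_bd: "\<bar>?x p \<omega>\<bar> \<le> c" if "p \<in> ?C" "\<omega> \<in> space P" for p \<omega>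
    using c(2)[OF m(1)] that by (auto simp: coords_def)
  have x_int: "integrable P (?x p)" if "p \<in> ?C" for p
    using integrable_times_bounded[of P "\<lambda>_. 1" "?x p" c] x_meas x_bd that by simp
  have xx_int: "integrable P (\<lambda>\<omega>. ?x p \<omega> * ?x q \<omega>)" if "p \<in> ?C" "q \<in> ?C" for p q
    using x_int x_meas x_bd that by (intro integrable_times_bounded[where c = c]) auto
  have Sx_int: "integrable P (\<lambda>\<omega>. ?S \<omega> * ?x p \<omega>)" if "p \<in> ?C" for p
    using S_int x_meas x_bd that by (intro integrable_times_bounded[where c = c]) auto
  have xD: "integrable P (\<lambda>\<omega>. ?x p \<omega> * \<Delta> m \<omega> p)" "expectation (\<lambda>\<omega>. ?x p \<omega> * \<Delta> m \<omega> p) = 0" if "p \<in> ?C" for p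
    unfolding \<Delta>_def using that
    by (intro history_noise_mean[OF t _ _ x_meas(1)[OF that] x_int[OF that]]; auto simp: coords_def)+
  have SxD: "integrable P (\<lambda>\<omega>. (?S \<omega> * ?x p \<omega>) * \<Delta> m \<omega> p)" "expectation (\<lambda>\<omega>. (?S \<omega> * ?x p \<omega>) * \<Delta> m \<omega> p) = 0"
    if "p \<in> ?C" for p
    unfolding \<Delta>_def using that IH
    by (intro history_noise_mean[OF t _ _ borel_measurable_times[OF _ x_meas(1)[OF that]] Sx_int[OF that]]; auto simp: coords_def)+
  have xxDD: "integrable P (\<lambda>\<omega>. (?x p \<omega> * ?x q \<omega>) * (\<Delta> m \<omega> p * \<Delta> m \<omega> q))"
      "expectation (\<lambda>\<omega>. (?x p \<omega> * ?x q \<omega>) * (\<Delta> m \<omega> p * \<Delta> m \<omega> q))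
        = (if p = q then \<sigma>\<^sup>2 * (\<tau> (Suc m) - \<tau> m) * expectation (\<lambda>\<omega>. ?x p \<omega> * ?x q \<omega>) else 0)"
    if "p \<in> ?C" "q \<in> ?C" for p q
  proof -
    have p: "fst p < N" "snd p < d" and q: "fst q < N" "snd q < d"
      using that by (auto simp: coords_def)
    from history_noise_cross[OF t p q borel_measurable_times[OF x_meas(1)[OF that(1)] x_meas(1)[OF that(2)]] xx_int[OF that]]
    show "integrable P (\<lambda>\<omega>. (?x p \<omega> * ?x q \<omega>) * (\<Delta> m \<omega> p * \<Delta> m \<omega> q))"
      "expectation (\<lambda>\<omega>. (?x p \<omega> * ?x q \<omega>) * (\<Delta> m \<omega> p * \<Delta> m \<omega> q))
        = (if p = q then \<sigma>\<^sup>2 * (\<tau> (Suc m) - \<tau> m) * expectation (\<lambda>\<omega>. ?x p \<omega> * ?x q \<omega>) else 0)"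
      unfolding \<Delta>_def prod.collapse .
  qed
  have Y_int: "integrable P Y" "expectation Y = 0"
    unfolding Y_def using xD by simp_all
  have SY: "?S \<omega> * Y \<omega> = (\<Sum>p\<in>?C. (?S \<omega> * ?x p \<omega>) * \<Delta> m \<omega> p)" for \<omega>
    by (simp add: Y_def sum_distrib_left mult.assoc)
  have YY: "(Y \<omega>)\<^sup>2 = (\<Sum>p\<in>?C. \<Sum>q\<in>?C. (?x p \<omega> * ?x q \<omega>) * (\<Delta> m \<omega> p * \<Delta> m \<omega> q))" for \<omega>
    by (simp add: Y_def power2_eq_square sum_product mult_ac)
  have SY_int: "integrable P (\<lambda>\<omega>. ?S \<omega> * Y \<omega>)" "expectation (\<lambda>\<omega>. ?S \<omega> * Y \<omega>) = 0"
    unfolding SY using SxD by simp_all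
  have YY_int: "integrable P (\<lambda>\<omega>. (Y \<omega>)\<^sup>2)"
    unfolding YY using xxDD by (intro Bochner_Integration.integrable_sum) auto
  have "expectation (\<lambda>\<omega>. (Y \<omega>)\<^sup>2)
      = (\<Sum>p\<in>?C. \<Sum>q\<in>?C. if p = q then \<sigma>\<^sup>2 * (\<tau> (Suc m) - \<tau> m) * expectation (\<lambda>\<omega>. ?x p \<omega> * ?x q \<omega>) else 0)"
    unfolding YY using xxDD by (simp add: Bochner_Integration.integral_sum cong: sum.cong)
  also have "\<dots> = \<sigma>\<^sup>2 * (\<tau> (Suc m) - \<tau> m) * (\<Sum>p\<in>?C. expectation (\<lambda>\<omega>. ?x p \<omega> * ?x p \<omega>))"
    by (simp add: sum.delta sum_distrib_left)
  also have "(\<Sum>p\<in>?C. expectation (\<lambda>\<omega>. ?x p \<omega> * ?x p \<omega>)) = expectation (\<lambda>\<omega>. inner_cfg N d (\<xi> m \<omega>) (\<xi> m \<omega>))"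
    unfolding inner_cfg_coords case_prod_beta using xx_int by (simp add: Bochner_Integration.integral_sum)
  finally have YY_exp: "expectation (\<lambda>\<omega>. (Y \<omega>)\<^sup>2)
      = \<sigma>\<^sup>2 * ((\<tau> (Suc m) - \<tau> m) * expectation (\<lambda>\<omega>. inner_cfg N d (\<xi> m \<omega>) (\<xi> m \<omega>)))"
    by simp
  have sq: "(partial_sum (Suc m) \<omega>)\<^sup>2 = (?S \<omega>)\<^sup>2 + 2 * (?S \<omega> * Y \<omega>) + (Y \<omega>)\<^sup>2" for \<omega>
    by (simp add: step power2_sum)
  have "partial_sum (Suc m) \<in> borel_measurable (hist (\<tau> (Suc m)))"
  proof -
    have "?S \<in> borel_measurable (hist (\<tau> (Suc m)))"
      by (rule history_measurable_mono[OF conjunct1[OF IH] t(2)])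
    moreover have "Y \<in> borel_measurable (hist (\<tau> (Suc m)))"
      unfolding Y_def
      by (intro borel_measurable_sum borel_measurable_times \<Delta>_measurable[OF Suc.prems] history_measurable_mono[OF x_meas(1) t(2)])
    ultimately show ?thesis
      unfolding step[abs_def] by (rule borel_measurable_add)
  qed
  moreover have "expectation (partial_sum (Suc m)) = 0"
    unfolding step[abs_def] using S_int Y_int IH by simp
  moreover have "integrable P (\<lambda>\<omega>. (partial_sum (Suc m) \<omega>)\<^sup>2)"
    unfolding sq using IH SY_int YY_int by simp
  moreover have "expectation (\<lambda>\<omega>. (partial_sum (Suc m) \<omega>)\<^sup>2) = \<sigma>\<^sup>2 * energy (Suc m)"
  proof -
    have "energy (Suc m) = energy m + (\<tau> (Suc m) - \<tau> m) * expectation (\<lambda>\<omega>. inner_cfg N d (\<xi> m \<omega>) (\<xi> m \<omega>))"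
      by (simp add: energy_def)
    then show ?thesis
      unfolding sq using IH SY_int YY_int YY_exp by (simp add: distrib_left)
  qed
  ultimately show ?case
    by blast
qed

text \<open>The definition of \<open>noise\<close> splits every increment of \<open>X\<close> into a
  noise part and a drift part, for each outcome and not only almost surely; the drift parts add up
  to a time integral.\<close>

lemma simple_process_inner_integral:
  assumes \<omega>: "\<omega> \<in> space P"
  shows "integrable (time_interval T) (\<lambda>u. inner_cfg N d (simple_process K \<tau> \<xi> u \<omega>) (drift N d \<phi> (X u \<omega>)))"
    and "simple_integral N d X K \<tau> \<xi> \<omega> = partial_sum K \<omega>
      + (LINT u|time_interval T. inner_cfg N d (simple_process K \<tau> \<xi> u \<omega>) (drift N d \<phi> (X u \<omega>)))"
proof -
  let ?g = "\<lambda>p u. drift N d \<phi> (X u \<omega>) (fst p) (snd p)"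
  let ?x = "\<lambda>j p. \<xi> j \<omega> (fst p) (snd p)"
  let ?I = "\<lambda>t p. LINT u|time_interval t. ?g p u"
  have inner: "inner_cfg N d (simple_process K \<tau> \<xi> u \<omega>) (drift N d \<phi> (X u \<omega>))
      = (\<Sum>j<K. \<Sum>p\<in>coords N d. ?x j p * (indicator {\<tau> j<..\<tau> (Suc j)} u * ?g p u))" for u
    unfolding inner_cfg_coords case_prod_beta simple_process_def sum_distrib_right
    by (subst sum.swap) (simp add: mult_ac)
  have int: "integrable (time_interval T) (\<lambda>u. indicator {\<tau> j<..\<tau> (Suc j)} u * ?g p u)" if "p \<in> coords N d" for j p
    using integrable_times_bounded[OF drift_phi_integrable[OF \<omega>, of "fst p" "snd p"], of "indicator {\<tau> j<..\<tau> (Suc j)}" 1] that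
    by (auto simp: mult.commute measurable_time_interval indicator_def coords_def)
  show "integrable (time_interval T) (\<lambda>u. inner_cfg N d (simple_process K \<tau> \<xi> u \<omega>) (drift N d \<phi> (X u \<omega>)))"
    unfolding inner using int by (intro Bochner_Integration.integrable_sum) auto
  have "(LINT u|time_interval T. inner_cfg N d (simple_process K \<tau> \<xi> u \<omega>) (drift N d \<phi> (X u \<omega>)))
      = (\<Sum>j<K. \<Sum>p\<in>coords N d. ?x j p * (LINT u|time_interval T. indicator {\<tau> j<..\<tau> (Suc j)} u * ?g p u))"
    unfolding inner using int by (simp add: Bochner_Integration.integral_sum Bochner_Integration.integrable_sum)
  also have "\<dots> = (\<Sum>j<K. \<Sum>p\<in>coords N d. ?x j p * (?I (\<tau> (Suc j)) p - ?I (\<tau> j) p))"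
    using \<tau>_range \<tau>_mono
    by (intro sum.cong refl arg_cong2[where f = "(*)"] drift_phi_increment[OF \<omega>, symmetric]) (auto simp: coords_def)
  finally have eq: "(LINT u|time_interval T. inner_cfg N d (simple_process K \<tau> \<xi> u \<omega>) (drift N d \<phi> (X u \<omega>)))
      = (\<Sum>j<K. \<Sum>p\<in>coords N d. ?x j p * (?I (\<tau> (Suc j)) p - ?I (\<tau> j) p))" .
  have "partial_sum K \<omega> + (LINT u|time_interval T. inner_cfg N d (simple_process K \<tau> \<xi> u \<omega>) (drift N d \<phi> (X u \<omega>)))
      = (\<Sum>j<K. \<Sum>p\<in>coords N d. ?x j p * (X (\<tau> (Suc j)) \<omega> (fst p) (snd p) - X (\<tau> j) \<omega> (fst p) (snd p)))"
    unfolding eq partial_sum_def \<Delta>_def noise_def sum.distrib[symmetric]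
    by (intro sum.cong refl) (simp only: distrib_left[symmetric], simp)
  then show "simple_integral N d X K \<tau> \<xi> \<omega> = partial_sum K \<omega>
      + (LINT u|time_interval T. inner_cfg N d (simple_process K \<tau> \<xi> u \<omega>) (drift N d \<phi> (X u \<omega>)))"
    by (simp add: simple_integral_def inner_cfg_coords case_prod_beta)
qed

lemma simple_process_on:
  assumes "j < K" "u \<in> {\<tau> j<..\<tau> (Suc j)}"
  shows "simple_process K \<tau> \<xi> u \<omega> = \<xi> j \<omega>"
    and "(\<Sum>l<K. indicator {\<tau> l<..\<tau> (Suc l)} u * f l) = (f j :: ennreal)"
proof -
  have ind: "indicator {\<tau> l<..\<tau> (Suc l)} u = (if l = j then 1 else 0 :: 'c :: zero_neq_one)" if "l < K" for l
  proof -
    have "u \<notin> {\<tau> l<..\<tau> (Suc l)}" if "l \<noteq> j"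
    proof (cases "l < j")
      case True
      then show ?thesis
        using \<tau>_mono[of "Suc l" j] assms by auto
    next
      case False
      then show ?thesis
        using \<tau>_mono[of "Suc j" l] assms that \<open>l < K\<close> by auto
    qed
    then show ?thesis
      using assms by (auto simp: indicator_def)
  qed
  show "simple_process K \<tau> \<xi> u \<omega> = \<xi> j \<omega>"
  proof (intro ext)
    fix i k
    have "(\<Sum>l<K. indicator {\<tau> l<..\<tau> (Suc l)} u * \<xi> l \<omega> i k) = (\<Sum>l<K. if l = j then \<xi> l \<omega> i k else 0)"
      by (rule sum.cong[OF refl], subst ind) auto
    then show "simple_process K \<tau> \<xi> u \<omega> i k = \<xi> j \<omega> i k"
      using assms(1) by (simp add: simple_process_def sum.delta)
  qed
  show "(\<Sum>l<K. indicator {\<tau> l<..\<tau> (Suc l)} u * f l) = f j"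
  proof -
    have "(\<Sum>l<K. indicator {\<tau> l<..\<tau> (Suc l)} u * f l) = (\<Sum>l<K. if l = j then f l else 0)"
      by (rule sum.cong[OF refl], subst ind) auto
    then show ?thesis
      using assms(1) by (simp add: sum.delta)
  qed
qed

text \<open>A time lies in at most one cell of the partition, and there the process equals
  \<open>\<xi> j\<close>; outside all cells the left integrand is 0.\<close>

lemma energy_le:
  "ennreal (energy K) \<le> (\<integral>\<^sup>+u. (\<integral>\<^sup>+\<omega>. ennreal ((norm_cfg N d (simple_process K \<tau> \<xi> u \<omega>))\<^sup>2) \<partial>P) \<partial>time_interval T)"
proof -
  obtain c where c: "c \<ge> 0" "\<And>j i k \<omega>. j < K \<Longrightarrow> i < N \<Longrightarrow> k < d \<Longrightarrow> \<omega> \<in> space P \<Longrightarrow> \<bar>\<xi> j \<omega> i k\<bar> \<le> c"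
    using \<xi>_bounded by blast
  let ?c = "\<lambda>j. \<integral>\<^sup>+\<omega>. ennreal ((norm_cfg N d (\<xi> j \<omega>))\<^sup>2) \<partial>P"
  have c_eq: "?c j = ennreal (expectation (\<lambda>\<omega>. inner_cfg N d (\<xi> j \<omega>) (\<xi> j \<omega>)))" if "j < K" for j
  proof -
    have "integrable P (\<lambda>\<omega>. \<xi> j \<omega> i k * \<xi> j \<omega> i k)" if "i < N" "k < d" for i k
      using \<xi>_events[OF \<open>j < K\<close> that] c(2)[OF \<open>j < K\<close> that]
        integrable_times_bounded[of P "\<lambda>_. 1" "\<lambda>\<omega>. \<xi> j \<omega> i k" c]
      by (intro integrable_times_bounded[where c = c]) auto
    then have "integrable P (\<lambda>\<omega>. inner_cfg N d (\<xi> j \<omega>) (\<xi> j \<omega>))"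
      unfolding inner_cfg_def by (intro Bochner_Integration.integrable_sum) auto
    then show ?thesis
      unfolding norm_cfg_sq by (intro nn_integral_eq_integral) (auto simp: inner_cfg_nonneg)
  qed
  have "ennreal (energy K) = (\<Sum>j<K. ennreal (\<tau> (Suc j) - \<tau> j) * ?c j)"
    unfolding energy_def using \<tau>_mono
    by (subst sum_ennreal[symmetric])
      (auto intro!: sum.cong mult_nonneg_nonneg integral_nonneg_AE simp: inner_cfg_nonneg ennreal_mult c_eq)
  also have "\<dots> = (\<Sum>j<K. \<integral>\<^sup>+u. indicator {\<tau> j<..\<tau> (Suc j)} u * ?c j \<partial>time_interval T)"
  proof (rule sum.cong[OF refl])
    fix j assume "j \<in> {..<K}"
    then have j: "0 \<le> \<tau> j" "\<tau> j \<le> \<tau> (Suc j)" "\<tau> (Suc j) \<le> T"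
      using \<tau>_range[of j] \<tau>_range[of "Suc j"] \<tau>_mono[of j "Suc j"] by auto
    then have "emeasure (time_interval T) {\<tau> j<..\<tau> (Suc j)} = ennreal (\<tau> (Suc j) - \<tau> j)"
      unfolding time_interval_def by (subst emeasure_restrict_space) auto
    moreover have "{\<tau> j<..\<tau> (Suc j)} \<in> sets (time_interval T)"
      using j by (auto simp: time_interval_def sets_restrict_space intro!: image_eqI[of _ _ "{\<tau> j<..\<tau> (Suc j)}"])
    ultimately show "ennreal (\<tau> (Suc j) - \<tau> j) * ?c j = (\<integral>\<^sup>+u. indicator {\<tau> j<..\<tau> (Suc j)} u * ?c j \<partial>time_interval T)"
      by (simp add: nn_integral_multc)
  qed
  also have "\<dots> = (\<integral>\<^sup>+u. (\<Sum>j<K. indicator {\<tau> j<..\<tau> (Suc j)} u * ?c j) \<partial>time_interval T)"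
    by (intro nn_integral_sum[symmetric] measurable_time_interval) measurable
  also have "\<dots> \<le> (\<integral>\<^sup>+u. (\<integral>\<^sup>+\<omega>. ennreal ((norm_cfg N d (simple_process K \<tau> \<xi> u \<omega>))\<^sup>2) \<partial>P) \<partial>time_interval T)"
  proof (rule nn_integral_mono)
    fix u
    show "(\<Sum>j<K. indicator {\<tau> j<..\<tau> (Suc j)} u * ?c j) \<le> (\<integral>\<^sup>+\<omega>. ennreal ((norm_cfg N d (simple_process K \<tau> \<xi> u \<omega>))\<^sup>2) \<partial>P)"
    proof (cases "\<exists>j<K. u \<in> {\<tau> j<..\<tau> (Suc j)}")
      case True
      then obtain j where "j < K" "u \<in> {\<tau> j<..\<tau> (Suc j)}"
        by blast
      then show ?thesis
        by (simp only: simple_process_on order_refl)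
    next
      case False
      then have "(\<Sum>j<K. indicator {\<tau> j<..\<tau> (Suc j)} u * ?c j) = 0"
        by (intro sum.neutral) (auto simp: indicator_def)
      then show ?thesis
        by simp
    qed
  qed
  finally show ?thesis .
qed

end

section \<open>Approximation of stochastic integrals\<close>

lemma (in observation) kernel_drift_measurable:
  assumes "h \<in> kernels R" "g \<in> kernels R" "t \<le> T"
  shows "(\<lambda>(\<omega>, u). inner_cfg N d (drift N d h (X u \<omega>)) (drift N d g (X u \<omega>))) \<in> borel_measurable (hist T \<Otimes>\<^sub>M time_interval t)"
proof -
  have "(\<lambda>z. inner_cfg N d (drift N d h (X (snd z) (fst z))) (drift N d g (X (snd z) (fst z))))
      \<in> borel_measurable (hist T \<Otimes>\<^sub>M time_interval t)"
    using history_drift_measurable[OF assms(1), of t T] history_drift_measurable[OF assms(2), of t T] assms(3)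
    by (intro inner_cfg_measurable) (auto simp: case_prod_beta')
  then show ?thesis
    by (simp add: case_prod_beta')
qed

lemma inner_cfg_abs_le: "\<bar>inner_cfg N d x y\<bar> \<le> sqrt (inner_cfg N d x x * inner_cfg N d y y)"
  using inner_cfg_Cauchy_Schwarz[of N d x y] by (simp add: real_le_rsqrt)

lemma inner_drift_bound:
  assumes "N > 0" "R > 0" "h \<in> kernels R" "g \<in> kernels R"
  obtains c where "c \<ge> 0" "\<And>x. \<bar>inner_cfg N d (drift N d h x) (drift N d g x)\<bar> \<le> c"
proof -
  obtain c1 c2 where c: "\<And>r. \<bar>h r\<bar> \<le> c1" "\<And>r. \<bar>g r\<bar> \<le> c2"
    using assms by (auto simp: kernels_def)
  have "\<bar>inner_cfg N d (drift N d h x) (drift N d g x)\<bar> \<le> sqrt ((real N * (c1 * R)\<^sup>2) * (real N * (c2 * R)\<^sup>2))" for x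
    using drift_sq_bound[OF assms(1,3) c(1) assms(2), of d x] drift_sq_bound[OF assms(1,4) c(2) assms(2), of d x]
    by (intro order_trans[OF inner_cfg_abs_le] real_sqrt_le_mono mult_mono) (auto simp: inner_cfg_nonneg)
  then show thesis
    by (intro that[of "sqrt ((real N * (c1 * R)\<^sup>2) * (real N * (c2 * R)\<^sup>2))"]) auto
qed

context simple_integrand
begin

lemma simple_process_measurable:
  assumes "i < N" "k < d"
  shows "(\<lambda>(\<omega>, u). simple_process K \<tau> \<xi> u \<omega> i k) \<in> borel_measurable (hist T \<Otimes>\<^sub>M time_interval T)"
proof -
  have "(\<lambda>z. indicator {\<tau> j<..\<tau> (Suc j)} (snd z) * \<xi> j (fst z) i k) \<in> borel_measurable (hist T \<Otimes>\<^sub>M time_interval T)"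
    if "j < K" for j
  proof (rule borel_measurable_times)
    show "(\<lambda>z. indicator {\<tau> j<..\<tau> (Suc j)} (snd z) :: real) \<in> borel_measurable (hist T \<Otimes>\<^sub>M time_interval T)"
      by (rule measurable_compose[OF measurable_snd measurable_time_interval]) measurable
    show "(\<lambda>z. \<xi> j (fst z) i k) \<in> borel_measurable (hist T \<Otimes>\<^sub>M time_interval T)"
    proof -
      have "\<tau> j \<le> T"
        using \<tau>_range(2)[of j] that by simp
      from history_measurable_mono[OF \<xi>_measurable[OF that assms] this]
      show ?thesis
        by (rule measurable_compose[OF measurable_fst])
    qed
  qed
  then have "(\<lambda>z. \<Sum>j<K. indicator {\<tau> j<..\<tau> (Suc j)} (snd z) * \<xi> j (fst z) i k) \<in> borel_measurable (hist T \<Otimes>\<^sub>M time_interval T)"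
    by (intro borel_measurable_sum) (simp only: lessThan_iff)
  then show ?thesis
    by (simp only: simple_process_def case_prod_beta')
qed

lemma simple_process_bounded:
  obtains c where "c \<ge> 0" "\<And>u \<omega>. \<omega> \<in> space P \<Longrightarrow> inner_cfg N d (simple_process K \<tau> \<xi> u \<omega>) (simple_process K \<tau> \<xi> u \<omega>) \<le> c"
proof -
  obtain c where c: "c \<ge> 0" "\<And>j i k \<omega>. j < K \<Longrightarrow> i < N \<Longrightarrow> k < d \<Longrightarrow> \<omega> \<in> space P \<Longrightarrow> \<bar>\<xi> j \<omega> i k\<bar> \<le> c"
    using \<xi>_bounded by blast
  have "\<bar>simple_process K \<tau> \<xi> u \<omega> i k\<bar> \<le> real K * c" if "i < N" "k < d" "\<omega> \<in> space P" for u \<omega> i k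
  proof -
    have "\<bar>simple_process K \<tau> \<xi> u \<omega> i k\<bar> \<le> (\<Sum>j<K. c)"
      unfolding simple_process_def using c that
      by (intro order_trans[OF sum_abs sum_mono]) (auto simp: abs_mult indicator_def)
    then show ?thesis
      by simp
  qed
  then have "simple_process K \<tau> \<xi> u \<omega> i k * simple_process K \<tau> \<xi> u \<omega> i k \<le> (real K * c)\<^sup>2" if "i < N" "k < d" "\<omega> \<in> space P" for u \<omega> i k
    using that by (metis abs_ge_zero abs_mult_self_eq mult_mono' power2_eq_square)
  then have "inner_cfg N d (simple_process K \<tau> \<xi> u \<omega>) (simple_process K \<tau> \<xi> u \<omega>) \<le> (\<Sum>i<N. \<Sum>k<d. (real K * c)\<^sup>2)"
    if "\<omega> \<in> space P" for u \<omega>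
    unfolding inner_cfg_def using that by (intro sum_mono) auto
  then show thesis
    by (intro that[of "\<Sum>i<N. \<Sum>k<d. (real K * c)\<^sup>2"]) (auto intro: sum_nonneg)
qed

text \<open>\<open>Z\<close> is what remains of the integral against \<open>X\<close> after its
  drift part is removed. The drift part depends continuously on the integrand since the drift of
  \<open>\<phi>\<close> is bounded: Cauchy-Schwarz in time contributes \<open>T\<close>, and the
  bound of the drift contributes \<open>real N * (S * R)\<^sup>2\<close>. Here \<open>a\<close> and
  \<open>b\<close> are the two errors that tend to 0 in the definition of the Ito integral.\<close>

lemma simple_error_bound:
  assumes h: "h \<in> kernels R" and I: "I \<in> borel_measurable P"
  defines "Z \<equiv> \<lambda>\<omega>. I \<omega> - (LINT u|time_interval T. inner_cfg N d (drift N d h (X u \<omega>)) (drift N d \<phi> (X u \<omega>)))"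
  defines "a \<equiv> \<integral>\<^sup>+u. (\<integral>\<^sup>+\<omega>. ennreal ((norm_cfg N d (\<lambda>i k. simple_process K \<tau> \<xi> u \<omega> i k - drift N d h (X u \<omega>) i k))\<^sup>2) \<partial>P) \<partial>time_interval T"
  defines "b \<equiv> \<integral>\<^sup>+\<omega>. ennreal ((simple_integral N d X K \<tau> \<xi> \<omega> - I \<omega>)\<^sup>2) \<partial>P"
  defines "A \<equiv> \<integral>\<^sup>+u. (\<integral>\<^sup>+\<omega>. ennreal ((norm_cfg N d (drift N d h (X u \<omega>)))\<^sup>2) \<partial>P) \<partial>time_interval T"
  shows "(\<integral>\<^sup>+\<omega>. ennreal ((Z \<omega> - partial_sum K \<omega>)\<^sup>2) \<partial>P) \<le> 2 * b + 2 * (ennreal (T * (real N * (S * R)\<^sup>2)) * a)"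
    and "ennreal (energy K) \<le> 2 * a + 2 * A"
proof -
  interpret TI: finite_measure "time_interval T"
    by (rule finite_measure_time_interval)
  interpret pair_sigma_finite P "time_interval T"
    by unfold_locales
  let ?H = "\<lambda>u \<omega>. drift N d h (X u \<omega>)" and ?s = "\<lambda>u \<omega>. simple_process K \<tau> \<xi> u \<omega>" and ?f = "\<lambda>u \<omega>. drift N d \<phi> (X u \<omega>)"
  let ?e = "\<lambda>u \<omega> i k. ?s u \<omega> i k - ?H u \<omega> i k"
  let ?HP = "hist T \<Otimes>\<^sub>M time_interval T" and ?PT = "P \<Otimes>\<^sub>M time_interval T"
  have up: "f \<in> borel_measurable ?PT" if "f \<in> borel_measurable ?HP" for f :: "_ \<Rightarrow> real"
  proof -
    have "(\<lambda>x. x) \<in> measurable P (hist T)"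
      using history_le_events[of T] by (auto simp: measurable_def)
    from measurable_compose[OF measurable_fst this]
    have "(\<lambda>z. (fst z, snd z)) \<in> measurable ?PT ?HP"
      by (rule measurable_Pair[OF _ measurable_snd])
    from measurable_compose[OF this that] show ?thesis
      by simp
  qed
  have s_meas: "(\<lambda>z. ?s (snd z) (fst z) i k) \<in> borel_measurable ?HP"
    and H_meas: "(\<lambda>z. ?H (snd z) (fst z) i k) \<in> borel_measurable ?HP"
    and f_meas: "(\<lambda>z. ?f (snd z) (fst z) i k) \<in> borel_measurable ?HP" if "i < N" "k < d" for i k
    using simple_process_measurable[OF that] history_drift_measurable[OF h, of T T i k] history_phi_drift_measurable[of T T i k] that
    by (simp_all add: case_prod_beta')
  have ee_meas: "(\<lambda>(\<omega>, u). inner_cfg N d (?e u \<omega>) (?e u \<omega>)) \<in> borel_measurable ?HP"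
    unfolding case_prod_beta' by (intro inner_cfg_measurable borel_measurable_diff s_meas H_meas) auto
  have ef_meas: "(\<lambda>(\<omega>, u). inner_cfg N d (?e u \<omega>) (?f u \<omega>)) \<in> borel_measurable ?HP"
    unfolding case_prod_beta' by (intro inner_cfg_measurable borel_measurable_diff s_meas H_meas f_meas) auto
  have HH_meas: "(\<lambda>(\<omega>, u). inner_cfg N d (?H u \<omega>) (?H u \<omega>)) \<in> borel_measurable ?HP"
    unfolding case_prod_beta' by (intro inner_cfg_measurable H_meas) auto
  obtain cs where cs: "cs \<ge> 0" "\<And>u \<omega>. \<omega> \<in> space P \<Longrightarrow> inner_cfg N d (?s u \<omega>) (?s u \<omega>) \<le> cs"
    using simple_process_bounded by blast
  obtain cH where cH: "cH \<ge> 0" "\<And>x. \<bar>inner_cfg N d (drift N d h x) (drift N d h x)\<bar> \<le> cH"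
    using inner_drift_bound[OF N R h h] by blast
  have minus: "inner_cfg N d (\<lambda>i k. - x i k) (\<lambda>i k. - x i k) = inner_cfg N d x x" for x
    by (simp add: inner_cfg_def)
  have ee_le: "inner_cfg N d (?e u \<omega>) (?e u \<omega>) \<le> 2 * cs + 2 * cH" if "\<omega> \<in> space P" for u \<omega>
    using inner_cfg_add_le[of N d "?s u \<omega>" "\<lambda>i k. - ?H u \<omega> i k"] cs(2)[OF that, of u] cH(2)[of "X u \<omega>"]
    by (simp add: minus)
  have ef_sq: "(inner_cfg N d (?e u \<omega>) (?f u \<omega>))\<^sup>2 \<le> real N * (S * R)\<^sup>2 * inner_cfg N d (?e u \<omega>) (?e u \<omega>)" for u \<omega>
    using mult_left_mono[OF drift_phi_sq_bound[of "X u \<omega>"] inner_cfg_nonneg[of N d "?e u \<omega>"]]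
      inner_cfg_Cauchy_Schwarz[of N d "?e u \<omega>" "?f u \<omega>"] by (simp add: mult_ac)
  have sect: "(\<lambda>u. F \<omega> u) \<in> borel_measurable (time_interval T)" if "\<omega> \<in> space P" "(\<lambda>(\<omega>, u). F \<omega> u) \<in> borel_measurable ?HP"
    for F :: "'a \<Rightarrow> real \<Rightarrow> real" and \<omega>
    using measurable_Pair2[OF that(2), of \<omega>] that(1) by simp
  let ?C = "real N * (S * R)\<^sup>2"
  have key: "ennreal ((Z \<omega> - partial_sum K \<omega>)\<^sup>2) \<le> 2 * ennreal ((simple_integral N d X K \<tau> \<xi> \<omega> - I \<omega>)\<^sup>2)
      + 2 * (ennreal (T * ?C) * (\<integral>\<^sup>+u. ennreal (inner_cfg N d (?e u \<omega>) (?e u \<omega>)) \<partial>time_interval T))"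
    if \<omega>: "\<omega> \<in> space P" for \<omega>
  proof -
    have ee_int: "integrable (time_interval T) (\<lambda>u. inner_cfg N d (?e u \<omega>) (?e u \<omega>))"
      using ee_le[OF \<omega>] sect[OF \<omega> ee_meas]
      by (intro TI.integrable_const_bound[where B = "2 * cs + 2 * cH"]) (auto simp: inner_cfg_nonneg)
    have ef_sq_int: "integrable (time_interval T) (\<lambda>u. (inner_cfg N d (?e u \<omega>) (?f u \<omega>))\<^sup>2)"
      using ef_sq sect[OF \<omega> ef_meas]
      by (intro Bochner_Integration.integrable_bound[OF integrable_mult_right[OF ee_int, of ?C]]) (auto simp: inner_cfg_nonneg)
    have ef_int: "integrable (time_interval T) (\<lambda>u. inner_cfg N d (?e u \<omega>) (?f u \<omega>))"
      using sect[OF \<omega> ef_meas] ef_sq_int by (rule TI.square_integrable_imp_integrable)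
    have Hf_int: "integrable (time_interval T) (\<lambda>u. inner_cfg N d (?H u \<omega>) (?f u \<omega>))"
      using Bochner_Integration.integrable_diff[OF simple_process_inner_integral(1)[OF \<omega>] ef_int]
        inner_cfg_lincomb[of N d 1 "?s _ \<omega>" "-1" "?H _ \<omega>"] by simp
    have "(LINT u|time_interval T. inner_cfg N d (?s u \<omega>) (?f u \<omega>)) - (LINT u|time_interval T. inner_cfg N d (?H u \<omega>) (?f u \<omega>))
        = (LINT u|time_interval T. inner_cfg N d (?e u \<omega>) (?f u \<omega>))"
      using simple_process_inner_integral(1)[OF \<omega>] Hf_int inner_cfg_lincomb[of N d 1 "?s _ \<omega>" "-1" "?H _ \<omega>"]
      by (subst Bochner_Integration.integral_diff[symmetric]) simp_all
    then have Z_eq: "Z \<omega> - partial_sum K \<omega> = - (simple_integral N d X K \<tau> \<xi> \<omega> - I \<omega>)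
        + (LINT u|time_interval T. inner_cfg N d (?e u \<omega>) (?f u \<omega>))"
      using simple_process_inner_integral(2)[OF \<omega>] by (simp add: Z_def)
    have "ennreal ((Z \<omega> - partial_sum K \<omega>)\<^sup>2) \<le> 2 * ennreal ((simple_integral N d X K \<tau> \<xi> \<omega> - I \<omega>)\<^sup>2)
        + 2 * ennreal ((LINT u|time_interval T. inner_cfg N d (?e u \<omega>) (?f u \<omega>))\<^sup>2)"
      unfolding Z_eq
      by (rule ennreal_sq_add_le[of "- (simple_integral N d X K \<tau> \<xi> \<omega> - I \<omega>)", unfolded power2_minus])
    moreover have "(LINT u|time_interval T. inner_cfg N d (?e u \<omega>) (?f u \<omega>))\<^sup>2
        \<le> T * ?C * (LINT u|time_interval T. inner_cfg N d (?e u \<omega>) (?e u \<omega>))"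
    proof -
      have "(LINT u|time_interval T. inner_cfg N d (?e u \<omega>) (?f u \<omega>))\<^sup>2
          \<le> T * (LINT u|time_interval T. (inner_cfg N d (?e u \<omega>) (?f u \<omega>))\<^sup>2)"
        using TI.integral_sq_le[OF ef_int ef_sq_int] T by (simp add: measure_time_interval)
      also have "(LINT u|time_interval T. (inner_cfg N d (?e u \<omega>) (?f u \<omega>))\<^sup>2)
          \<le> (LINT u|time_interval T. ?C * inner_cfg N d (?e u \<omega>) (?e u \<omega>))"
        using ef_sq ef_sq_int ee_int by (intro integral_mono) auto
      finally show ?thesis
        using T by (simp add: mult_left_mono)
    qed
    then have "ennreal ((LINT u|time_interval T. inner_cfg N d (?e u \<omega>) (?f u \<omega>))\<^sup>2)
        \<le> ennreal (T * ?C) * (\<integral>\<^sup>+u. ennreal (inner_cfg N d (?e u \<omega>) (?e u \<omega>)) \<partial>time_interval T)"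
      using ee_int T
      by (subst nn_integral_eq_integral) (auto simp: inner_cfg_nonneg ennreal_mult[symmetric] integral_nonneg_AE intro!: ennreal_leI)
    ultimately show ?thesis
      by (meson add_left_mono mult_left_mono order_trans zero_le)
  qed
  have ee_up: "(\<lambda>(\<omega>, u). ennreal (inner_cfg N d (?e u \<omega>) (?e u \<omega>))) \<in> borel_measurable ?PT"
    using up[OF ee_meas] by (simp add: case_prod_beta')
  have SI_meas: "(\<lambda>\<omega>. ennreal ((simple_integral N d X K \<tau> \<xi> \<omega> - I \<omega>)\<^sup>2)) \<in> borel_measurable P"
  proof -
    have "(\<lambda>\<omega>. simple_integral N d X K \<tau> \<xi> \<omega>) \<in> borel_measurable P"
      unfolding simple_integral_def inner_cfg_def using \<tau>_range
      by (intro borel_measurable_sum borel_measurable_times borel_measurable_diff \<xi>_events X_measurable) auto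
    then show ?thesis
      using I by measurable
  qed
  have inner_meas: "(\<lambda>\<omega>. \<integral>\<^sup>+u. ennreal (inner_cfg N d (?e u \<omega>) (?e u \<omega>)) \<partial>time_interval T) \<in> borel_measurable P"
    using TI.borel_measurable_nn_integral[OF ee_up] by simp
  have "(\<integral>\<^sup>+\<omega>. ennreal ((Z \<omega> - partial_sum K \<omega>)\<^sup>2) \<partial>P)
      \<le> (\<integral>\<^sup>+\<omega>. 2 * ennreal ((simple_integral N d X K \<tau> \<xi> \<omega> - I \<omega>)\<^sup>2)
      + 2 * (ennreal (T * ?C) * (\<integral>\<^sup>+u. ennreal (inner_cfg N d (?e u \<omega>) (?e u \<omega>)) \<partial>time_interval T)) \<partial>P)"
    by (intro nn_integral_mono key)
  also have "\<dots> = 2 * b + 2 * (ennreal (T * ?C) * (\<integral>\<^sup>+\<omega>. (\<integral>\<^sup>+u. ennreal (inner_cfg N d (?e u \<omega>) (?e u \<omega>)) \<partial>time_interval T) \<partial>P))"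
    using SI_meas inner_meas by (simp add: nn_integral_add nn_integral_cmult b_def)
  also have "(\<integral>\<^sup>+\<omega>. (\<integral>\<^sup>+u. ennreal (inner_cfg N d (?e u \<omega>) (?e u \<omega>)) \<partial>time_interval T) \<partial>P) = a"
    unfolding a_def norm_cfg_sq using Fubini'[OF ee_up] by simp
  finally show "(\<integral>\<^sup>+\<omega>. ennreal ((Z \<omega> - partial_sum K \<omega>)\<^sup>2) \<partial>P) \<le> 2 * b + 2 * (ennreal (T * ?C) * a)" .
  have HH_up: "(\<lambda>(\<omega>, u). ennreal (inner_cfg N d (?H u \<omega>) (?H u \<omega>))) \<in> borel_measurable ?PT"
    using up[OF HH_meas] by (simp add: case_prod_beta')
  have sec: "(\<lambda>\<omega>. F \<omega> u) \<in> borel_measurable P" if "(\<lambda>(\<omega>, u). F \<omega> u) \<in> borel_measurable ?PT" "u \<in> {0..T}"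
    for F :: "'a \<Rightarrow> real \<Rightarrow> ennreal" and u
    using measurable_Pair1[OF that(1), of u] that(2) by simp
  have meas1: "(\<lambda>u. \<integral>\<^sup>+\<omega>. F \<omega> u \<partial>P) \<in> borel_measurable (time_interval T)" if "(\<lambda>(\<omega>, u). F \<omega> u) \<in> borel_measurable ?PT"
    for F :: "'a \<Rightarrow> real \<Rightarrow> ennreal"
    using measurable_pair_swap[OF that]
    by (intro sigma_finite_measure.borel_measurable_nn_integral[OF prob_space_imp_sigma_finite[OF prob_space_axioms]]) simp
  have "ennreal (energy K) \<le> (\<integral>\<^sup>+u. (\<integral>\<^sup>+\<omega>. ennreal ((norm_cfg N d (?s u \<omega>))\<^sup>2) \<partial>P) \<partial>time_interval T)"
    by (rule energy_le)
  also have "\<dots> \<le> (\<integral>\<^sup>+u. 2 * (\<integral>\<^sup>+\<omega>. ennreal (inner_cfg N d (?e u \<omega>) (?e u \<omega>)) \<partial>P)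
      + 2 * (\<integral>\<^sup>+\<omega>. ennreal (inner_cfg N d (?H u \<omega>) (?H u \<omega>)) \<partial>P) \<partial>time_interval T)"
  proof (rule nn_integral_mono)
    fix u assume "u \<in> space (time_interval T)"
    then have u: "u \<in> {0..T}"
      by simp
    have "(\<integral>\<^sup>+\<omega>. ennreal ((norm_cfg N d (?s u \<omega>))\<^sup>2) \<partial>P)
        \<le> (\<integral>\<^sup>+\<omega>. 2 * ennreal (inner_cfg N d (?e u \<omega>) (?e u \<omega>)) + 2 * ennreal (inner_cfg N d (?H u \<omega>) (?H u \<omega>)) \<partial>P)"
    proof (rule nn_integral_mono)
      fix \<omega>
      have "inner_cfg N d (?s u \<omega>) (?s u \<omega>) \<le> 2 * inner_cfg N d (?e u \<omega>) (?e u \<omega>) + 2 * inner_cfg N d (?H u \<omega>) (?H u \<omega>)"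
        using inner_cfg_add_le[of N d "?e u \<omega>" "?H u \<omega>"] by simp
      then have "ennreal ((norm_cfg N d (?s u \<omega>))\<^sup>2)
          \<le> ennreal (2 * inner_cfg N d (?e u \<omega>) (?e u \<omega>) + 2 * inner_cfg N d (?H u \<omega>) (?H u \<omega>))"
        unfolding norm_cfg_sq by (rule ennreal_leI)
      then show "ennreal ((norm_cfg N d (?s u \<omega>))\<^sup>2)
          \<le> 2 * ennreal (inner_cfg N d (?e u \<omega>) (?e u \<omega>)) + 2 * ennreal (inner_cfg N d (?H u \<omega>) (?H u \<omega>))"
        by (simp add: inner_cfg_nonneg ennreal_mult)
    qed
    also have "\<dots> = 2 * (\<integral>\<^sup>+\<omega>. ennreal (inner_cfg N d (?e u \<omega>) (?e u \<omega>)) \<partial>P)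
        + 2 * (\<integral>\<^sup>+\<omega>. ennreal (inner_cfg N d (?H u \<omega>) (?H u \<omega>)) \<partial>P)"
      using sec[OF ee_up u] sec[OF HH_up u] by (simp add: nn_integral_add nn_integral_cmult)
    finally show "(\<integral>\<^sup>+\<omega>. ennreal ((norm_cfg N d (?s u \<omega>))\<^sup>2) \<partial>P)
        \<le> 2 * (\<integral>\<^sup>+\<omega>. ennreal (inner_cfg N d (?e u \<omega>) (?e u \<omega>)) \<partial>P) + 2 * (\<integral>\<^sup>+\<omega>. ennreal (inner_cfg N d (?H u \<omega>) (?H u \<omega>)) \<partial>P)" .
  qed
  also have "\<dots> = 2 * a + 2 * A"
    unfolding a_def A_def norm_cfg_sq using meas1[OF ee_up] meas1[OF HH_up]
    by (simp add: nn_integral_add nn_integral_cmult)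
  finally show "ennreal (energy K) \<le> 2 * a + 2 * A" .
qed

end

context observation
begin

text \<open>The factor 2 in front of the energy \<open>A\<close> of the integrand is lossy but harmless for the rate.\<close>

lemma ito_approximation:
  assumes h: "h \<in> kernels R" and ito: "has_ito_integral N d T P X (\<lambda>t \<omega>. drift N d h (X t \<omega>)) I"
  defines "Z \<equiv> \<lambda>\<omega>. I \<omega> - (LINT u|time_interval T. inner_cfg N d (drift N d h (X u \<omega>)) (drift N d \<phi> (X u \<omega>)))"
  defines "A \<equiv> \<integral>\<^sup>+u. (\<integral>\<^sup>+\<omega>. ennreal ((norm_cfg N d (drift N d h (X u \<omega>)))\<^sup>2) \<partial>P) \<partial>time_interval T"
  shows "\<exists>Y a. (\<forall>n::nat. Y n \<in> borel_measurable (hist T) \<and> integrable P (\<lambda>\<omega>. (Y n \<omega>)\<^sup>2) \<and> expectation (Y n) = 0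
      \<and> ennreal (expectation (\<lambda>\<omega>. (Y n \<omega>)\<^sup>2)) \<le> ennreal (\<sigma>\<^sup>2) * (2 * a n + 2 * A))
    \<and> a \<longlonglongrightarrow> 0 \<and> (\<lambda>n. \<integral>\<^sup>+\<omega>. ennreal ((Z \<omega> - Y n \<omega>)\<^sup>2) \<partial>P) \<longlonglongrightarrow> 0"
proof -
  let ?a = "\<lambda>K \<tau> \<xi>. \<integral>\<^sup>+u. (\<integral>\<^sup>+\<omega>. ennreal ((norm_cfg N d (\<lambda>i k. simple_process K \<tau> \<xi> u \<omega> i k - drift N d h (X u \<omega>) i k))\<^sup>2) \<partial>P) \<partial>time_interval T"
  let ?b = "\<lambda>K \<tau> \<xi>. \<integral>\<^sup>+\<omega>. ennreal ((simple_integral N d X K \<tau> \<xi> \<omega> - I \<omega>)\<^sup>2) \<partial>P"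
  obtain K \<tau> \<xi> where I: "I \<in> borel_measurable P" and simple: "\<And>n::nat. simple_data N d T P X (K n) (\<tau> n) (\<xi> n)"
    and a: "(\<lambda>n. ?a (K n) (\<tau> n) (\<xi> n)) \<longlonglongrightarrow> 0" and b: "(\<lambda>n. ?b (K n) (\<tau> n) (\<xi> n)) \<longlonglongrightarrow> 0"
    using ito unfolding has_ito_integral_def set_nn_integral_time_interval by blast
  have loc: "simple_integrand P N d \<sigma> T R S \<phi> \<mu>0 B X (K n) (\<tau> n) (\<xi> n)" for n
    by unfold_locales (rule simple)
  define Y where "Y n = simple_integrand.partial_sum N d \<phi> X (\<tau> n) (\<xi> n) (K n)" for n
  let ?C = "ennreal (T * (real N * (S * R)\<^sup>2))"
  have Y: "Y n \<in> borel_measurable (hist T)" "integrable P (\<lambda>\<omega>. (Y n \<omega>)\<^sup>2)" "expectation (Y n) = 0"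
    "ennreal (expectation (\<lambda>\<omega>. (Y n \<omega>)\<^sup>2)) \<le> ennreal (\<sigma>\<^sup>2) * (2 * ?a (K n) (\<tau> n) (\<xi> n) + 2 * A)"
    "(\<integral>\<^sup>+\<omega>. ennreal ((Z \<omega> - Y n \<omega>)\<^sup>2) \<partial>P) \<le> 2 * ?b (K n) (\<tau> n) (\<xi> n) + 2 * (?C * ?a (K n) (\<tau> n) (\<xi> n))" for n
  proof -
    interpret s: simple_integrand P N d \<sigma> T R S \<phi> \<mu>0 B X "K n" "\<tau> n" "\<xi> n"
      by (rule loc)
    have "\<tau> n (K n) = T"
      using simple[of n] by (simp add: simple_data_def)
    note m = s.partial_sum_moments[OF order_refl, unfolded this]
    show "Y n \<in> borel_measurable (hist T)" "integrable P (\<lambda>\<omega>. (Y n \<omega>)\<^sup>2)" "expectation (Y n) = 0"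
      unfolding Y_def using m by blast+
    have "ennreal (expectation (\<lambda>\<omega>. (Y n \<omega>)\<^sup>2)) = ennreal (\<sigma>\<^sup>2) * ennreal (s.energy (K n))"
      unfolding Y_def using m by (simp add: ennreal_mult')
    then show "ennreal (expectation (\<lambda>\<omega>. (Y n \<omega>)\<^sup>2)) \<le> ennreal (\<sigma>\<^sup>2) * (2 * ?a (K n) (\<tau> n) (\<xi> n) + 2 * A)"
      unfolding A_def using s.simple_error_bound(2)[OF h I] by (simp only: mult_left_mono zero_le)
    show "(\<integral>\<^sup>+\<omega>. ennreal ((Z \<omega> - Y n \<omega>)\<^sup>2) \<partial>P) \<le> 2 * ?b (K n) (\<tau> n) (\<xi> n) + 2 * (?C * ?a (K n) (\<tau> n) (\<xi> n))"
      unfolding Y_def Z_def by (rule s.simple_error_bound(1)[OF h I])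
  qed
  have lim: "(\<lambda>n. 2 * ?b (K n) (\<tau> n) (\<xi> n) + 2 * (?C * ?a (K n) (\<tau> n) (\<xi> n))) \<longlonglongrightarrow> 2 * 0 + 2 * (?C * 0)"
    using a b by (intro tendsto_add ennreal_tendsto_cmult) auto
  have "(\<lambda>n. \<integral>\<^sup>+\<omega>. ennreal ((Z \<omega> - Y n \<omega>)\<^sup>2) \<partial>P) \<longlonglongrightarrow> 0"
    by (rule tendsto_sandwich[OF _ _ tendsto_const lim[simplified]]) (auto intro: always_eventually Y(5))
  then show ?thesis
    using Y(1-4) a
    by (intro exI[of _ Y] exI[of _ "\<lambda>n. ?a (K n) (\<tau> n) (\<xi> n)"] conjI allI)
qed

end

section \<open>Semi-inner products on spaces of kernels\<close>

locale semi_inner =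
  fixes V :: "(real \<Rightarrow> real) set" and ip :: "(real \<Rightarrow> real) \<Rightarrow> (real \<Rightarrow> real) \<Rightarrow> real"
  assumes zero_mem: "(\<lambda>r. 0) \<in> V"
    and lincomb_mem: "\<And>f g a b. f \<in> V \<Longrightarrow> g \<in> V \<Longrightarrow> (\<lambda>r. a * f r + b * g r) \<in> V"
    and ip_lincomb: "\<And>f g h a b. f \<in> V \<Longrightarrow> g \<in> V \<Longrightarrow> h \<in> V \<Longrightarrow>
      ip (\<lambda>r. a * f r + b * g r) h = a * ip f h + b * ip g h"
    and ip_commute: "\<And>f g. f \<in> V \<Longrightarrow> g \<in> V \<Longrightarrow> ip f g = ip g f"
    and ip_nonneg: "\<And>f. f \<in> V \<Longrightarrow> 0 \<le> ip f f"
begin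

lemma ip_lincomb_right:
  "f \<in> V \<Longrightarrow> g \<in> V \<Longrightarrow> h \<in> V \<Longrightarrow> ip h (\<lambda>r. a * f r + b * g r) = a * ip h f + b * ip h g"
  by (simp add: ip_commute[of h] lincomb_mem ip_lincomb)

lemma ip_diff_left:
  assumes "f \<in> V" "g \<in> V" "h \<in> V"
  shows "ip (\<lambda>r. f r - g r) h = ip f h - ip g h"
  using ip_lincomb[OF assms, of 1 "-1"] by simp

lemma ip_square:
  assumes "f \<in> V" "g \<in> V"
  shows "ip (\<lambda>r. a * f r + b * g r) (\<lambda>r. a * f r + b * g r) = a\<^sup>2 * ip f f + 2 * a * b * ip f g + b\<^sup>2 * ip g g"
  using assms ip_commute[OF assms]
  by (simp add: ip_lincomb ip_lincomb_right lincomb_mem power2_eq_square algebra_simps)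

lemma sum_mem:
  assumes "finite A" "\<And>k. k \<in> A \<Longrightarrow> e k \<in> V"
  shows "(\<lambda>r. \<Sum>k\<in>A. c k * e k r) \<in> V"
  using assms
proof (induction A)
  case (insert x A)
  then show ?case
    using lincomb_mem[of "e x" "\<lambda>r. \<Sum>k\<in>A. c k * e k r" "c x" 1] by simp
qed (simp add: zero_mem)

lemma ip_sum_left:
  assumes "finite A" "\<And>k. k \<in> A \<Longrightarrow> e k \<in> V" "h \<in> V"
  shows "ip (\<lambda>r. \<Sum>k\<in>A. c k * e k r) h = (\<Sum>k\<in>A. c k * ip (e k) h)"
  using assms
proof (induction A)
  case empty
  then show ?case
    using ip_lincomb[of h h h 0 0] by simp
next
  case (insert x A)
  then show ?case
    using ip_lincomb[of "e x" "\<lambda>r. \<Sum>k\<in>A. c k * e k r" h "c x" 1] sum_mem[of A e c] by simp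
qed

lemma ip_sum_right:
  assumes "finite A" "\<And>k. k \<in> A \<Longrightarrow> e k \<in> V" "h \<in> V"
  shows "ip h (\<lambda>r. \<Sum>k\<in>A. c k * e k r) = (\<Sum>k\<in>A. c k * ip h (e k))"
proof -
  have "ip h (\<lambda>r. \<Sum>k\<in>A. c k * e k r) = ip (\<lambda>r. \<Sum>k\<in>A. c k * e k r) h"
    using assms by (intro ip_commute sum_mem) auto
  also have "\<dots> = (\<Sum>k\<in>A. c k * ip (e k) h)"
    using assms by (intro ip_sum_left) auto
  also have "\<dots> = (\<Sum>k\<in>A. c k * ip h (e k))"
    using assms by (intro sum.cong refl) (simp add: ip_commute)
  finally show ?thesis .
qed

lemma Cauchy_Schwarz:
  assumes "f \<in> V" "g \<in> V"
  shows "(ip f g)\<^sup>2 \<le> ip f f * ip g g"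
proof (cases "ip g g = 0")
  case True
  have "ip f g = 0"
  proof (rule ccontr)
    assume ne: "ip f g \<noteq> 0"
    \<comment> \<open>If \<open>ip g g = 0\<close>, the square of \<open>f + t g\<close> is affine
      in \<open>t\<close>; this \<open>t\<close> would give it the value -1.\<close>
    let ?t = "- (ip f f + 1) / (2 * ip f g)"
    have "0 \<le> ip (\<lambda>r. 1 * f r + ?t * g r) (\<lambda>r. 1 * f r + ?t * g r)"
      by (rule ip_nonneg[OF lincomb_mem[OF assms]])
    then have "0 \<le> ip f f + 2 * ?t * ip f g"
      unfolding ip_square[OF assms] using True by simp
    moreover have "2 * ?t * ip f g = - (ip f f + 1)"
      using ne by (simp add: field_simps)
    ultimately show False
      by linarith
  qed
  then show ?thesis
    using True by simp
next
  case False
  then have pos: "ip g g > 0"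
    using ip_nonneg[OF assms(2)] by simp
  let ?t = "- (ip f g / ip g g)"
  have "0 \<le> ip (\<lambda>r. 1 * f r + ?t * g r) (\<lambda>r. 1 * f r + ?t * g r)"
    by (rule ip_nonneg[OF lincomb_mem[OF assms]])
  also have "\<dots> = ip f f - (ip f g)\<^sup>2 / ip g g"
    unfolding ip_square[OF assms] using pos by (simp add: power2_eq_square field_simps)
  finally show ?thesis
    using pos by (simp add: field_simps)
qed

lemma ip_zero: "f \<in> V \<Longrightarrow> g \<in> V \<Longrightarrow> ip g g = 0 \<Longrightarrow> ip f g = 0"
  using Cauchy_Schwarz[of f g] by simp

lemma ip_add_le:
  assumes "f \<in> V" "g \<in> V"
  shows "ip (\<lambda>r. f r + g r) (\<lambda>r. f r + g r) \<le> 2 * ip f f + 2 * ip g g"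
proof -
  have "0 \<le> ip (\<lambda>r. 1 * f r + (-1) * g r) (\<lambda>r. 1 * f r + (-1) * g r)"
    by (rule ip_nonneg[OF lincomb_mem[OF assms]])
  then show ?thesis
    using ip_square[OF assms, of 1 "-1"] ip_square[OF assms, of 1 1] by simp
qed

lemma ip_diff_le:
  assumes "f \<in> V" "g \<in> V"
  shows "ip (\<lambda>r. f r - g r) (\<lambda>r. f r - g r) \<le> 2 * ip f f + 2 * ip g g"
proof -
  have "0 \<le> ip (\<lambda>r. 1 * f r + 1 * g r) (\<lambda>r. 1 * f r + 1 * g r)"
    by (rule ip_nonneg[OF lincomb_mem[OF assms]])
  then show ?thesis
    using ip_square[OF assms, of 1 "-1"] ip_square[OF assms, of 1 1] by simp
qed

text \<open>The largest eigenvalue of a Gram matrix is at most its trace; obtained from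
  Cauchy-Schwarz for each entry and once more for the sum.\<close>

lemma ip_sum_le:
  assumes "finite A" "\<And>k. k \<in> A \<Longrightarrow> e k \<in> V"
  shows "ip (\<lambda>r. \<Sum>k\<in>A. c k * e k r) (\<lambda>r. \<Sum>k\<in>A. c k * e k r) \<le> (\<Sum>k\<in>A. (c k)\<^sup>2) * (\<Sum>k\<in>A. ip (e k) (e k))"
proof -
  let ?s = "\<lambda>k. sqrt (ip (e k) (e k))"
  have "ip (\<lambda>r. \<Sum>k\<in>A. c k * e k r) (\<lambda>r. \<Sum>k\<in>A. c k * e k r) = (\<Sum>j\<in>A. \<Sum>k\<in>A. c j * c k * ip (e j) (e k))"
    using assms by (simp add: ip_sum_left sum_mem ip_sum_right sum_distrib_left mult.assoc)
  also have "\<dots> \<le> (\<Sum>j\<in>A. \<Sum>k\<in>A. (\<bar>c j\<bar> * ?s j) * (\<bar>c k\<bar> * ?s k))"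
  proof (intro sum_mono)
    fix j k assume "j \<in> A" "k \<in> A"
    then have "\<bar>ip (e j) (e k)\<bar> \<le> sqrt (ip (e j) (e j) * ip (e k) (e k))"
      using assms by (intro real_le_rsqrt) (simp add: Cauchy_Schwarz)
    then have "\<bar>c j * c k\<bar> * \<bar>ip (e j) (e k)\<bar> \<le> \<bar>c j * c k\<bar> * (?s j * ?s k)"
      by (intro mult_left_mono) (auto simp: real_sqrt_mult)
    then show "c j * c k * ip (e j) (e k) \<le> (\<bar>c j\<bar> * ?s j) * (\<bar>c k\<bar> * ?s k)"
      using abs_ge_self[of "c j * c k * ip (e j) (e k)"] by (simp add: abs_mult mult_ac)
  qed
  also have "\<dots> = (\<Sum>j\<in>A. \<bar>c j\<bar> * ?s j)\<^sup>2"
    by (simp add: power2_eq_square sum_product)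
  also have "\<dots> \<le> (\<Sum>k\<in>A. \<bar>c k\<bar>\<^sup>2) * (\<Sum>k\<in>A. (?s k)\<^sup>2)"
    by (rule Cauchy_Schwarz_ineq_sum)
  also have "\<dots> = (\<Sum>k\<in>A. (c k)\<^sup>2) * (\<Sum>k\<in>A. ip (e k) (e k))"
    using assms by (simp add: ip_nonneg)
  finally show ?thesis .
qed

text \<open>Vectors of length 0 are permitted, and no linear independence is asked, so the
  representing coefficients need not be unique. All that is used is that they are determined at the
  vectors of length 1.\<close>

definition orthobasis :: "(real \<Rightarrow> real) set \<Rightarrow> nat \<Rightarrow> (nat \<Rightarrow> real \<Rightarrow> real) \<Rightarrow> bool" where
  "orthobasis W D e \<longleftrightarrow> (\<forall>k<D. e k \<in> V \<and> ip (e k) (e k) \<in> {0, 1}) \<and>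
     (\<forall>j<D. \<forall>k<D. j \<noteq> k \<longrightarrow> ip (e j) (e k) = 0) \<and>
     (\<forall>k<D. e k \<in> W) \<and>
     (\<forall>h\<in>W. \<exists>c. h = (\<lambda>r. \<Sum>k<D. c k * e k r))"

text \<open>Subtracting the projection makes the remainder orthogonal to all earlier vectors, also
  to those of length 0, because any vector is orthogonal to these by Cauchy-Schwarz.\<close>

lemma Gram_Schmidt:
  assumes "finite B" "funs.span B \<subseteq> V"
  shows "\<exists>e. orthobasis (funs.span B) (card B) e"
  using assms
proof (induction B)
  case empty
  then show ?case
    by (auto simp: orthobasis_def funs.span_empty fun_eq_iff)
next
  case (insert b B)
  have sub: "funs.span B \<subseteq> funs.span (insert b B)"
    by (intro funs.span_mono) auto
  have lin: "(\<lambda>r. x * f r + y * g r) \<in> funs.span A" if "f \<in> funs.span A" "g \<in> funs.span A" for x y f g A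
    using funs.span_add[OF funs.span_scale[OF that(1), of x] funs.span_scale[OF that(2), of y]]
    by (simp add: plus_fun_def)
  let ?D = "card B"
  obtain e where e: "orthobasis (funs.span B) ?D e"
    using insert sub by blast
  have eV: "\<And>k. k < ?D \<Longrightarrow> e k \<in> V" and e01: "\<And>k. k < ?D \<Longrightarrow> ip (e k) (e k) \<in> {0, 1}"
    and orth: "\<And>j k. j < ?D \<Longrightarrow> k < ?D \<Longrightarrow> j \<noteq> k \<Longrightarrow> ip (e j) (e k) = 0"
    and espan: "\<And>k. k < ?D \<Longrightarrow> e k \<in> funs.span B"
    and repr: "\<And>h. h \<in> funs.span B \<Longrightarrow> \<exists>c. h = (\<lambda>r. \<Sum>k<?D. c k * e k r)"
    using e by (auto simp: orthobasis_def)
  have b: "b \<in> funs.span (insert b B)" "b \<in> V"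
    using insert.prems by (auto intro: funs.span_base)
  define p where "p r = (\<Sum>k<?D. ip b (e k) * e k r)" for r
  have "(\<lambda>r. \<Sum>k<m. ip b (e k) * e k r) \<in> funs.span B" if "m \<le> ?D" for m
    using that
  proof (induction m)
    case 0
    then show ?case
      using funs.span_zero[of B] by (simp add: zero_fun_def)
  next
    case (Suc m)
    then show ?case
      using lin[of "\<lambda>r. \<Sum>k<m. ip b (e k) * e k r" B "e m" 1 "ip b (e m)"] espan[of m] by simp
  qed
  then have p: "p \<in> funs.span B"
    by (simp add: p_def[abs_def])
  define b' where "b' r = b r - p r" for r
  have b': "b' \<in> funs.span (insert b B)" "b' \<in> V"
    using lin[OF b(1) subsetD[OF sub p], of 1 "-1"] insert.prems by (auto simp: b'_def[abs_def])
  have b'_orth: "ip b' (e j) = 0" if "j < ?D" for j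
  proof -
    have "ip p (e j) = (\<Sum>k<?D. ip b (e k) * ip (e k) (e j))"
      unfolding p_def[abs_def] using eV that by (intro ip_sum_left) auto
    also have "\<dots> = (\<Sum>k<?D. if k = j then ip b (e j) * ip (e j) (e j) else 0)"
      using orth that by (intro sum.cong) auto
    also have "\<dots> = ip b (e j)"
      using that e01[OF that] ip_zero[OF b(2) eV[OF that]] by auto
    finally have "ip p (e j) = ip b (e j)" .
    moreover have "p \<in> V"
      using p sub insert.prems by blast
    ultimately show ?thesis
      using ip_lincomb[OF b(2) _ eV[OF that], of p 1 "-1"] by (simp add: b'_def[abs_def])
  qed
  \<comment> \<open>A remainder of length 0 cannot be normalised; it is kept as it is, since it may
    still be needed to span.\<close>
  define s where "s = (if ip b' b' = 0 then 1 else 1 / sqrt (ip b' b'))"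
  have s: "s \<noteq> 0"
    using ip_nonneg[OF b'(2)] by (auto simp: s_def)
  define e' where "e' k = (if k < ?D then e k else (\<lambda>r. s * b' r))" for k
  have sb': "(\<lambda>r. s * b' r) \<in> V" "(\<lambda>r. s * b' r) \<in> funs.span (insert b B)"
    using lincomb_mem[OF b'(2) b'(2), of s 0] lin[OF b'(1) b'(1), of s 0] by simp_all
  have ip_sb': "ip (\<lambda>r. s * b' r) h = s * ip b' h" if "h \<in> V" for h
    using ip_lincomb[OF b'(2) b'(2) that, of s 0] by simp
  have sq: "ip (\<lambda>r. s * b' r) (\<lambda>r. s * b' r) \<in> {0, 1}"
  proof -
    have "ip (\<lambda>r. s * b' r) (\<lambda>r. s * b' r) = s * (s * ip b' b')"
      using ip_sb'[OF sb'(1)] ip_commute[OF b'(2) sb'(1)] ip_sb'[OF b'(2)] by simp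
    then show ?thesis
      using ip_nonneg[OF b'(2)] by (auto simp: s_def)
  qed
  have sb'_orth: "ip (\<lambda>r. s * b' r) (e k) = 0" "ip (e k) (\<lambda>r. s * b' r) = 0" if "k < ?D" for k
    using ip_sb'[OF eV[OF that]] b'_orth[OF that] ip_commute[OF sb'(1) eV[OF that]] by auto
  have "orthobasis (funs.span (insert b B)) (Suc ?D) e'"
    unfolding orthobasis_def
  proof (intro conjI allI impI ballI)
    fix k assume "k < Suc ?D"
    show "e' k \<in> V" "ip (e' k) (e' k) \<in> {0, 1}" "e' k \<in> funs.span (insert b B)"
      using eV e01 espan sub sb' sq by (auto simp: e'_def)
  next
    fix j k assume "j < Suc ?D" "k < Suc ?D" "j \<noteq> k"
    then show "ip (e' j) (e' k) = 0"
      using orth sb'_orth by (auto simp: e'_def less_Suc_eq)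
  next
    fix h assume "h \<in> funs.span (insert b B)"
    then obtain t where "h - (\<lambda>r. t * b r) \<in> funs.span B"
      by (auto simp: funs.span_insert)
    then obtain c where c: "h - (\<lambda>r. t * b r) = (\<lambda>r. \<Sum>k<?D. c k * e k r)"
      using repr by blast
    define c' where "c' k = (if k < ?D then c k + t * ip b (e k) else t / s)" for k
    have "h r = (\<Sum>k<Suc ?D. c' k * e' k r)" for r
    proof -
      have "h r = (\<Sum>k<?D. c k * e k r) + t * (p r + b' r)"
        using fun_cong[OF c, of r] by (simp add: b'_def)
      also have "\<dots> = (\<Sum>k<?D. (c k + t * ip b (e k)) * e k r) + t * b' r"
        by (simp add: p_def distrib_left distrib_right sum.distrib sum_distrib_left mult.assoc)
      finally show ?thesis
        using s by (simp add: c'_def e'_def)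
    qed
    then show "\<exists>c. h = (\<lambda>r. \<Sum>k<Suc ?D. c k * e' k r)"
      by blast
  qed
  then show ?case
    using insert.hyps by auto
qed

text \<open>At a vector of length 1 this recovers the coefficient; at a vector of length 0 both
  sides are 0 and the coefficient remains undetermined.\<close>

lemma orthobasis_coeff:
  assumes e: "orthobasis W D e" and h: "h = (\<lambda>r. \<Sum>k<D. c k * e k r)" and j: "j < D"
  shows "ip h (e j) = c j * ip (e j) (e j)"
proof -
  have eV: "\<And>k. k < D \<Longrightarrow> e k \<in> V" and orth: "\<And>j k. j < D \<Longrightarrow> k < D \<Longrightarrow> j \<noteq> k \<Longrightarrow> ip (e j) (e k) = 0"
    using e by (auto simp: orthobasis_def)
  have "ip h (e j) = (\<Sum>k<D. c k * ip (e k) (e j))"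
    unfolding h using eV j by (intro ip_sum_left) auto
  also have "\<dots> = (\<Sum>k<D. if k = j then c j * ip (e j) (e j) else 0)"
    using orth j by (intro sum.cong) auto
  finally show ?thesis
    using j by simp
qed

lemma orthobasis_Parseval:
  assumes e: "orthobasis W D e" and h: "h \<in> W"
  shows "ip h h = (\<Sum>k<D. (ip h (e k))\<^sup>2)"
proof -
  obtain c where c: "h = (\<lambda>r. \<Sum>k<D. c k * e k r)"
    using e h by (auto simp: orthobasis_def)
  have eV: "\<And>k. k < D \<Longrightarrow> e k \<in> V" and e01: "\<And>k. k < D \<Longrightarrow> ip (e k) (e k) \<in> {0, 1}"
    using e by (auto simp: orthobasis_def)
  have "h \<in> V"
    unfolding c using eV by (intro sum_mem) auto
  then have "ip h (\<lambda>r. \<Sum>k<D. c k * e k r) = (\<Sum>k<D. c k * ip h (e k))"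
    using eV by (intro ip_sum_right) auto
  also have "\<dots> = (\<Sum>k<D. (ip h (e k))\<^sup>2)"
    using orthobasis_coeff[OF e c] e01 by (intro sum.cong) (auto simp: power2_eq_square)
  finally show ?thesis
    using c by simp
qed

text \<open>A second semi-inner product that degenerates wherever \<open>ip\<close> does only sees the components along the
  basis vectors of positive length.\<close>

lemma orthobasis_dominated:
  assumes e: "orthobasis W D e" and h: "h \<in> W" and q: "semi_inner V q"
    and null: "\<And>k. k < D \<Longrightarrow> ip (e k) (e k) = 0 \<Longrightarrow> q (e k) (e k) = 0"
  shows "q h h \<le> ip h h * (\<Sum>k<D. q (e k) (e k))"
proof -
  interpret q: semi_inner V q
    by (rule q)
  obtain c where c: "h = (\<lambda>r. \<Sum>k<D. c k * e k r)"
    using e h by (auto simp: orthobasis_def)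
  have eV: "\<And>k. k < D \<Longrightarrow> e k \<in> V" and e01: "\<And>k. k < D \<Longrightarrow> ip (e k) (e k) \<in> {0, 1}"
    using e by (auto simp: orthobasis_def)
  \<comment> \<open>\<open>g\<close> is \<open>h\<close> with its components along vectors of length
    0 removed: there the coefficients \<open>ip h (e k)\<close> are 0. The form \<open>q\<close>
    does not see the difference, and the squared coefficients of \<open>g\<close> add up to
    \<open>ip h h\<close>.\<close>
  define g where "g = (\<lambda>r. \<Sum>k<D. ip h (e k) * e k r)"
  have hV: "h \<in> V" and gV: "g \<in> V"
    unfolding c g_def using eV by (auto intro!: sum_mem)
  have same: "q h f = q g f" if "f \<in> V" for f
  proof -
    have "q h f = (\<Sum>k<D. c k * q (e k) f)"
      unfolding c using eV that by (intro q.ip_sum_left) auto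
    also have "\<dots> = (\<Sum>k<D. ip h (e k) * q (e k) f)"
    proof (rule sum.cong[OF refl])
      fix k assume k: "k \<in> {..<D}"
      show "c k * q (e k) f = ip h (e k) * q (e k) f"
      proof (cases "ip (e k) (e k) = 0")
        case True
        then have "q f (e k) = 0"
          using q.ip_zero[OF that eV null] k by simp
        then show ?thesis
          using q.ip_commute[OF that, of "e k"] eV k by simp
      next
        case False
        then show ?thesis
          using e01[of k] orthobasis_coeff[OF e c, of k] k by auto
      qed
    qed
    also have "\<dots> = q g f"
      unfolding g_def using eV that by (intro q.ip_sum_left[symmetric]) auto
    finally show ?thesis .
  qed
  have "q h h = q g g"
    using same[OF hV] same[OF gV] q.ip_commute[OF hV gV] by simp
  also have "\<dots> \<le> (\<Sum>k<D. (ip h (e k))\<^sup>2) * (\<Sum>k<D. q (e k) (e k))"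
    unfolding g_def using eV by (intro q.ip_sum_le) auto
  finally show ?thesis
    by (simp add: orthobasis_Parseval[OF e h])
qed

end

section \<open>A one-sided deviation inequality\<close>

text \<open>The lost factor 1/2 in front of \<open>y\<close> is the reason why half the mean, and
  not the mean itself, is compared with the empirical average later on.\<close>

lemma exp_minus_le:
  fixes y :: real
  assumes "0 \<le> y" "y \<le> 1"
  shows "exp (- y) \<le> 1 - y / 2"
proof -
  have "(1 - y / 2) * exp y \<ge> (1 - y / 2) * (1 + y)"
    using assms exp_ge_add_one_self[of y] by (intro mult_left_mono) auto
  moreover have "(1 - y / 2) * (1 + y) = 1 + y * (1 - y) / 2"
    by (simp add: field_simps)
  moreover have "y * (1 - y) / 2 \<ge> 0"
    using assms by simp
  ultimately have "1 \<le> (1 - y / 2) * exp y"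
    by linarith
  then show ?thesis
    by (simp add: exp_minus field_simps)
qed

text \<open>For y in [0,1] the Laplace transform of -y is at most 1 - E y / 2, hence at most exp (-
  E y / 2); independence multiplies these bounds. Only deviations below half the mean of a
  nonnegative variable are covered. In exchange no variance appears and the exponent is linear in
  the deviation, which yields the order 1/M.\<close>

lemma (in prob_space) exp_half_mean_minus_sum_le:
  fixes Y :: "'i \<Rightarrow> 'a \<Rightarrow> real"
  assumes ind: "indep_vars (\<lambda>_. borel) Y I" and I: "finite I" and b: "b > 0"
    and Y: "\<And>i \<omega>. i \<in> I \<Longrightarrow> \<omega> \<in> space M \<Longrightarrow> 0 \<le> Y i \<omega> \<and> Y i \<omega> \<le> b"
    and \<mu>: "\<And>i. i \<in> I \<Longrightarrow> expectation (Y i) = \<mu>"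
  shows "integrable M (\<lambda>\<omega>. exp (\<Sum>i\<in>I. (\<mu> / 2 - Y i \<omega>) / b))"
    and "expectation (\<lambda>\<omega>. exp (\<Sum>i\<in>I. (\<mu> / 2 - Y i \<omega>) / b)) \<le> 1"
proof -
  let ?F = "\<lambda>i \<omega>. exp ((\<mu> / 2 - Y i \<omega>) / b)"
  have rv: "random_variable borel (Y i)" if "i \<in> I" for i
    using ind that by (auto simp: indep_vars_def)
  have F_bound: "\<bar>?F i \<omega>\<bar> \<le> exp (\<mu> / 2 / b)" if "i \<in> I" "\<omega> \<in> space M" for i \<omega>
    using Y[OF that] b divide_right_mono[of "\<mu> / 2 - Y i \<omega>" "\<mu> / 2" b] by simp
  have F_int: "integrable M (?F i)" if "i \<in> I" for i
    using rv[OF that] F_bound[OF that] by (intro integrable_const_bound[of _ "exp (\<mu> / 2 / b)"]) auto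
  have indF: "indep_vars (\<lambda>_. borel) ?F I"
    by (rule indep_vars_compose2[OF ind]) measurable
  have eq: "exp (\<Sum>i\<in>I. (\<mu> / 2 - Y i \<omega>) / b) = (\<Prod>i\<in>I. ?F i \<omega>)" for \<omega>
    using I by (simp add: exp_sum)
  show "integrable M (\<lambda>\<omega>. exp (\<Sum>i\<in>I. (\<mu> / 2 - Y i \<omega>) / b))"
    unfolding eq by (rule indep_vars_integrable[OF I indF F_int])
  have le: "expectation (?F i) \<le> 1" if i: "i \<in> I" for i
  proof -
    have Y_int: "integrable M (Y i)"
      using rv[OF i] Y[OF i] by (intro integrable_const_bound[of _ b]) auto
    have "expectation (?F i) \<le> expectation (\<lambda>\<omega>. exp (\<mu> / 2 / b) * (1 - Y i \<omega> / b / 2))"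
    proof (rule integral_mono)
      fix \<omega> assume "\<omega> \<in> space M"
      then have "exp (- (Y i \<omega> / b)) \<le> 1 - Y i \<omega> / b / 2"
        using Y[OF i] b by (intro exp_minus_le) auto
      then have "exp (\<mu> / 2 / b) * exp (- (Y i \<omega> / b)) \<le> exp (\<mu> / 2 / b) * (1 - Y i \<omega> / b / 2)"
        by (rule mult_left_mono) simp
      then show "?F i \<omega> \<le> exp (\<mu> / 2 / b) * (1 - Y i \<omega> / b / 2)"
        by (simp add: exp_add[symmetric] diff_divide_distrib)
    qed (use F_int[OF i] Y_int in auto)
    also have "\<dots> = exp (\<mu> / 2 / b) * (1 - \<mu> / 2 / b)"
      using Y_int \<mu>[OF i] by (simp add: prob_space)
    also have "\<dots> \<le> exp (\<mu> / 2 / b) * exp (- (\<mu> / 2 / b))"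
      using exp_ge_add_one_self[of "- (\<mu> / 2 / b)"] by (intro mult_left_mono) auto
    also have "\<dots> = 1"
      by (simp add: exp_add[symmetric])
    finally show ?thesis .
  qed
  have "expectation (\<lambda>\<omega>. exp (\<Sum>i\<in>I. (\<mu> / 2 - Y i \<omega>) / b)) = (\<Prod>i\<in>I. expectation (?F i))"
    unfolding eq by (rule indep_vars_lebesgue_integral[OF I indF F_int])
  also have "\<dots> \<le> (\<Prod>i\<in>I. 1)"
    using le by (intro prod_mono) (auto intro: integral_nonneg_AE)
  finally show "expectation (\<lambda>\<omega>. exp (\<Sum>i\<in>I. (\<mu> / 2 - Y i \<omega>) / b)) \<le> 1"
    by simp
qed

section \<open>Energy forms of an observation\<close>

lemma semi_inner_scale:
  assumes "semi_inner V ip" "c \<ge> 0"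
  shows "semi_inner V (\<lambda>f g. c * ip f g)"
proof -
  interpret semi_inner V ip
    by (rule assms)
  show ?thesis
    using assms(2)
    by unfold_locales (simp_all add: zero_mem lincomb_mem ip_lincomb ip_nonneg ip_commute distrib_left mult.left_commute)
qed

lemma semi_inner_sum:
  assumes "I \<noteq> {}" "\<And>i. i \<in> I \<Longrightarrow> semi_inner V (ip i)"
  shows "semi_inner V (\<lambda>f g. \<Sum>i\<in>I. ip i f g)"
proof -
  obtain i where "i \<in> I"
    using assms(1) by blast
  then interpret i: semi_inner V "ip i"
    by (rule assms(2))
  show ?thesis
  proof
    fix f g h a b assume *: "f \<in> V" "g \<in> V" "h \<in> V"
    have "(\<Sum>i\<in>I. ip i (\<lambda>r. a * f r + b * g r) h) = (\<Sum>i\<in>I. a * ip i f h + b * ip i g h)"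
      by (intro sum.cong refl semi_inner.ip_lincomb[OF assms(2) *])
    then show "(\<Sum>i\<in>I. ip i (\<lambda>r. a * f r + b * g r) h) = a * (\<Sum>i\<in>I. ip i f h) + b * (\<Sum>i\<in>I. ip i g h)"
      by (simp add: sum.distrib sum_distrib_left)
  next
    fix f g assume *: "f \<in> V" "g \<in> V"
    show "(\<Sum>i\<in>I. ip i f g) = (\<Sum>i\<in>I. ip i g f)"
      by (intro sum.cong refl semi_inner.ip_commute[OF assms(2) *])
  next
    fix f assume *: "f \<in> V"
    show "0 \<le> (\<Sum>i\<in>I. ip i f f)"
      by (intro sum_nonneg semi_inner.ip_nonneg[OF assms(2) *])
  qed (simp_all add: i.zero_mem i.lincomb_mem)
qed

lemma kernels_zero: "(\<lambda>r. 0) \<in> kernels R"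
  by (auto simp: kernels_def)

context observation
begin

text \<open>The energy form of a single trajectory. Its expectation is, up to a factor, the form on
  the right of the coercivity condition.\<close>

definition qf :: "(real \<Rightarrow> real) \<Rightarrow> (real \<Rightarrow> real) \<Rightarrow> 'w \<Rightarrow> real" where
  "qf h g \<omega> = (LINT u|time_interval T. inner_cfg N d (drift N d h (X u \<omega>)) (drift N d g (X u \<omega>)))"

lemma X_jointly_measurable:
  assumes "i < N" "k < d"
  shows "(\<lambda>(u, \<omega>). X u \<omega> i k) \<in> borel_measurable (time_interval T \<Otimes>\<^sub>M P)"
proof -
  have "(\<lambda>(\<omega>, u). X u \<omega> i k) \<in> borel_measurable (P \<Otimes>\<^sub>M time_interval T)"
    using assms by (intro continuous_process_jointly_measurable X_measurable X_continuous)
  from measurable_pair_swap[OF this] show ?thesis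
    by simp
qed

lemma inner_drift_jointly_measurable:
  assumes "h \<in> kernels R" "g \<in> kernels R"
  shows "(\<lambda>(u, \<omega>). inner_cfg N d (drift N d h (X u \<omega>)) (drift N d g (X u \<omega>))) \<in> borel_measurable (time_interval T \<Otimes>\<^sub>M P)"
proof -
  have "(\<lambda>z. inner_cfg N d (drift N d h (X (fst z) (snd z))) (drift N d g (X (fst z) (snd z))))
      \<in> borel_measurable (time_interval T \<Otimes>\<^sub>M P)"
    using X_jointly_measurable assms
    by (intro inner_cfg_measurable drift_measurable kernels_measurable) (auto simp: case_prod_beta')
  then show ?thesis
    by (simp add: case_prod_beta')
qed

lemma qf_integrable:
  assumes "h \<in> kernels R" "g \<in> kernels R" "\<omega> \<in> space P"
  shows "integrable (time_interval T) (\<lambda>u. inner_cfg N d (drift N d h (X u \<omega>)) (drift N d g (X u \<omega>)))"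
proof -
  interpret TI: finite_measure "time_interval T"
    by (rule finite_measure_time_interval)
  obtain c where "\<And>x. \<bar>inner_cfg N d (drift N d h x) (drift N d g x)\<bar> \<le> c"
    using inner_drift_bound[OF N R assms(1,2)] by blast
  moreover have "(\<lambda>u. inner_cfg N d (drift N d h (X u \<omega>)) (drift N d g (X u \<omega>))) \<in> borel_measurable (time_interval T)"
    using measurable_Pair1[OF inner_drift_jointly_measurable[OF assms(1,2)] assms(3)] by simp
  ultimately show ?thesis
    by (intro TI.integrable_const_bound[of _ c]) auto
qed

lemma qf_measurable:
  assumes "h \<in> kernels R" "g \<in> kernels R"
  shows "qf h g \<in> borel_measurable (hist T)"
  unfolding qf_def[abs_def] using assms by (intro borel_measurable_time_integral kernel_drift_measurable) auto

lemma semi_inner_qf: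
  assumes "\<omega> \<in> space P"
  shows "semi_inner (kernels R) (\<lambda>h g. qf h g \<omega>)"
proof
  fix f g h a b assume "f \<in> kernels R" "g \<in> kernels R" "h \<in> kernels R"
  then show "qf (\<lambda>r. a * f r + b * g r) h \<omega> = a * qf f h \<omega> + b * qf g h \<omega>"
    using qf_integrable assms by (simp add: qf_def drift_lincomb inner_cfg_lincomb)
next
  fix f show "0 \<le> qf f f \<omega>"
    unfolding qf_def by (intro integral_nonneg_AE) (simp add: inner_cfg_nonneg)
qed (simp_all add: kernels_zero kernels_lincomb qf_def inner_cfg_commute)

lemma qf_bound:
  assumes "h \<in> kernels R" "\<And>r. \<bar>h r\<bar> \<le> c" "\<omega> \<in> space P"
  shows "qf h h \<omega> \<le> T * (real N * (c * R)\<^sup>2)"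
proof -
  interpret TI: finite_measure "time_interval T"
    by (rule finite_measure_time_interval)
  have "qf h h \<omega> \<le> (LINT u|time_interval T. real N * (c * R)\<^sup>2)"
    unfolding qf_def using drift_sq_bound[OF N assms(1,2) R]
    by (intro integral_mono qf_integrable assms) auto
  then show ?thesis
    using T by (simp add: measure_time_interval)
qed

lemma qf_abs_bound:
  assumes "h \<in> kernels R" "g \<in> kernels R"
  obtains c where "\<And>\<omega>. \<omega> \<in> space P \<Longrightarrow> \<bar>qf h g \<omega>\<bar> \<le> c"
proof -
  interpret TI: finite_measure "time_interval T"
    by (rule finite_measure_time_interval)
  obtain c where c: "\<And>x. \<bar>inner_cfg N d (drift N d h x) (drift N d g x)\<bar> \<le> c"
    using inner_drift_bound[OF N R assms(1,2)] by blast
  have "\<bar>qf h g \<omega>\<bar> \<le> T * c" if "\<omega> \<in> space P" for \<omega>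
  proof -
    have "\<bar>qf h g \<omega>\<bar> \<le> (LINT u|time_interval T. \<bar>inner_cfg N d (drift N d h (X u \<omega>)) (drift N d g (X u \<omega>))\<bar>)"
      unfolding qf_def by (rule integral_abs_bound)
    also have "\<dots> \<le> (LINT u|time_interval T. c)"
      using qf_integrable[OF assms that] c by (intro integral_mono) auto
    finally show ?thesis
      using T by (simp add: measure_time_interval)
  qed
  then show thesis
    by (rule that)
qed

lemma qf_integrable_P:
  assumes "h \<in> kernels R" "g \<in> kernels R"
  shows "integrable P (qf h g)"
proof -
  obtain c where "\<And>\<omega>. \<omega> \<in> space P \<Longrightarrow> \<bar>qf h g \<omega>\<bar> \<le> c"
    using qf_abs_bound[OF assms] by blast
  then show ?thesis
    using history_measurable_events[OF qf_measurable[OF assms]]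
    by (intro integrable_const_bound[of _ c]) auto
qed

lemma qf_expectation:
  assumes "h \<in> kernels R" "g \<in> kernels R"
  shows "expectation (qf h g)
    = (LINT u|time_interval T. expectation (\<lambda>\<omega>. inner_cfg N d (drift N d h (X u \<omega>)) (drift N d g (X u \<omega>))))"
proof -
  interpret TI: finite_measure "time_interval T"
    by (rule finite_measure_time_interval)
  interpret pair_sigma_finite "time_interval T" P
    by unfold_locales
  interpret TP: finite_measure "time_interval T \<Otimes>\<^sub>M P"
    by (intro finite_measure_pair_measure TI.finite_measure_axioms finite_measure_axioms)
  obtain c where "\<And>x. \<bar>inner_cfg N d (drift N d h x) (drift N d g x)\<bar> \<le> c"
    using inner_drift_bound[OF N R assms(1,2)] by blast
  then have "integrable (time_interval T \<Otimes>\<^sub>M P) (\<lambda>(u, \<omega>). inner_cfg N d (drift N d h (X u \<omega>)) (drift N d g (X u \<omega>)))"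
    using inner_drift_jointly_measurable[OF assms] by (intro TP.integrable_const_bound[of _ c]) auto
  from Fubini_integral[OF this] show ?thesis
    by (simp add: qf_def[abs_def])
qed

lemma semi_inner_expectation_qf: "semi_inner (kernels R) (\<lambda>h g. expectation (qf h g))"
proof
  fix f g h a b assume *: "f \<in> kernels R" "g \<in> kernels R" "h \<in> kernels R"
  have "expectation (qf (\<lambda>r. a * f r + b * g r) h) = expectation (\<lambda>\<omega>. a * qf f h \<omega> + b * qf g h \<omega>)"
    using semi_inner.ip_lincomb[OF semi_inner_qf *] by (intro Bochner_Integration.integral_cong) auto
  then show "expectation (qf (\<lambda>r. a * f r + b * g r) h) = a * expectation (qf f h) + b * expectation (qf g h)"
    using * qf_integrable_P by simp
next
  fix f g assume "f \<in> kernels R" "g \<in> kernels R"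
  then show "expectation (qf f g) = expectation (qf g f)"
    by (simp add: qf_def[abs_def] inner_cfg_commute)
next
  fix f assume "f \<in> kernels R"
  then show "0 \<le> expectation (qf f f)"
    using semi_inner.ip_nonneg[OF semi_inner_qf] by (intro integral_nonneg_AE) auto
qed (simp_all add: kernels_zero kernels_lincomb)

text \<open>Identifies the energy bound delivered by the Ito approximation with the population
  form.\<close>

lemma nn_energy:
  assumes "h \<in> kernels R"
  shows "(\<integral>\<^sup>+u. (\<integral>\<^sup>+\<omega>. ennreal (inner_cfg N d (drift N d h (X u \<omega>)) (drift N d h (X u \<omega>))) \<partial>P) \<partial>time_interval T)
    = ennreal (expectation (qf h h))"
proof -
  interpret TI: finite_measure "time_interval T"
    by (rule finite_measure_time_interval)
  interpret pair_sigma_finite "time_interval T" P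
    by unfold_locales
  have "(\<lambda>(u, \<omega>). ennreal (inner_cfg N d (drift N d h (X u \<omega>)) (drift N d h (X u \<omega>)))) \<in> borel_measurable (time_interval T \<Otimes>\<^sub>M P)"
    using inner_drift_jointly_measurable[OF assms assms] by (simp add: case_prod_beta')
  from Fubini'[OF this]
  have "(\<integral>\<^sup>+u. (\<integral>\<^sup>+\<omega>. ennreal (inner_cfg N d (drift N d h (X u \<omega>)) (drift N d h (X u \<omega>))) \<partial>P) \<partial>time_interval T)
      = (\<integral>\<^sup>+\<omega>. (\<integral>\<^sup>+u. ennreal (inner_cfg N d (drift N d h (X u \<omega>)) (drift N d h (X u \<omega>))) \<partial>time_interval T) \<partial>P)"
    by simp
  also have "\<dots> = (\<integral>\<^sup>+\<omega>. ennreal (qf h h \<omega>) \<partial>P)"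
    unfolding qf_def using qf_integrable[OF assms assms]
    by (intro nn_integral_cong nn_integral_eq_integral) (auto simp: inner_cfg_nonneg)
  also have "\<dots> = ennreal (expectation (qf h h))"
    using qf_integrable_P[OF assms assms] semi_inner.ip_nonneg[OF semi_inner_qf assms]
    by (intro nn_integral_eq_integral) auto
  finally show ?thesis .
qed

end

section \<open>The distribution of pairwise distances\<close>

definition index_pairs :: "nat \<Rightarrow> (nat \<times> nat) set" where
  "index_pairs N = {(i, i'). i < i' \<and> i' < N}"

lemma index_pairs_Suc: "index_pairs (Suc N) = index_pairs N \<union> (\<lambda>i. (i, N)) ` {..<N}"
  by (auto simp: index_pairs_def less_Suc_eq)

lemma finite_index_pairs [simp]: "finite (index_pairs N)"
  by (rule finite_subset[OF _ finite_cartesian_product[OF finite_lessThan[of N] finite_lessThan[of N]]])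
    (auto simp: index_pairs_def)

lemma sum_index_pairs_Suc:
  "(\<Sum>p\<in>index_pairs (Suc N). f p) = (\<Sum>p\<in>index_pairs N. f p) + (\<Sum>i<N. f (i, N))"
proof -
  have "index_pairs N \<inter> (\<lambda>i. (i, N)) ` {..<N} = {}"
    by (auto simp: index_pairs_def)
  moreover have "(\<Sum>p\<in>(\<lambda>i. (i, N)) ` {..<N}. f p) = (\<Sum>i<N. f (i, N))"
    by (subst sum.reindex) (auto simp: inj_on_def)
  ultimately show ?thesis
    unfolding index_pairs_Suc by (simp add: sum.union_disjoint)
qed

lemma card_index_pairs: "card (index_pairs N) = N choose 2"
proof (induction N)
  case 0
  then show ?case
    by (simp add: index_pairs_def)
next
  case (Suc N)
  then show ?case
    using sum_index_pairs_Suc[of "\<lambda>_. 1::nat" N] by (simp add: numeral_2_eq_2)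
qed

lemma sum_symmetric_pairs:
  fixes a :: "nat \<Rightarrow> nat \<Rightarrow> real"
  assumes "\<And>i j. a i j = a j i" "\<And>i. a i i = 0"
  shows "(\<Sum>i<N. \<Sum>j<N. a i j) = 2 * (\<Sum>p\<in>index_pairs N. a (fst p) (snd p))"
proof (induction N)
  case 0
  then show ?case
    by (simp add: index_pairs_def)
next
  case (Suc N)
  have "(\<Sum>j<N. a N j) = (\<Sum>i<N. a i N)"
    using assms(1) by simp
  then show ?case
    using Suc assms(2) by (simp add: sum_index_pairs_Suc sum.distrib)
qed

context observation
begin

abbreviation "\<rho> \<equiv> rho N d T P X"

lemma pdist_jointly_measurable:
  assumes "i < N" "i' < N"
  shows "(\<lambda>y. pdist d (X (fst y) (snd y)) i i') \<in> borel_measurable (time_interval T \<Otimes>\<^sub>M P)"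
  using X_jointly_measurable assms by (intro pdist_measurable) (auto simp: case_prod_beta')

text \<open>A measure built by \<open>measure_of\<close> has the prescribed values only if these are
  countably additive. To see this, \<open>rho\<close> is recognised as a scaled image, under the
  distance map, of the product of counting measure on pairs, time and \<open>P\<close>; its
  integrals are then those of an image measure.\<close>

lemma rho_nn_integral:
  shows sets_rho: "sets \<rho> = sets borel" and space_rho: "space \<rho> = UNIV"
    and "f \<in> borel_measurable borel \<Longrightarrow> (\<integral>\<^sup>+r. f r \<partial>\<rho>) = ennreal (1 / (real (N choose 2) * T)) *
      (\<Sum>p\<in>index_pairs N. \<integral>\<^sup>+u. (\<integral>\<^sup>+\<omega>. f (pdist d (X u \<omega>) (fst p) (snd p)) \<partial>P) \<partial>time_interval T)"
proof -
  note nn_fst = nn_integral_fst and meas_fst = borel_measurable_nn_integral_fst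
  interpret TI: finite_measure "time_interval T"
    by (rule finite_measure_time_interval)
  interpret pair_sigma_finite "time_interval T" P
    by unfold_locales
  interpret TP: finite_measure "time_interval T \<Otimes>\<^sub>M P"
    by (intro finite_measure_pair_measure TI.finite_measure_axioms finite_measure_axioms)
  let ?c = "ennreal (1 / (real (N choose 2) * T))"
  define G where "G = count_space (index_pairs N) \<Otimes>\<^sub>M (time_interval T \<Otimes>\<^sub>M P)"
  define D where "D z = pdist d (X (fst (snd z)) (snd (snd z))) (fst (fst z)) (snd (fst z))" for z
  have D: "D \<in> borel_measurable G"
    unfolding G_def
  proof (rule measurable_pair_measure_countable1)
    fix p assume "p \<in> index_pairs N"
    then show "(\<lambda>y. D (p, y)) \<in> borel_measurable (time_interval T \<Otimes>\<^sub>M P)"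
      unfolding D_def fst_conv snd_conv by (intro pdist_jointly_measurable) (auto simp: index_pairs_def)
  qed (simp add: countable_finite)
  define \<rho>' where "\<rho>' = scale_measure ?c (distr G borel D)"
  have sets': "sets \<rho>' = sets borel"
    by (simp add: \<rho>'_def)
  have space': "space \<rho>' = UNIV"
    using sets_eq_imp_space_eq[OF sets'] by simp
  have nn: "(\<integral>\<^sup>+r. f r \<partial>\<rho>') = ?c * (\<Sum>p\<in>index_pairs N. \<integral>\<^sup>+u. (\<integral>\<^sup>+\<omega>. f (pdist d (X u \<omega>) (fst p) (snd p)) \<partial>P) \<partial>time_interval T)"
    if f: "f \<in> borel_measurable borel" for f
  proof -
    have fD: "(\<lambda>z. f (D z)) \<in> borel_measurable G"
      by (rule measurable_compose[OF D f])
    have "(\<integral>\<^sup>+r. f r \<partial>\<rho>') = ?c * (\<integral>\<^sup>+z. f (D z) \<partial>G)"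
      unfolding \<rho>'_def using f D by (simp add: nn_integral_scale_measure nn_integral_distr)
    also have "(\<integral>\<^sup>+z. f (D z) \<partial>G) = (\<integral>\<^sup>+p. (\<integral>\<^sup>+y. f (D (p, y)) \<partial>(time_interval T \<Otimes>\<^sub>M P)) \<partial>count_space (index_pairs N))"
      using fD unfolding G_def
      by (intro sigma_finite_measure.nn_integral_fst[symmetric]) unfold_locales
    also have "\<dots> = (\<Sum>p\<in>index_pairs N. \<integral>\<^sup>+y. f (D (p, y)) \<partial>(time_interval T \<Otimes>\<^sub>M P))"
      by (simp add: nn_integral_count_space_finite)
    also have "\<dots> = (\<Sum>p\<in>index_pairs N. \<integral>\<^sup>+u. (\<integral>\<^sup>+\<omega>. f (pdist d (X u \<omega>) (fst p) (snd p)) \<partial>P) \<partial>time_interval T)"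
    proof (rule sum.cong[OF refl])
      fix p assume p: "p \<in> index_pairs N"
      have m: "(\<lambda>y. f (pdist d (X (fst y) (snd y)) (fst p) (snd p))) \<in> borel_measurable (time_interval T \<Otimes>\<^sub>M P)"
        using p by (intro measurable_compose[OF pdist_jointly_measurable f]) (auto simp: index_pairs_def)
      show "(\<integral>\<^sup>+y. f (D (p, y)) \<partial>(time_interval T \<Otimes>\<^sub>M P))
          = (\<integral>\<^sup>+u. (\<integral>\<^sup>+\<omega>. f (pdist d (X u \<omega>) (fst p) (snd p)) \<partial>P) \<partial>time_interval T)"
        unfolding D_def fst_conv snd_conv using nn_fst[OF m] by simp
    qed
    finally show ?thesis .
  qed
  have "\<rho> = \<rho>'"
  proof -
    have "\<rho> = measure_of UNIV (sets borel) (emeasure \<rho>')"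
      unfolding rho_def
    proof (rule measure_of_eq)
      fix A :: "real set" assume "A \<in> sigma_sets UNIV (sets borel)"
      then have A: "A \<in> sets borel"
        using sets.sigma_sets_eq[of "borel :: real measure"] by simp
      have "emeasure \<rho>' A = (\<integral>\<^sup>+r. indicator A r \<partial>\<rho>')"
        using A by (simp add: \<rho>'_def)
      also have "\<dots> = ?c * (\<Sum>p\<in>index_pairs N. \<integral>\<^sup>+u. (\<integral>\<^sup>+\<omega>. indicator A (pdist d (X u \<omega>) (fst p) (snd p)) \<partial>P) \<partial>time_interval T)"
        using A by (intro nn) auto
      also have "(\<Sum>p\<in>index_pairs N. \<integral>\<^sup>+u. (\<integral>\<^sup>+\<omega>. indicator A (pdist d (X u \<omega>) (fst p) (snd p)) \<partial>P) \<partial>time_interval T)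
          = (\<integral>\<^sup>+u. (\<Sum>p\<in>index_pairs N. \<integral>\<^sup>+\<omega>. indicator A (pdist d (X u \<omega>) (fst p) (snd p)) \<partial>P) \<partial>time_interval T)"
      proof (rule nn_integral_sum[symmetric])
        fix p assume p: "p \<in> index_pairs N"
        have "(\<lambda>y. indicator A (pdist d (X (fst y) (snd y)) (fst p) (snd p)) :: ennreal) \<in> borel_measurable (time_interval T \<Otimes>\<^sub>M P)"
          using p A by (intro measurable_compose[OF pdist_jointly_measurable]) (auto simp: index_pairs_def)
        from meas_fst[OF this]
        show "(\<lambda>u. \<integral>\<^sup>+\<omega>. indicator A (pdist d (X u \<omega>) (fst p) (snd p)) \<partial>P) \<in> borel_measurable (time_interval T)"
          by simp
      qed
      finally show "?c * (\<integral>\<^sup>+t\<in>{0..T}. (\<Sum>(i, i')\<in>{(i, i'). i < i' \<and> i' < N}.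
          \<integral>\<^sup>+\<omega>. indicator A (pdist d (X t \<omega>) i i') \<partial>P) \<partial>lborel) = emeasure \<rho>' A"
        by (simp add: set_nn_integral_time_interval index_pairs_def case_prod_beta')
    qed simp
    also have "\<dots> = \<rho>'"
      using measure_of_of_measure[of \<rho>'] unfolding sets' space' .
    finally show ?thesis .
  qed
  then show "sets \<rho> = sets borel" "space \<rho> = UNIV"
    "f \<in> borel_measurable borel \<Longrightarrow> (\<integral>\<^sup>+r. f r \<partial>\<rho>) = ?c *
      (\<Sum>p\<in>index_pairs N. \<integral>\<^sup>+u. (\<integral>\<^sup>+\<omega>. f (pdist d (X u \<omega>) (fst p) (snd p)) \<partial>P) \<partial>time_interval T)"
    using nn[of f] sets' space' by auto
qed

lemma prob_space_rho:
  assumes "N \<ge> 2"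
  shows "prob_space \<rho>"
proof
  have c: "real (N choose 2) > 0"
    using assms by (simp add: zero_less_binomial)
  have "emeasure \<rho> (space \<rho>) = (\<integral>\<^sup>+r. 1 \<partial>\<rho>)"
    by simp
  also have "\<dots> = ennreal (1 / (real (N choose 2) * T)) * (\<Sum>p\<in>index_pairs N. ennreal T)"
    using T by (subst rho_nn_integral(3)) (auto simp: emeasure_space_1 emeasure_time_interval)
  also have "\<dots> = ennreal (1 / (real (N choose 2) * T) * (real (N choose 2) * T))"
  proof -
    have "(\<Sum>p\<in>index_pairs N. ennreal T) = ennreal (real (N choose 2) * T)"
      using T by (simp add: card_index_pairs ennreal_mult ennreal_of_nat_eq_real_of_nat)
    then show ?thesis
      using T by (simp only: ennreal_mult zero_le_divide_1_iff mult_nonneg_nonneg of_nat_0_le_iff less_imp_le)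
  qed
  also have "1 / (real (N choose 2) * T) * (real (N choose 2) * T) = 1"
    using T c by simp
  finally show "emeasure \<rho> (space \<rho>) = 1"
    by simp
qed

section \<open>The squared norm as an integral against \<open>rho\<close>\<close>

definition tri2 :: "(real \<Rightarrow> real) \<Rightarrow> real" where
  "tri2 h = (LINT r|\<rho>. indicator {0..} r * (h r * r)\<^sup>2)"

lemma tri_norm_sq: "(tri_norm \<rho> h)\<^sup>2 = tri2 h"
proof -
  have "(LINT r:{0..}|\<rho>. \<bar>h r * r\<bar>\<^sup>2) = tri2 h"
    by (simp add: set_lebesgue_integral_def tri2_def)
  moreover have "tri2 h \<ge> 0"
    unfolding tri2_def by (intro integral_nonneg_AE) auto
  ultimately show ?thesis
    by (simp add: tri_norm_def)
qed

lemma tri2_nonneg: "tri2 h \<ge> 0"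
  unfolding tri2_def by (intro integral_nonneg_AE) auto

lemma tri2_cong: "(\<And>r. r \<ge> 0 \<Longrightarrow> h r = g r) \<Longrightarrow> tri2 h = tri2 g"
  unfolding tri2_def by (intro Bochner_Integration.integral_cong refl) (simp add: indicator_def)

lemma tri2_integrable:
  assumes "N \<ge> 2" "h \<in> kernels R"
  shows "integrable \<rho> (\<lambda>r. indicator {0..} r * (h r * r)\<^sup>2)"
proof -
  interpret \<rho>: prob_space \<rho>
    by (rule prob_space_rho[OF assms(1)])
  obtain c where "\<And>r. \<bar>h r\<bar> \<le> c"
    using assms(2) by (auto simp: kernels_def)
  then have "\<bar>indicator {0..} r * (h r * r)\<^sup>2\<bar> \<le> (c * R)\<^sup>2" for r
    using kernels_times_id_le[OF assms(2) _ _ R, of c r] by (simp add: indicator_def)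
  moreover have "(\<lambda>r. indicator {0..} r * (h r * r)\<^sup>2) \<in> borel_measurable \<rho>"
    unfolding measurable_cong_sets[OF sets_rho refl] using assms(2) by measurable
  ultimately show ?thesis
    by (intro \<rho>.integrable_const_bound[of _ "(c * R)\<^sup>2"]) auto
qed

lemma tri2_bound:
  assumes "N \<ge> 2" "h \<in> kernels R" "\<And>r. \<bar>h r\<bar> \<le> c"
  shows "tri2 h \<le> (c * R)\<^sup>2"
proof -
  interpret \<rho>: prob_space \<rho>
    by (rule prob_space_rho[OF assms(1)])
  have "tri2 h \<le> (LINT r|\<rho>. (c * R)\<^sup>2)"
    unfolding tri2_def using tri2_integrable[OF assms(1,2)] kernels_times_id_le[OF assms(2,3) _ R]
    by (intro integral_mono) (auto simp: indicator_def)
  then show ?thesis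
    by (simp add: \<rho>.prob_space)
qed

lemma tri2_add_le:
  assumes "N \<ge> 2" "h \<in> kernels R" "g \<in> kernels R"
  shows "tri2 (\<lambda>r. h r + g r) \<le> 2 * tri2 h + 2 * tri2 g" "tri2 (\<lambda>r. h r - g r) \<le> 2 * tri2 h + 2 * tri2 g"
proof -
  have sq: "(x + y)\<^sup>2 \<le> 2 * x\<^sup>2 + 2 * y\<^sup>2" for x y :: real
    using sum_squares_ge_zero[of "x - y" 0] by (simp add: power2_eq_square algebra_simps)
  have *: "tri2 f \<le> 2 * tri2 h + 2 * tri2 g" if "f \<in> kernels R" "\<And>r. (f r * r)\<^sup>2 \<le> 2 * (h r * r)\<^sup>2 + 2 * (g r * r)\<^sup>2" for f
  proof -
    have "tri2 f \<le> (LINT r|\<rho>. 2 * (indicator {0..} r * (h r * r)\<^sup>2) + 2 * (indicator {0..} r * (g r * r)\<^sup>2))"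
      unfolding tri2_def using tri2_integrable[OF assms(1)] assms(2,3) that
      by (intro integral_mono) (auto simp: indicator_def)
    then show ?thesis
      using tri2_integrable[OF assms(1)] assms(2,3) by (simp add: tri2_def)
  qed
  show "tri2 (\<lambda>r. h r + g r) \<le> 2 * tri2 h + 2 * tri2 g"
    using kernels_lincomb[OF assms(2,3), of 1 1] sq[of "h _ * _" "g _ * _"] by (intro *) (auto simp: distrib_right)
  show "tri2 (\<lambda>r. h r - g r) \<le> 2 * tri2 h + 2 * tri2 g"
    using kernels_diff[OF assms(2,3)] sq[of "h _ * _" "- (g _ * _)"] by (intro *) (auto simp: left_diff_distrib)
qed

text \<open>The inequality opposite to coercivity, valid for every kernel. The sum over ordered
  pairs is twice the sum over unordered ones, the diagonal being 0, and 2/N times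
  \<open>N choose 2\<close> is N - 1, estimated by N.\<close>

lemma energy_le_tri2:
  assumes "N \<ge> 2" "h \<in> kernels R"
  shows "expectation (qf h h) \<le> T * real N * tri2 h"
proof -
  note nn_fst = nn_integral_fst and meas_fst = borel_measurable_nn_integral_fst
  interpret TI: finite_measure "time_interval T"
    by (rule finite_measure_time_interval)
  interpret pair_sigma_finite "time_interval T" P
    by unfold_locales
  have ch: "real (N choose 2) > 0"
    using assms by (simp add: zero_less_binomial)
  have ch_eq: "real (N choose 2) = real N * (real N - 1) / 2"
  proof -
    have "2 * (N choose 2) = N * (N - 1)"
    proof -
      have "even (N * (N - 1))"
        by (cases "even N") auto
      then show ?thesis
        by (simp add: choose_two)
    qed
    then have "2 * real (N choose 2) = real N * real (N - 1)"
      by (metis of_nat_mult of_nat_numeral)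
    then show ?thesis
      using N by (simp add: of_nat_diff)
  qed
  let ?f = "\<lambda>r. indicator {0..} r * (h r * r)\<^sup>2"
  let ?g = "\<lambda>p u \<omega>. (h (pdist d (X u \<omega>) (fst p) (snd p)) * pdist d (X u \<omega>) (fst p) (snd p))\<^sup>2"
  have f_meas: "(\<lambda>r. ennreal (?f r)) \<in> borel_measurable borel"
    using assms(2) by measurable
  have g_meas: "(\<lambda>(u, \<omega>). ennreal (?g p u \<omega>)) \<in> borel_measurable (time_interval T \<Otimes>\<^sub>M P)" if "p \<in> index_pairs N" for p
  proof -
    have "fst p < N" "snd p < N"
      using that by (auto simp: index_pairs_def)
    from measurable_compose[OF pdist_jointly_measurable[OF this] f_meas] show ?thesis
      by (simp add: case_prod_beta')
  qed
  have tri: "ennreal (tri2 h) = ennreal (1 / (real (N choose 2) * T)) *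
      (\<Sum>p\<in>index_pairs N. \<integral>\<^sup>+u. (\<integral>\<^sup>+\<omega>. ennreal (?g p u \<omega>) \<partial>P) \<partial>time_interval T)"
  proof -
    have "ennreal (tri2 h) = (\<integral>\<^sup>+r. ennreal (?f r) \<partial>\<rho>)"
      unfolding tri2_def using tri2_integrable[OF assms] by (intro nn_integral_eq_integral[symmetric]) auto
    then show ?thesis
      using rho_nn_integral(3)[OF f_meas] by simp
  qed
  have "ennreal (expectation (qf h h))
      = (\<integral>\<^sup>+u. (\<integral>\<^sup>+\<omega>. ennreal (inner_cfg N d (drift N d h (X u \<omega>)) (drift N d h (X u \<omega>))) \<partial>P) \<partial>time_interval T)"
    using nn_energy[OF assms(2)] by simp
  also have "\<dots> \<le> (\<integral>\<^sup>+u. (\<integral>\<^sup>+\<omega>. (\<Sum>p\<in>index_pairs N. ennreal (2 / real N) * ennreal (?g p u \<omega>)) \<partial>P) \<partial>time_interval T)"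
  proof (intro nn_integral_mono)
    fix u \<omega>
    have "inner_cfg N d (drift N d h (X u \<omega>)) (drift N d h (X u \<omega>))
        \<le> 1 / real N * (\<Sum>i<N. \<Sum>i'<N. (h (pdist d (X u \<omega>) i i') * pdist d (X u \<omega>) i i')\<^sup>2)"
      by (rule drift_sq_le[OF N])
    also have "(\<Sum>i<N. \<Sum>i'<N. (h (pdist d (X u \<omega>) i i') * pdist d (X u \<omega>) i i')\<^sup>2) = 2 * (\<Sum>p\<in>index_pairs N. ?g p u \<omega>)"
      by (rule sum_symmetric_pairs) (simp_all add: pdist_commute)
    finally have "inner_cfg N d (drift N d h (X u \<omega>)) (drift N d h (X u \<omega>)) \<le> (\<Sum>p\<in>index_pairs N. 2 / real N * ?g p u \<omega>)"
      by (simp add: sum_distrib_left)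
    then show "ennreal (inner_cfg N d (drift N d h (X u \<omega>)) (drift N d h (X u \<omega>)))
        \<le> (\<Sum>p\<in>index_pairs N. ennreal (2 / real N) * ennreal (?g p u \<omega>))"
      by (simp add: ennreal_mult'[symmetric] sum_ennreal ennreal_leI)
  qed
  also have "\<dots> = (\<integral>\<^sup>+u. (\<Sum>p\<in>index_pairs N. ennreal (2 / real N) * (\<integral>\<^sup>+\<omega>. ennreal (?g p u \<omega>) \<partial>P)) \<partial>time_interval T)"
  proof (rule nn_integral_cong)
    fix u assume "u \<in> space (time_interval T)"
    then have m: "(\<lambda>\<omega>. ennreal (?g p u \<omega>)) \<in> borel_measurable P" if "p \<in> index_pairs N" for p
      using measurable_Pair2[OF g_meas[OF that], of u] by simp
    have "(\<integral>\<^sup>+\<omega>. (\<Sum>p\<in>index_pairs N. ennreal (2 / real N) * ennreal (?g p u \<omega>)) \<partial>P)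
        = (\<Sum>p\<in>index_pairs N. \<integral>\<^sup>+\<omega>. ennreal (2 / real N) * ennreal (?g p u \<omega>) \<partial>P)"
      using m by (intro nn_integral_sum borel_measurable_times_ennreal) auto
    also have "\<dots> = (\<Sum>p\<in>index_pairs N. ennreal (2 / real N) * (\<integral>\<^sup>+\<omega>. ennreal (?g p u \<omega>) \<partial>P))"
      using m by (intro sum.cong refl nn_integral_cmult) auto
    finally show "(\<integral>\<^sup>+\<omega>. (\<Sum>p\<in>index_pairs N. ennreal (2 / real N) * ennreal (?g p u \<omega>)) \<partial>P)
        = (\<Sum>p\<in>index_pairs N. ennreal (2 / real N) * (\<integral>\<^sup>+\<omega>. ennreal (?g p u \<omega>) \<partial>P))" .
  qed
  also have "\<dots> = (\<Sum>p\<in>index_pairs N. \<integral>\<^sup>+u. ennreal (2 / real N) * (\<integral>\<^sup>+\<omega>. ennreal (?g p u \<omega>) \<partial>P) \<partial>time_interval T)"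
    using meas_fst[OF g_meas] by (intro nn_integral_sum borel_measurable_times_ennreal) auto
  also have "\<dots> = (\<Sum>p\<in>index_pairs N. ennreal (2 / real N) * (\<integral>\<^sup>+u. (\<integral>\<^sup>+\<omega>. ennreal (?g p u \<omega>) \<partial>P) \<partial>time_interval T))"
    using meas_fst[OF g_meas] by (intro sum.cong refl nn_integral_cmult) auto
  also have "\<dots> = ennreal (2 / real N) * (\<Sum>p\<in>index_pairs N. \<integral>\<^sup>+u. (\<integral>\<^sup>+\<omega>. ennreal (?g p u \<omega>) \<partial>P) \<partial>time_interval T)"
    by (rule sum_distrib_left[symmetric])
  also have "\<dots> = ennreal (2 / real N * (real (N choose 2) * T)) * ennreal (tri2 h)"
  proof -
    have "ennreal (2 / real N * (real (N choose 2) * T)) * (ennreal (1 / (real (N choose 2) * T)) * y) = ennreal (2 / real N) * y" for y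
      using ch T by (simp add: mult.assoc[symmetric] ennreal_mult[symmetric])
    then show ?thesis
      unfolding tri by simp
  qed
  also have "\<dots> = ennreal ((real N - 1) * T * tri2 h)"
    using N T tri2_nonneg[of h] unfolding ch_eq by (simp add: ennreal_mult[symmetric] mult_ac)
  finally have "expectation (qf h h) \<le> (real N - 1) * T * tri2 h"
    using N T tri2_nonneg[of h] by (subst (asm) ennreal_le_iff) auto
  also have "\<dots> \<le> T * real N * tri2 h"
    using T tri2_nonneg[of h] by (intro mult_right_mono) (auto simp: algebra_simps)
  finally show ?thesis .
qed

end

section \<open>Independent copies\<close>

lemma inner_cfg_cong:
  assumes "\<And>i k. i < N \<Longrightarrow> k < d \<Longrightarrow> x i k = x' i k" "\<And>i k. i < N \<Longrightarrow> k < d \<Longrightarrow> y i k = y' i k"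
  shows "inner_cfg N d x y = inner_cfg N d x' y'"
  using assms by (simp add: inner_cfg_def)

lemma drift_coords_cong:
  assumes "\<And>i k. i < N \<Longrightarrow> k < d \<Longrightarrow> x i k = y i k" "i < N" "k < d"
  shows "drift N d h x i k = drift N d h y i k"
proof -
  have "pdist d x i i' = pdist d y i i'" if "i' < N" for i'
    using assms that by (simp add: pdist_def L2_set_def)
  then show ?thesis
    using assms by (simp add: drift_def)
qed

lemma (in prob_space) sum_indep_second_moment:
  fixes Y :: "'i \<Rightarrow> 'a \<Rightarrow> real"
  assumes ind: "indep_vars (\<lambda>_. borel) Y I" and I: "finite I"
    and sq: "\<And>i. i \<in> I \<Longrightarrow> integrable M (\<lambda>\<omega>. (Y i \<omega>)\<^sup>2)" and zero: "\<And>i. i \<in> I \<Longrightarrow> expectation (Y i) = 0"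
  shows "integrable M (\<lambda>\<omega>. (\<Sum>i\<in>I. Y i \<omega>)\<^sup>2)"
    and "expectation (\<lambda>\<omega>. (\<Sum>i\<in>I. Y i \<omega>)\<^sup>2) = (\<Sum>i\<in>I. expectation (\<lambda>\<omega>. (Y i \<omega>)\<^sup>2))"
proof -
  have int: "integrable M (Y i)" if "i \<in> I" for i
  proof (rule square_integrable_imp_integrable[OF _ sq[OF that]])
    show "random_variable borel (Y i)"
      using ind that unfolding indep_vars_def by blast
  qed
  have cross: "integrable M (\<lambda>\<omega>. Y i \<omega> * Y j \<omega>) \<and>
      expectation (\<lambda>\<omega>. Y i \<omega> * Y j \<omega>) = (if i = j then expectation (\<lambda>\<omega>. (Y i \<omega>)\<^sup>2) else 0)"
    if ij: "i \<in> I" "j \<in> I" for i j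
  proof (cases "i = j")
    case True
    then show ?thesis
      using sq ij by (simp add: power2_eq_square)
  next
    case False
    have ind': "indep_vars (\<lambda>_. borel) Y {i, j}"
      using ij by (intro indep_vars_subset[OF ind]) auto
    have int': "integrable M (Y k)" if "k \<in> {i, j}" for k
      using that int ij by blast
    have prod: "(\<Prod>k\<in>{i, j}. F k) = F i * F j" for F :: "'i \<Rightarrow> real"
      using False by simp
    show ?thesis
      using indep_vars_integrable[OF _ ind' int'] indep_vars_lebesgue_integral[OF _ ind' int'] False zero ij
      unfolding prod by simp
  qed
  have eq: "(\<Sum>i\<in>I. Y i \<omega>)\<^sup>2 = (\<Sum>i\<in>I. \<Sum>j\<in>I. Y i \<omega> * Y j \<omega>)" for \<omega>
    by (simp add: power2_eq_square sum_product)
  show "integrable M (\<lambda>\<omega>. (\<Sum>i\<in>I. Y i \<omega>)\<^sup>2)"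
    unfolding eq using cross by (intro Bochner_Integration.integrable_sum) auto
  have "expectation (\<lambda>\<omega>. (\<Sum>i\<in>I. Y i \<omega>)\<^sup>2)
      = (\<Sum>i\<in>I. \<Sum>j\<in>I. if i = j then expectation (\<lambda>\<omega>. (Y i \<omega>)\<^sup>2) else 0)"
    unfolding eq using cross by (simp add: Bochner_Integration.integral_sum cong: sum.cong)
  then show "expectation (\<lambda>\<omega>. (\<Sum>i\<in>I. Y i \<omega>)\<^sup>2) = (\<Sum>i\<in>I. expectation (\<lambda>\<omega>. (Y i \<omega>)\<^sup>2))"
    using I by (simp add: sum.delta)
qed

text \<open>Each copy has its own driving motion, but independence and equality in law concern the
  trajectories \<open>Xs m\<close> only. Whatever is to be independent across copies must therefore
  be measurable in the history of its trajectory.\<close>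

locale sample = P: observation P N d \<sigma> T R S \<phi> \<mu>0 B X + Q: prob_space Q
  for P :: "'w measure" and N d :: nat and \<sigma> T R S :: real and \<phi> :: "real \<Rightarrow> real"
    and \<mu>0 :: "(nat \<times> nat \<Rightarrow> real) measure" and B X :: "real \<Rightarrow> 'w \<Rightarrow> config" and Q :: "'v measure" +
  fixes Bs Xs :: "nat \<Rightarrow> real \<Rightarrow> 'v \<Rightarrow> config" and M :: nat
  assumes copies: "\<And>m. m \<in> {1..M} \<Longrightarrow> observed_system N d \<sigma> T \<phi> \<mu>0 Q (Bs m) (Xs m)"
    and indep: "independent_copies N d T P X Q M Xs"
    and M: "M \<ge> 1"
begin

lemma observation_copy: "m \<in> {1..M} \<Longrightarrow> observation Q N d \<sigma> T R S \<phi> \<mu>0 (Bs m) (Xs m)"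
  using copies P.adm P.T P.R P.N by unfold_locales auto

definition q :: "nat \<Rightarrow> (real \<Rightarrow> real) \<Rightarrow> (real \<Rightarrow> real) \<Rightarrow> 'v \<Rightarrow> real" where
  "q m = observation.qf N d T (Xs m)"

lemma indep_functions:
  fixes F :: "nat \<Rightarrow> 'v \<Rightarrow> real"
  assumes "\<And>m. m \<in> {1..M} \<Longrightarrow> F m \<in> borel_measurable (history N d Q (Xs m) T)"
  shows "Q.indep_vars (\<lambda>_. borel) F {1..M}"
proof -
  have "Q.indep_vars (\<lambda>_. path_space N d T) (\<lambda>m. path N d T (Xs m)) {1..M}"
    using indep by (simp add: independent_copies_def)
  then have ind: "Q.indep_sets (\<lambda>m. sets (history N d Q (Xs m) T)) {1..M}"
    by (simp add: Q.indep_vars_def history_def sets_vimage_algebra)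
  have sub: "{F m -` A \<inter> space Q | A. A \<in> sets borel} \<subseteq> sets (history N d Q (Xs m) T)" if "m \<in> {1..M}" for m
    using measurable_sets[OF assms[OF that]] by auto
  show ?thesis
    unfolding Q.indep_vars_def2
  proof (intro conjI ballI)
    show "Q.indep_sets (\<lambda>m. {F m -` A \<inter> space Q | A. A \<in> sets borel}) {1..M}"
      using ind sub by (rule Q.indep_sets_mono_sets)
    show "F m \<in> borel_measurable Q" if "m \<in> {1..M}" for m
    proof -
      interpret m: observation Q N d \<sigma> T R S \<phi> \<mu>0 "Bs m" "Xs m"
        by (rule observation_copy[OF that])
      show ?thesis
        using m.history_measurable_events[OF assms[OF that]] by simp
    qed
  qed
qed

text \<open>The law of a trajectory lives on a product sigma-algebra over uncountably many times,
  where a time integral is not a measurable functional. So laws are compared at one fixed time,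
  where finitely many coordinates matter, and time is integrated afterwards by Fubini on either
  side.\<close>

lemma q_expectation:
  assumes m: "m \<in> {1..M}" and h: "h \<in> kernels R" and g: "g \<in> kernels R"
  shows "Q.expectation (q m h g) = P.expectation (P.qf h g)"
proof -
  interpret m: observation Q N d \<sigma> T R S \<phi> \<mu>0 "Bs m" "Xs m"
    by (rule observation_copy[OF m])
  have "Q.expectation (\<lambda>\<omega>. inner_cfg N d (drift N d h (Xs m u \<omega>)) (drift N d g (Xs m u \<omega>)))
      = P.expectation (\<lambda>\<omega>. inner_cfg N d (drift N d h (X u \<omega>)) (drift N d g (X u \<omega>)))" if u: "u \<in> {0..T}" for u
  proof -
    let ?at = "\<lambda>p :: real \<times> nat \<times> nat \<Rightarrow> real. \<lambda>i k. p (u, i, k)"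
    define G where "G p = inner_cfg N d (drift N d h (?at p)) (drift N d g (?at p))" for p
    have comp: "(\<lambda>p. ?at p i k) \<in> borel_measurable (path_space N d T)" if "i < N" "k < d" for i k
      unfolding path_space_def using that u by (intro measurable_component_singleton) (auto simp: coords_def)
    have G: "G \<in> borel_measurable (path_space N d T)"
      unfolding G_def[abs_def] using h g by (intro inner_cfg_measurable drift_measurable comp kernels_measurable)
    have G_path: "G (path N d T Y \<omega>) = inner_cfg N d (drift N d h (Y u \<omega>)) (drift N d g (Y u \<omega>))" for Y :: "real \<Rightarrow> 'z \<Rightarrow> config" and \<omega>
      unfolding G_def using u
      by (intro inner_cfg_cong drift_coords_cong) (auto simp: path_def coords_def)
    have "Q.expectation (\<lambda>\<omega>. G (path N d T (Xs m) \<omega>)) = integral\<^sup>L (distr Q (path_space N d T) (path N d T (Xs m))) G"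
      using m.X_measurable by (intro integral_distr[symmetric] G path_measurable) auto
    also have "distr Q (path_space N d T) (path N d T (Xs m)) = distr P (path_space N d T) (path N d T X)"
      using indep m by (simp add: independent_copies_def)
    also have "integral\<^sup>L (distr P (path_space N d T) (path N d T X)) G = P.expectation (\<lambda>\<omega>. G (path N d T X \<omega>))"
      using P.X_measurable by (intro integral_distr G path_measurable) auto
    finally show ?thesis
      by (simp add: G_path)
  qed
  then show ?thesis
    unfolding q_def m.qf_expectation[OF h g] P.qf_expectation[OF h g]
    by (intro Bochner_Integration.integral_cong) auto
qed

text \<open>Constants are not optimal here: two applications of \<open>(a + b)\<^sup>2 \<le> 2 a\<^sup>2 + 2 b\<^sup>2\<close> replace the passage to the
  limit in the Ito isometry.\<close>

lemma noise_second_moment: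
  assumes h: "h \<in> kernels R"
    and ito: "\<And>m. m \<in> {1..M} \<Longrightarrow> has_ito_integral N d T Q (Xs m) (\<lambda>t \<omega>. drift N d h (Xs m t \<omega>)) (I m)"
  defines "Z \<equiv> \<lambda>m \<omega>. I m \<omega> - q m h (truncate R \<phi>) \<omega>"
  shows "(\<integral>\<^sup>+\<omega>. ennreal ((\<Sum>m=1..M. Z m \<omega>)\<^sup>2) \<partial>Q) \<le> ennreal (4 * \<sigma>\<^sup>2 * real M * P.expectation (P.qf h h))"
    and "\<And>m. m \<in> {1..M} \<Longrightarrow> Z m \<in> borel_measurable Q"
proof -
  note tr = truncate_admissible(1)[OF P.adm P.R]
  let ?A = "ennreal (P.expectation (P.qf h h))"
  define approx where "approx m Y a \<longleftrightarrow> (\<forall>n::nat. Y n \<in> borel_measurable (history N d Q (Xs m) T) \<and> integrable Q (\<lambda>\<omega>. (Y n \<omega>)\<^sup>2)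
      \<and> Q.expectation (Y n) = 0 \<and> ennreal (Q.expectation (\<lambda>\<omega>. (Y n \<omega>)\<^sup>2)) \<le> ennreal (\<sigma>\<^sup>2) * (2 * a n + 2 * ?A))
    \<and> a \<longlonglongrightarrow> 0 \<and> (\<lambda>n. \<integral>\<^sup>+\<omega>. ennreal ((Z m \<omega> - Y n \<omega>)\<^sup>2) \<partial>Q) \<longlonglongrightarrow> 0" for m Y a
  have ex: "\<exists>Y a. approx m Y a" if m: "m \<in> {1..M}" for m
  proof -
    interpret m: observation Q N d \<sigma> T R S \<phi> \<mu>0 "Bs m" "Xs m"
      by (rule observation_copy[OF m])
    have "Z m = (\<lambda>\<omega>. I m \<omega> - (LINT u|time_interval T. inner_cfg N d (drift N d h (Xs m u \<omega>)) (drift N d \<phi> (Xs m u \<omega>))))"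
      unfolding Z_def q_def m.qf_def[abs_def] truncate_admissible(4)[OF P.adm P.R] ..
    moreover have "(\<integral>\<^sup>+u. (\<integral>\<^sup>+\<omega>. ennreal ((norm_cfg N d (drift N d h (Xs m u \<omega>)))\<^sup>2) \<partial>Q) \<partial>time_interval T) = ?A"
      unfolding norm_cfg_sq m.nn_energy[OF h] q_expectation[OF m h h, unfolded q_def] ..
    ultimately show ?thesis
      unfolding approx_def using m.ito_approximation[OF h ito[OF m]] by simp
  qed
  obtain Y a where Ya: "\<And>m. m \<in> {1..M} \<Longrightarrow> approx m (Y m) (a m)"
    using ex by metis
  let ?D = "\<lambda>m n. \<integral>\<^sup>+\<omega>. ennreal ((Z m \<omega> - Y m n \<omega>)\<^sup>2) \<partial>Q"
  have Y: "Y m n \<in> borel_measurable (history N d Q (Xs m) T)" "integrable Q (\<lambda>\<omega>. (Y m n \<omega>)\<^sup>2)"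
    "Q.expectation (Y m n) = 0" "ennreal (Q.expectation (\<lambda>\<omega>. (Y m n \<omega>)\<^sup>2)) \<le> ennreal (\<sigma>\<^sup>2) * (2 * a m n + 2 * ?A)"
    "a m \<longlonglongrightarrow> 0" "?D m \<longlonglongrightarrow> 0" if "m \<in> {1..M}" for m n
    using Ya[OF that] unfolding approx_def by blast+
  have Y_meas: "Y m n \<in> borel_measurable Q" and Z_meas: "Z m \<in> borel_measurable Q" if m: "m \<in> {1..M}" for m n
  proof -
    interpret m: observation Q N d \<sigma> T R S \<phi> \<mu>0 "Bs m" "Xs m"
      by (rule observation_copy[OF m])
    show "Y m n \<in> borel_measurable Q"
      using m.history_measurable_events[OF Y(1)[OF m]] by simp
    have "I m \<in> borel_measurable Q"
      using ito[OF m] by (simp add: has_ito_integral_def)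
    moreover have "q m h (truncate R \<phi>) \<in> borel_measurable Q"
      using m.history_measurable_events[OF m.qf_measurable[OF h tr]] by (simp add: q_def)
    ultimately show "Z m \<in> borel_measurable Q"
      unfolding Z_def by (intro borel_measurable_diff)
  qed
  show "\<And>m. m \<in> {1..M} \<Longrightarrow> Z m \<in> borel_measurable Q"
    by (rule Z_meas)
  let ?r = "\<lambda>n. 2 * (\<Sum>m=1..M. ennreal (\<sigma>\<^sup>2) * (2 * a m n + 2 * ?A)) + 2 * (ennreal (real M) * (\<Sum>m=1..M. ?D m n))"
  have bound: "(\<integral>\<^sup>+\<omega>. ennreal ((\<Sum>m=1..M. Z m \<omega>)\<^sup>2) \<partial>Q) \<le> ?r n" for n
  proof -
    have ind: "Q.indep_vars (\<lambda>_. borel) (\<lambda>m. Y m n) {1..M}"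
      using Y(1) by (rule indep_functions)
    have pt: "ennreal ((\<Sum>m=1..M. Z m \<omega>)\<^sup>2) \<le> 2 * ennreal ((\<Sum>m=1..M. Y m n \<omega>)\<^sup>2)
        + 2 * (ennreal (real M) * (\<Sum>m=1..M. ennreal ((Z m \<omega> - Y m n \<omega>)\<^sup>2)))" for \<omega>
    proof -
      \<comment> \<open>The factor \<open>M\<close> lost here is harmless: it multiplies
        approximation errors that vanish as \<open>n\<close> grows, whereas the main term is treated
        by independence.\<close>
      have "(\<Sum>m=1..M. (Z m \<omega> - Y m n \<omega>) * 1)\<^sup>2 \<le> (\<Sum>m=1..M. (Z m \<omega> - Y m n \<omega>)\<^sup>2) * (\<Sum>m=1..M. 1\<^sup>2)"
        by (rule Cauchy_Schwarz_ineq_sum)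
      then have "ennreal ((\<Sum>m=1..M. Z m \<omega> - Y m n \<omega>)\<^sup>2) \<le> ennreal (real M * (\<Sum>m=1..M. (Z m \<omega> - Y m n \<omega>)\<^sup>2))"
        by (intro ennreal_leI) (simp add: mult.commute)
      also have "\<dots> = ennreal (real M) * (\<Sum>m=1..M. ennreal ((Z m \<omega> - Y m n \<omega>)\<^sup>2))"
        by (simp add: ennreal_mult sum_nonneg sum_ennreal)
      finally have le: "ennreal ((\<Sum>m=1..M. Z m \<omega> - Y m n \<omega>)\<^sup>2) \<le> ennreal (real M) * (\<Sum>m=1..M. ennreal ((Z m \<omega> - Y m n \<omega>)\<^sup>2))" .
      have "(\<Sum>m=1..M. Z m \<omega>) = (\<Sum>m=1..M. Y m n \<omega>) + (\<Sum>m=1..M. Z m \<omega> - Y m n \<omega>)"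
        by (simp add: sum_subtractf)
      then have "ennreal ((\<Sum>m=1..M. Z m \<omega>)\<^sup>2) \<le> 2 * ennreal ((\<Sum>m=1..M. Y m n \<omega>)\<^sup>2) + 2 * ennreal ((\<Sum>m=1..M. Z m \<omega> - Y m n \<omega>)\<^sup>2)"
        by (simp only: ennreal_sq_add_le)
      also have "\<dots> \<le> 2 * ennreal ((\<Sum>m=1..M. Y m n \<omega>)\<^sup>2)
        + 2 * (ennreal (real M) * (\<Sum>m=1..M. ennreal ((Z m \<omega> - Y m n \<omega>)\<^sup>2)))"
        by (intro add_left_mono mult_left_mono le) simp
      finally show ?thesis .
    qed
    have m1: "(\<lambda>\<omega>. ennreal ((\<Sum>m=1..M. Y m n \<omega>)\<^sup>2)) \<in> borel_measurable Q"
      using Y_meas by (intro measurable_compose[OF _ measurable_ennreal] borel_measurable_power borel_measurable_sum)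
    have m2: "(\<lambda>\<omega>. ennreal ((Z m \<omega> - Y m n \<omega>)\<^sup>2)) \<in> borel_measurable Q" if "m \<in> {1..M}" for m
      using Y_meas[OF that] Z_meas[OF that] by (intro measurable_compose[OF _ measurable_ennreal] borel_measurable_power borel_measurable_diff)
    have m3: "(\<lambda>\<omega>. \<Sum>m=1..M. ennreal ((Z m \<omega> - Y m n \<omega>)\<^sup>2)) \<in> borel_measurable Q"
      using m2 by (rule borel_measurable_sum)
    have "(\<integral>\<^sup>+\<omega>. ennreal ((\<Sum>m=1..M. Z m \<omega>)\<^sup>2) \<partial>Q)
        \<le> (\<integral>\<^sup>+\<omega>. 2 * ennreal ((\<Sum>m=1..M. Y m n \<omega>)\<^sup>2)
          + 2 * (ennreal (real M) * (\<Sum>m=1..M. ennreal ((Z m \<omega> - Y m n \<omega>)\<^sup>2))) \<partial>Q)"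
      by (intro nn_integral_mono pt)
    also have "\<dots> = 2 * (\<integral>\<^sup>+\<omega>. ennreal ((\<Sum>m=1..M. Y m n \<omega>)\<^sup>2) \<partial>Q) + 2 * (ennreal (real M) * (\<Sum>m=1..M. ?D m n))"
    proof -
      have "(\<integral>\<^sup>+\<omega>. (\<Sum>m=1..M. ennreal ((Z m \<omega> - Y m n \<omega>)\<^sup>2)) \<partial>Q) = (\<Sum>m=1..M. ?D m n)"
        by (rule nn_integral_sum) (rule m2)
      with m1 m3 show ?thesis
        by (simp add: nn_integral_add nn_integral_cmult del: sum_ennreal)
    qed
    also have "(\<integral>\<^sup>+\<omega>. ennreal ((\<Sum>m=1..M. Y m n \<omega>)\<^sup>2) \<partial>Q) = ennreal (\<Sum>m=1..M. Q.expectation (\<lambda>\<omega>. (Y m n \<omega>)\<^sup>2))"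
      using Q.sum_indep_second_moment[OF ind _ Y(2) Y(3)] by (subst nn_integral_eq_integral) auto
    also have "\<dots> = (\<Sum>m=1..M. ennreal (Q.expectation (\<lambda>\<omega>. (Y m n \<omega>)\<^sup>2)))"
      by (intro sum_ennreal[symmetric] integral_nonneg_AE) auto
    also have "2 * (\<Sum>m=1..M. ennreal (Q.expectation (\<lambda>\<omega>. (Y m n \<omega>)\<^sup>2))) + 2 * (ennreal (real M) * (\<Sum>m=1..M. ?D m n)) \<le> ?r n"
      using Y(4) by (intro add_right_mono mult_left_mono sum_mono) auto
    finally show ?thesis .
  qed
  have "?r \<longlonglongrightarrow> 2 * (\<Sum>m=1..M. ennreal (\<sigma>\<^sup>2) * (2 * 0 + 2 * ?A)) + 2 * (ennreal (real M) * (\<Sum>m=1..M. 0))"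
    using Y(5,6) by (intro tendsto_add ennreal_tendsto_cmult tendsto_sum tendsto_const) auto
  then have "(\<integral>\<^sup>+\<omega>. ennreal ((\<Sum>m=1..M. Z m \<omega>)\<^sup>2) \<partial>Q)
      \<le> 2 * (\<Sum>m=1..M. ennreal (\<sigma>\<^sup>2) * (2 * 0 + 2 * ?A)) + 2 * (ennreal (real M) * (\<Sum>m=1..M. 0))"
    using bound by (intro LIMSEQ_le_const) auto
  also have "\<dots> = ennreal (4 * \<sigma>\<^sup>2 * real M * P.expectation (P.qf h h))"
  proof -
    have e: "0 \<le> P.expectation (P.qf h h)"
      by (rule semi_inner.ip_nonneg[OF P.semi_inner_expectation_qf h])
    have "2 * (\<Sum>m=1..M. ennreal (\<sigma>\<^sup>2) * (2 * 0 + 2 * ?A)) = ennreal 2 * (ennreal (real M) * (ennreal (\<sigma>\<^sup>2) * (ennreal 2 * ?A)))"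
      by (simp add: ennreal_of_nat_eq_real_of_nat)
    also have "\<dots> = ennreal (2 * (real M * (\<sigma>\<^sup>2 * (2 * P.expectation (P.qf h h)))))"
      using e by (simp only: ennreal_mult mult_nonneg_nonneg zero_le_power2 of_nat_0_le_iff zero_le_numeral)
    finally show ?thesis
      by (simp add: mult_ac)
  qed
  finally show "(\<integral>\<^sup>+\<omega>. ennreal ((\<Sum>m=1..M. Z m \<omega>)\<^sup>2) \<partial>Q) \<le> ennreal (4 * \<sigma>\<^sup>2 * real M * P.expectation (P.qf h h))" .
qed

end

section \<open>Least squares over a bounded part of a finite-dimensional space\<close>

text \<open>Of the minimality of the estimator only the comparison with one deterministic competitor
  \<open>\<psi>\<close> is kept; it will be an approximant of the true kernel that obeys the bound
  \<open>S0\<close>.\<close>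

locale learning = sample P N d \<sigma> T R S \<phi> \<mu>0 B X Q Bs Xs M
  for P :: "'w measure" and N d :: nat and \<sigma> T R S :: real and \<phi> :: "real \<Rightarrow> real"
    and \<mu>0 :: "(nat \<times> nat \<Rightarrow> real) measure" and B X :: "real \<Rightarrow> 'w \<Rightarrow> config" and Q :: "'v measure"
    and Bs Xs :: "nat \<Rightarrow> real \<Rightarrow> 'v \<Rightarrow> config" and M :: nat +
  fixes V :: "(real \<Rightarrow> real) set" and basis :: "(real \<Rightarrow> real) set" and S0 :: real
    and J :: "nat \<Rightarrow> (real \<Rightarrow> real) \<Rightarrow> 'v \<Rightarrow> real" and est :: "'v \<Rightarrow> real \<Rightarrow> real" and \<psi> :: "real \<Rightarrow> real"
  assumes \<sigma>: "\<sigma> > 0" and S0: "S0 > 0"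
    and V: "V = funs.span basis" "finite basis" "V \<subseteq> kernels R"
    and J: "linear_ito_versions N d T Q M Xs V J"
    and est: "AE \<omega> in Q. est \<omega> \<in> V \<and> (\<forall>r. \<bar>est \<omega> r\<bar> \<le> S0) \<and>
      empirical_error N d \<sigma> T M Xs J (est \<omega>) \<omega> \<le> empirical_error N d \<sigma> T M Xs J \<psi> \<omega>"
    and \<psi>: "\<psi> \<in> V" "\<And>r. \<bar>\<psi> r\<bar> \<le> S0"
begin

abbreviation "\<phi>0 \<equiv> truncate R \<phi>"

definition \<kappa> :: real where
  "\<kappa> = 1 / (2 * \<sigma>\<^sup>2 * T * real N)"

text \<open>Normalised by \<open>\<kappa>\<close> so that \<open>ip h h\<close> is exactly the right
  side of the coercivity condition at \<open>h\<close>; \<open>qM\<close> is its empirical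
  counterpart.\<close>

definition ip :: "(real \<Rightarrow> real) \<Rightarrow> (real \<Rightarrow> real) \<Rightarrow> real" where
  "ip h g = \<kappa> * P.expectation (P.qf h g)"

definition qM :: "'v \<Rightarrow> (real \<Rightarrow> real) \<Rightarrow> (real \<Rightarrow> real) \<Rightarrow> real" where
  "qM \<omega> h g = \<kappa> / real M * (\<Sum>m=1..M. q m h g \<omega>)"

text \<open>The average over the sample of the integral of the drift of \<open>h\<close> against the
  noise: the integral against \<open>X\<close>, minus its drift part, which is the form
  \<open>q m\<close> evaluated at \<open>h\<close> and the true kernel.\<close>

definition W :: "(real \<Rightarrow> real) \<Rightarrow> 'v \<Rightarrow> real" where
  "W h \<omega> = \<kappa> / real M * (\<Sum>m=1..M. J m h \<omega> - q m h \<phi>0 \<omega>)"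

lemma \<kappa>_pos: "\<kappa> > 0"
  using \<sigma> P.T P.N by (simp add: \<kappa>_def)

lemma M_pos: "real M > 0"
  using M by simp

lemma \<phi>0: "\<phi>0 \<in> kernels R"
  by (rule truncate_admissible(1)[OF P.adm P.R])

lemma semi_inner_q: "m \<in> {1..M} \<Longrightarrow> \<omega> \<in> space Q \<Longrightarrow> semi_inner (kernels R) (\<lambda>h g. q m h g \<omega>)"
  unfolding q_def using observation.semi_inner_qf[OF observation_copy] .

lemma semi_inner_qM: "\<omega> \<in> space Q \<Longrightarrow> semi_inner (kernels R) (qM \<omega>)"
  unfolding qM_def[abs_def] using \<kappa>_pos M_pos M
  by (intro semi_inner_scale semi_inner_sum semi_inner_q) auto

sublocale ip: semi_inner "kernels R" ip
  unfolding ip_def[abs_def] using \<kappa>_pos by (intro semi_inner_scale P.semi_inner_expectation_qf) auto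

lemma V_lincomb: "f \<in> V \<Longrightarrow> g \<in> V \<Longrightarrow> (\<lambda>r. a * f r + b * g r) \<in> V"
  unfolding V(1) using funs.span_add[OF funs.span_scale funs.span_scale] by (simp add: plus_fun_def)

lemma V_diff: "f \<in> V \<Longrightarrow> g \<in> V \<Longrightarrow> (\<lambda>r. f r - g r) \<in> V"
  using V_lincomb[of f g 1 "-1"] by simp

lemma V_zero: "(\<lambda>r. 0) \<in> V"
  unfolding V(1) using funs.span_zero[of basis] by (simp add: zero_fun_def)

lemma V_kernels: "h \<in> V \<Longrightarrow> h \<in> kernels R"
  using V(3) by blast

lemma q_integrable:
  assumes "m \<in> {1..M}" "h \<in> kernels R" "g \<in> kernels R"
  shows "integrable Q (q m h g)"
  unfolding q_def using observation.qf_integrable_P[OF observation_copy[OF assms(1)] assms(2,3)] .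

lemma qM_expectation:
  assumes "h \<in> kernels R" "g \<in> kernels R"
  shows "integrable Q (\<lambda>\<omega>. qM \<omega> h g)" "Q.expectation (\<lambda>\<omega>. qM \<omega> h g) = ip h g"
proof -
  have int: "integrable Q (\<lambda>\<omega>. \<Sum>m=1..M. q m h g \<omega>)"
    by (intro Bochner_Integration.integrable_sum q_integrable assms)
  then show "integrable Q (\<lambda>\<omega>. qM \<omega> h g)"
    unfolding qM_def by (rule integrable_mult_right)
  have "Q.expectation (\<lambda>\<omega>. \<Sum>m=1..M. q m h g \<omega>) = (\<Sum>m=1..M. Q.expectation (q m h g))"
    by (intro Bochner_Integration.integral_sum q_integrable assms)
  also have "\<dots> = (\<Sum>m=1..M. P.expectation (P.qf h g))"
    by (intro sum.cong refl q_expectation assms)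
  finally show "Q.expectation (\<lambda>\<omega>. qM \<omega> h g) = ip h g"
    using int M_pos by (simp add: qM_def ip_def)
qed

lemma empirical_error_eq:
  "empirical_error N d \<sigma> T M Xs J h \<omega> = qM \<omega> h h - 2 * (\<kappa> / real M * (\<Sum>m=1..M. J m h \<omega>))"
proof -
  have q: "q m h h \<omega> = (LINT t|time_interval T. inner_cfg N d (drift N d h (Xs m t \<omega>)) (drift N d h (Xs m t \<omega>)))" if "m \<in> {1..M}" for m
    unfolding q_def observation.qf_def[OF observation_copy[OF that]] ..
  have "empirical_error N d \<sigma> T M Xs J h \<omega> = (1 / real M) * (\<Sum>m=1..M. \<kappa> * (q m h h \<omega> - 2 * J m h \<omega>))"
    unfolding empirical_error_def path_error_def \<kappa>_def set_integral_time_interval norm_cfg_sq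
    using q by (intro arg_cong2[where f = "(*)"] sum.cong refl) simp
  then show ?thesis
    by (simp add: qM_def sum_distrib_left sum_subtractf right_diff_distrib mult_ac)
qed

text \<open>The kernel to be inserted is the random \<open>est \<omega>\<close>, so linearity has to
  hold for all elements of \<open>V\<close> outside one common null set.\<close>

definition J_linear :: "'v \<Rightarrow> bool" where
  "J_linear \<omega> \<longleftrightarrow> (\<forall>m\<in>{1..M}. \<forall>f\<in>V. \<forall>g\<in>V. \<forall>a b. J m (\<lambda>r. a * f r + b * g r) \<omega> = a * J m f \<omega> + b * J m g \<omega>)"

lemma AE_J_linear: "AE \<omega> in Q. J_linear \<omega>"
  unfolding J_linear_def
proof (rule AE_finite_allI)
  fix m assume "m \<in> {1..M}"
  then show "AE \<omega> in Q. \<forall>f\<in>V. \<forall>g\<in>V. \<forall>a b. J m (\<lambda>r. a * f r + b * g r) \<omega> = a * J m f \<omega> + b * J m g \<omega>"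
    using J unfolding linear_ito_versions_def by blast
qed simp

lemma W_lincomb:
  assumes "J_linear \<omega>" "\<omega> \<in> space Q" "f \<in> V" "g \<in> V"
  shows "W (\<lambda>r. a * f r + b * g r) \<omega> = a * W f \<omega> + b * W g \<omega>"
proof -
  have "J m (\<lambda>r. a * f r + b * g r) \<omega> - q m (\<lambda>r. a * f r + b * g r) \<phi>0 \<omega>
      = a * (J m f \<omega> - q m f \<phi>0 \<omega>) + b * (J m g \<omega> - q m g \<phi>0 \<omega>)" if m: "m \<in> {1..M}" for m
    using assms m semi_inner.ip_lincomb[OF semi_inner_q[OF m assms(2)] V_kernels V_kernels \<phi>0]
    by (simp add: J_linear_def algebra_simps)
  then have "(\<Sum>m=1..M. J m (\<lambda>r. a * f r + b * g r) \<omega> - q m (\<lambda>r. a * f r + b * g r) \<phi>0 \<omega>)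
      = (\<Sum>m=1..M. a * (J m f \<omega> - q m f \<phi>0 \<omega>) + b * (J m g \<omega> - q m g \<phi>0 \<omega>))"
    by (intro sum.cong refl)
  then show ?thesis
    by (simp add: W_def sum.distrib sum_distrib_left[symmetric] distrib_left mult.left_commute)
qed

lemma W_sum:
  fixes D :: nat
  assumes "J_linear \<omega>" "\<omega> \<in> space Q" "\<And>k. k < D \<Longrightarrow> e k \<in> V"
  shows "(\<lambda>r. \<Sum>k<D. c k * e k r) \<in> V \<and> W (\<lambda>r. \<Sum>k<D. c k * e k r) \<omega> = (\<Sum>k<D. c k * W (e k) \<omega>)"
  using assms(3)
proof (induction D)
  case 0
  show ?case
    using W_lincomb[OF assms(1,2) V_zero V_zero, of 0 0] V_zero by simp
next
  case (Suc D)
  then have "(\<lambda>r. \<Sum>k<D. c k * e k r) \<in> V" "W (\<lambda>r. \<Sum>k<D. c k * e k r) \<omega> = (\<Sum>k<D. c k * W (e k) \<omega>)" "e D \<in> V"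
    by auto
  then show ?case
    using W_lincomb[OF assms(1,2), of "\<lambda>r. \<Sum>k<D. c k * e k r" "e D" 1 "c D"]
      V_lincomb[of "\<lambda>r. \<Sum>k<D. c k * e k r" "e D" 1 "c D"] by simp
qed

text \<open>One factor \<open>\<kappa>\<close> is absorbed by \<open>ip\<close>; the other one,
  times 4 \<sigma>^2 / M, is 2 / (T N M).\<close>

lemma W_second_moment:
  assumes "h \<in> V"
  shows "W h \<in> borel_measurable Q" "integrable Q (\<lambda>\<omega>. (W h \<omega>)\<^sup>2)"
    "Q.expectation (\<lambda>\<omega>. (W h \<omega>)\<^sup>2) \<le> 2 / (T * real N * real M) * ip h h"
proof -
  let ?Z = "\<lambda>m \<omega>. J m h \<omega> - q m h \<phi>0 \<omega>"
  have ito: "has_ito_integral N d T Q (Xs m) (\<lambda>t \<omega>. drift N d h (Xs m t \<omega>)) (J m h)" if "m \<in> {1..M}" for m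
    using J that assms by (auto simp: linear_ito_versions_def)
  note Z = noise_second_moment[OF V_kernels[OF assms] ito]
  have sum_meas: "(\<lambda>\<omega>. \<Sum>m=1..M. ?Z m \<omega>) \<in> borel_measurable Q"
    using Z(2) by (rule borel_measurable_sum)
  then show W_meas: "W h \<in> borel_measurable Q"
    unfolding W_def[abs_def] by (rule borel_measurable_times[OF borel_measurable_const])
  have e: "0 \<le> P.expectation (P.qf h h)"
    by (rule semi_inner.ip_nonneg[OF P.semi_inner_expectation_qf V_kernels[OF assms]])
  have "(\<integral>\<^sup>+\<omega>. ennreal ((W h \<omega>)\<^sup>2) \<partial>Q) = (\<integral>\<^sup>+\<omega>. ennreal ((\<kappa> / real M)\<^sup>2) * ennreal ((\<Sum>m=1..M. ?Z m \<omega>)\<^sup>2) \<partial>Q)"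
    unfolding W_def power_mult_distrib by (intro nn_integral_cong ennreal_mult) auto
  also have "\<dots> = ennreal ((\<kappa> / real M)\<^sup>2) * (\<integral>\<^sup>+\<omega>. ennreal ((\<Sum>m=1..M. ?Z m \<omega>)\<^sup>2) \<partial>Q)"
    by (rule nn_integral_cmult[OF measurable_compose[OF borel_measurable_power[OF sum_meas] measurable_ennreal]])
  also have "\<dots> \<le> ennreal ((\<kappa> / real M)\<^sup>2) * ennreal (4 * \<sigma>\<^sup>2 * real M * P.expectation (P.qf h h))"
    by (intro mult_left_mono Z(1)) auto
  also have "\<dots> = ennreal (2 / (T * real N * real M) * ip h h)"
  proof -
    have "(\<kappa> / real M)\<^sup>2 * (4 * \<sigma>\<^sup>2 * real M * P.expectation (P.qf h h)) = 2 / (T * real N * real M) * ip h h"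
      using \<sigma> P.T P.N M_pos by (simp add: ip_def \<kappa>_def power2_eq_square field_simps)
    then show ?thesis
      by (simp add: ennreal_mult'[symmetric])
  qed
  finally have nn: "(\<integral>\<^sup>+\<omega>. ennreal ((W h \<omega>)\<^sup>2) \<partial>Q) \<le> ennreal (2 / (T * real N * real M) * ip h h)" .
  then show int: "integrable Q (\<lambda>\<omega>. (W h \<omega>)\<^sup>2)"
    using W_meas by (intro integrableI_nonneg) (auto simp: order.strict_trans1)
  have "ennreal (Q.expectation (\<lambda>\<omega>. (W h \<omega>)\<^sup>2)) \<le> ennreal (2 / (T * real N * real M) * ip h h)"
    using nn nn_integral_eq_integral[OF int] by simp
  then show "Q.expectation (\<lambda>\<omega>. (W h \<omega>)\<^sup>2) \<le> 2 / (T * real N * real M) * ip h h"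
    using P.T ip.ip_nonneg[OF V_kernels[OF assms]] by (subst (asm) ennreal_le_iff) auto
qed

text \<open>Bounds the normalised energy of a kernel of supremum at most \<open>2 * S0\<close>, as
  is the difference of two kernels bounded by \<open>S0\<close>. The factors \<open>T\<close> and
  \<open>N\<close> cancel against \<open>\<kappa>\<close>.\<close>

definition bd :: real where
  "bd = (2 * S0 * R)\<^sup>2 / (2 * \<sigma>\<^sup>2)"

lemma bd_pos: "bd > 0"
  using S0 P.R \<sigma> by (simp add: bd_def)

definition ball :: "(real \<Rightarrow> real) set" where
  "ball = {g \<in> V. \<forall>r. \<bar>g r\<bar> \<le> 2 * S0}"

lemma \<kappa>_bd: "\<kappa> * (T * (real N * (2 * S0 * R)\<^sup>2)) = bd"
  using P.T P.N \<sigma> by (simp add: \<kappa>_def bd_def field_simps)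

lemma q_ball:
  assumes "g \<in> ball" "m \<in> {1..M}" "\<omega> \<in> space Q"
  shows "0 \<le> \<kappa> * q m g g \<omega>" "\<kappa> * q m g g \<omega> \<le> bd"
proof -
  interpret m: observation Q N d \<sigma> T R S \<phi> \<mu>0 "Bs m" "Xs m"
    by (rule observation_copy[OF assms(2)])
  have g: "g \<in> kernels R" "\<And>r. \<bar>g r\<bar> \<le> 2 * S0"
    using assms(1) V_kernels by (auto simp: ball_def)
  show "0 \<le> \<kappa> * q m g g \<omega>"
    using \<kappa>_pos semi_inner.ip_nonneg[OF semi_inner_q[OF assms(2,3)] g(1)] by simp
  show "\<kappa> * q m g g \<omega> \<le> bd"
    unfolding \<kappa>_bd[symmetric] q_def using \<kappa>_pos m.qf_bound[OF g assms(3)] by (intro mult_left_mono) auto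
qed

lemma ip_ball:
  assumes "g \<in> ball"
  shows "ip g g \<le> bd"
proof -
  have g: "g \<in> kernels R" "\<And>r. \<bar>g r\<bar> \<le> 2 * S0"
    using assms(1) V_kernels by (auto simp: ball_def)
  have "P.expectation (P.qf g g) \<le> P.expectation (\<lambda>_. T * (real N * (2 * S0 * R)\<^sup>2))"
    using P.qf_bound[OF g] P.qf_integrable_P[OF g(1) g(1)] by (intro integral_mono) auto
  then show ?thesis
    unfolding ip_def \<kappa>_bd[symmetric] using \<kappa>_pos by (intro mult_left_mono) (auto simp: P.prob_space)
qed

lemma exp_deviation:
  assumes "g \<in> ball"
  shows "integrable Q (\<lambda>\<omega>. exp (real M * (ip g g / 2 - qM \<omega> g g) / bd))"
    and "Q.expectation (\<lambda>\<omega>. exp (real M * (ip g g / 2 - qM \<omega> g g) / bd)) \<le> 1"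
proof -
  have g: "g \<in> kernels R"
    using assms(1) V_kernels by (auto simp: ball_def)
  have ind: "Q.indep_vars (\<lambda>_. borel) (\<lambda>m \<omega>. \<kappa> * q m g g \<omega>) {1..M}"
    unfolding q_def using observation.qf_measurable[OF observation_copy g g]
    by (intro indep_functions borel_measurable_times[OF borel_measurable_const])
  have mean: "Q.expectation (\<lambda>\<omega>. \<kappa> * q m g g \<omega>) = ip g g" if "m \<in> {1..M}" for m
    using q_expectation[OF that g g] by (simp add: ip_def)
  have eq: "(\<Sum>m=1..M. (ip g g / 2 - \<kappa> * q m g g \<omega>) / bd) = real M * (ip g g / 2 - qM \<omega> g g) / bd" for \<omega>
    using M_pos by (simp add: qM_def sum_divide_distrib[symmetric] sum_subtractf sum_distrib_left[symmetric] right_diff_distrib)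
  show "integrable Q (\<lambda>\<omega>. exp (real M * (ip g g / 2 - qM \<omega> g g) / bd))"
    "Q.expectation (\<lambda>\<omega>. exp (real M * (ip g g / 2 - qM \<omega> g g) / bd)) \<le> 1"
    using Q.exp_half_mean_minus_sum_le[OF ind _ bd_pos _ mean] q_ball[OF assms] unfolding eq by auto
qed

text \<open>Completing the square turns the empirical error of \<open>h\<close> into the energy of
  \<open>h - \<phi>0\<close> minus \<open>2 W h\<close>, up to a term free of \<open>h\<close>.
  Passing from \<open>f - \<phi>0\<close> to \<open>f - \<psi>\<close> by the parallelogram bound
  doubles everything and produces the factors 4.\<close>

lemma basic_inequality:
  assumes "J_linear \<omega>" "\<omega> \<in> space Q" "f \<in> V"
    and "empirical_error N d \<sigma> T M Xs J f \<omega> \<le> empirical_error N d \<sigma> T M Xs J \<psi> \<omega>"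
  shows "qM \<omega> (\<lambda>r. f r - \<psi> r) (\<lambda>r. f r - \<psi> r)
    \<le> 4 * qM \<omega> (\<lambda>r. \<psi> r - \<phi>0 r) (\<lambda>r. \<psi> r - \<phi>0 r) + 4 * W (\<lambda>r. f r - \<psi> r) \<omega>"
proof -
  interpret q: semi_inner "kernels R" "qM \<omega>"
    by (rule semi_inner_qM[OF assms(2)])
  have k: "f \<in> kernels R" "\<psi> \<in> kernels R"
    using assms(3) \<psi>(1) V_kernels by auto
  have err: "empirical_error N d \<sigma> T M Xs J h \<omega> = qM \<omega> (\<lambda>r. h r - \<phi>0 r) (\<lambda>r. h r - \<phi>0 r) - qM \<omega> \<phi>0 \<phi>0 - 2 * W h \<omega>"
    if "h \<in> kernels R" for h
  proof -
    have "qM \<omega> (\<lambda>r. h r - \<phi>0 r) (\<lambda>r. h r - \<phi>0 r) = qM \<omega> h h - 2 * qM \<omega> h \<phi>0 + qM \<omega> \<phi>0 \<phi>0"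
      using q.ip_square[OF that \<phi>0, of 1 "-1"] by simp
    moreover have "W h \<omega> = \<kappa> / real M * (\<Sum>m=1..M. J m h \<omega>) - qM \<omega> h \<phi>0"
      by (simp add: W_def qM_def sum_subtractf right_diff_distrib)
    ultimately show ?thesis
      by (simp add: empirical_error_eq)
  qed
  have "W (\<lambda>r. f r - \<psi> r) \<omega> = W f \<omega> - W \<psi> \<omega>"
    using W_lincomb[OF assms(1,2,3) \<psi>(1), of 1 "-1"] by simp
  then have "qM \<omega> (\<lambda>r. f r - \<phi>0 r) (\<lambda>r. f r - \<phi>0 r)
      \<le> qM \<omega> (\<lambda>r. \<psi> r - \<phi>0 r) (\<lambda>r. \<psi> r - \<phi>0 r) + 2 * W (\<lambda>r. f r - \<psi> r) \<omega>"
    using assms(4) err[OF k(1)] err[OF k(2)] by simp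
  moreover have "qM \<omega> (\<lambda>r. f r - \<psi> r) (\<lambda>r. f r - \<psi> r)
      \<le> 2 * qM \<omega> (\<lambda>r. f r - \<phi>0 r) (\<lambda>r. f r - \<phi>0 r) + 2 * qM \<omega> (\<lambda>r. \<psi> r - \<phi>0 r) (\<lambda>r. \<psi> r - \<phi>0 r)"
    using q.ip_diff_le[OF kernels_diff[OF k(1) \<phi>0] kernels_diff[OF k(2) \<phi>0]] by simp
  ultimately show ?thesis
    by linarith
qed

text \<open>Elements of the ball are discretised through their coordinates in an orthonormal basis for the population
  form; the empirical form of the rounding error is controlled by the trace of its Gram matrix, so no
  uniform norm enters. The maximum over the net is bounded through \<open>x \<le> ln A + exp x / A\<close>.\<close>

theorem excess_risk:
  assumes L: "sqrt bd * real M \<le> real L"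
  defines "D \<equiv> card basis"
  shows "\<exists>U. integrable Q U \<and> (AE \<omega> in Q. ip (\<lambda>r. est \<omega> r - \<psi> r) (\<lambda>r. est \<omega> r - \<psi> r) \<le> U \<omega>) \<and>
    Q.expectation U \<le> 64 * ip (\<lambda>r. \<psi> r - \<phi>0 r) (\<lambda>r. \<psi> r - \<phi>0 r) + 2048 * real D / (T * real N * real M)
      + 16 * (real D / real M)\<^sup>2 + 8 * (bd / real M * (real D * ln (2 * real L + 1) + 1)) + 4 * real D / (real M)\<^sup>2"
proof -
  obtain e where e: "ip.orthobasis V D e"
    using ip.Gram_Schmidt[OF V(2)] V(1,3) unfolding D_def by blast
  have eV: "\<And>k. k < D \<Longrightarrow> e k \<in> V" and e01: "\<And>k. k < D \<Longrightarrow> ip (e k) (e k) \<in> {0, 1}"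
    and repr: "\<And>h. h \<in> V \<Longrightarrow> \<exists>c. h = (\<lambda>r. \<Sum>k<D. c k * e k r)"
    using e by (auto simp: ip.orthobasis_def)
  have eK: "\<And>k. k < D \<Longrightarrow> e k \<in> kernels R"
    using eV V_kernels by blast
  \<comment> \<open>Coordinates rounded down to multiples of \<open>1 / M\<close>. The restriction
    to \<open>{..<D}\<close> makes the labels elements of a finite product.\<close>
  define z where "z g = (\<lambda>k\<in>{..<D}. \<lfloor>ip g (e k) * real M\<rfloor>)" for g
  define Net where "Net = z ` ball"
  \<comment> \<open>The cell is represented by one of its own elements in \<open>ball\<close>, and
    not by the rounded coordinates: these might define a kernel that violates the bound
    \<open>2 * S0\<close>, to which the deviation inequality would not apply.\<close>
  define rep where "rep = inv_into ball z"
  have rep: "rep (z g) \<in> ball" "z (rep (z g)) = z g" if "g \<in> ball" for g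
    unfolding rep_def using that by (auto intro!: inv_into_into f_inv_into_f[of "z g" z ball])
  have Net_sub: "Net \<subseteq> PiE {..<D} (\<lambda>_. {- int L..int L})"
  proof
    fix \<zeta> assume "\<zeta> \<in> Net"
    then obtain g where g: "g \<in> ball" "\<zeta> = z g"
      by (auto simp: Net_def)
    have "\<lfloor>ip g (e k) * real M\<rfloor> \<in> {- int L..int L}" if k: "k < D" for k
    proof -
      have gK: "g \<in> kernels R"
        using g V_kernels by (auto simp: ball_def)
      have "(ip g (e k))\<^sup>2 \<le> ip g g * ip (e k) (e k)"
        by (rule ip.Cauchy_Schwarz[OF gK eK[OF k]])
      also have "\<dots> \<le> bd * 1"
        using e01[OF k] ip_ball[OF g(1)] bd_pos ip.ip_nonneg[OF gK] by (intro mult_mono) auto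
      finally have "\<bar>ip g (e k)\<bar> \<le> sqrt bd"
        by (simp add: real_le_rsqrt)
      then have "\<bar>ip g (e k)\<bar> * real M \<le> sqrt bd * real M"
        by (rule mult_right_mono) simp
      then have "\<bar>ip g (e k) * real M\<bar> \<le> real L"
        using L by (simp add: abs_mult)
      then have "- real L \<le> ip g (e k) * real M" "ip g (e k) * real M \<le> real L"
        by auto
      then show ?thesis
        by (auto simp: le_floor_iff floor_le_iff)
    qed
    then show "\<zeta> \<in> PiE {..<D} (\<lambda>_. {- int L..int L})"
      unfolding g(2) z_def by auto
  qed
  have finPi: "finite (PiE {..<D} (\<lambda>_. {- int L..int L}))"
    by (intro finite_PiE) auto
  then have fin: "finite Net"
    using Net_sub by (rule finite_subset[rotated])
  define A where "A = (2 * real L + 1) ^ D"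
  have A: "A > 0" "real (card Net) \<le> A"
  proof -
    show "A > 0"
      by (simp add: A_def)
    have "card Net \<le> card (PiE {..<D} (\<lambda>_. {- int L..int L}))"
      by (rule card_mono[OF finPi Net_sub])
    also have "\<dots> = nat (int L - - int L + 1) ^ D"
      by (simp add: card_PiE)
    finally have "real (card Net) \<le> real (nat (2 * int L + 1) ^ D)"
      by (simp only: of_nat_le_iff) simp
    also have "\<dots> = A"
      by (simp add: A_def nat_add_distrib nat_mult_distrib add.commute)
    finally show "real (card Net) \<le> A" .
  qed
  define E where "E \<zeta> \<omega> = exp (real M * (ip (rep \<zeta>) (rep \<zeta>) / 2 - qM \<omega> (rep \<zeta>) (rep \<zeta>)) / bd)" for \<zeta> \<omega>
  \<comment> \<open>A bound for the deviation at all points of the net at once. Its mean is under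
    control because the exponential moments, each at most 1, are averaged over at most
    \<open>A\<close> points.\<close>
  define \<Xi> where "\<Xi> \<omega> = bd / real M * (ln A + 1 / A * (\<Sum>\<zeta>\<in>Net. E \<zeta> \<omega>))" for \<omega>
  have E_int: "integrable Q (E \<zeta>)" and E_le: "Q.expectation (E \<zeta>) \<le> 1" if "\<zeta> \<in> Net" for \<zeta>
  proof -
    have "rep \<zeta> \<in> ball"
      using that rep(1) by (auto simp: Net_def)
    from exp_deviation[OF this] show "integrable Q (E \<zeta>)" "Q.expectation (E \<zeta>) \<le> 1"
      by (auto simp: E_def[abs_def])
  qed
  have \<Xi>: "ip (rep \<zeta>) (rep \<zeta>) / 2 - qM \<omega> (rep \<zeta>) (rep \<zeta>) \<le> \<Xi> \<omega>" if "\<zeta> \<in> Net" for \<zeta> \<omega>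
  proof -
    let ?x = "real M * (ip (rep \<zeta>) (rep \<zeta>) / 2 - qM \<omega> (rep \<zeta>) (rep \<zeta>)) / bd"
    have "1 + (?x - ln A) \<le> exp (?x - ln A)"
      by (rule exp_ge_add_one_self)
    also have "\<dots> = 1 / A * E \<zeta> \<omega>"
      using A(1) by (simp add: exp_diff E_def)
    also have "\<dots> \<le> 1 / A * (\<Sum>\<zeta>\<in>Net. E \<zeta> \<omega>)"
      using A(1) that fin by (intro mult_left_mono member_le_sum) (auto simp: E_def)
    finally have "?x \<le> ln A + 1 / A * (\<Sum>\<zeta>\<in>Net. E \<zeta> \<omega>)"
      by linarith
    then have "bd / real M * ?x \<le> \<Xi> \<omega>"
      unfolding \<Xi>_def using bd_pos M_pos by (intro mult_left_mono) auto
    then show ?thesis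
      using bd_pos M_pos by simp
  qed
  have \<Xi>_int: "integrable Q \<Xi>"
    unfolding \<Xi>_def[abs_def] using E_int by auto
  have \<Xi>_exp: "Q.expectation \<Xi> \<le> bd / real M * (real D * ln (2 * real L + 1) + 1)"
  proof -
    have "Q.expectation \<Xi> = bd / real M * (ln A + 1 / A * (\<Sum>\<zeta>\<in>Net. Q.expectation (E \<zeta>)))"
      unfolding \<Xi>_def[abs_def] using E_int by (simp add: Q.prob_space)
    also have "\<dots> \<le> bd / real M * (ln A + 1)"
    proof -
      have "(\<Sum>\<zeta>\<in>Net. Q.expectation (E \<zeta>)) \<le> (\<Sum>\<zeta>\<in>Net. 1)"
        by (intro sum_mono E_le)
      also have "\<dots> \<le> A"
        using A(2) by simp
      finally have "1 / A * (\<Sum>\<zeta>\<in>Net. Q.expectation (E \<zeta>)) \<le> 1"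
        using A(1) by simp
      then show ?thesis
        using bd_pos M_pos by (intro mult_left_mono) auto
    qed
    also have "ln A = real D * ln (2 * real L + 1)"
      by (simp add: A_def ln_realpow)
    finally show ?thesis .
  qed
  let ?\<delta> = "\<lambda>\<omega>. qM \<omega> (\<lambda>r. \<psi> r - \<phi>0 r) (\<lambda>r. \<psi> r - \<phi>0 r)"
  have dK: "(\<lambda>r. \<psi> r - \<phi>0 r) \<in> kernels R"
    using \<psi>(1) V_kernels \<phi>0 by (intro kernels_diff) auto
  define \<gamma> where "\<gamma> = real D / (real M)\<^sup>2"
  define w where "w \<omega> = (\<Sum>k<D. (W (e k) \<omega>)\<^sup>2)" for \<omega>
  define t where "t \<omega> = (\<Sum>k<D. qM \<omega> (e k) (e k))" for \<omega>
  have w: "integrable Q w" "Q.expectation w = (\<Sum>k<D. Q.expectation (\<lambda>\<omega>. (W (e k) \<omega>)\<^sup>2))"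
    unfolding w_def[abs_def] using W_second_moment(2)[OF eV] by auto
  have t: "integrable Q t" "Q.expectation t = (\<Sum>k<D. ip (e k) (e k))"
    unfolding t_def[abs_def] using qM_expectation[OF eK eK] by auto
  \<comment> \<open>Write g for \<open>est \<omega> - \<psi>\<close>. Going from g to its net point,
    to the empirical form and back gives ip g g \<le> 32 \<delta> + 32 W g + 8 \<gamma> t + 4 \<Xi>
    + 2 \<gamma>. The share ip g g / 64 in the bound of W g then contributes half of the left side;
    absorbing it doubles all other coefficients.\<close>
  define U where "U \<omega> = 64 * ?\<delta> \<omega> + 1024 * w \<omega> + 16 * \<gamma> * t \<omega> + 8 * \<Xi> \<omega> + 4 * \<gamma>" for \<omega>
  have U_int: "integrable Q U"
    unfolding U_def[abs_def] using qM_expectation(1)[OF dK dK] w(1) t(1) \<Xi>_int by simp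
  have U_exp: "Q.expectation U \<le> 64 * ip (\<lambda>r. \<psi> r - \<phi>0 r) (\<lambda>r. \<psi> r - \<phi>0 r) + 2048 * real D / (T * real N * real M)
      + 16 * (real D / real M)\<^sup>2 + 8 * (bd / real M * (real D * ln (2 * real L + 1) + 1)) + 4 * real D / (real M)\<^sup>2"
  proof -
    have "Q.expectation U = 64 * ip (\<lambda>r. \<psi> r - \<phi>0 r) (\<lambda>r. \<psi> r - \<phi>0 r)
        + 1024 * (\<Sum>k<D. Q.expectation (\<lambda>\<omega>. (W (e k) \<omega>)\<^sup>2))
        + 16 * \<gamma> * (\<Sum>k<D. ip (e k) (e k)) + 8 * Q.expectation \<Xi> + 4 * \<gamma>"
      unfolding U_def[abs_def] w(2)[symmetric] t(2)[symmetric]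
      using qM_expectation[OF dK dK] w(1) t(1) \<Xi>_int by (simp add: Q.prob_space)
    moreover have "(\<Sum>k<D. Q.expectation (\<lambda>\<omega>. (W (e k) \<omega>)\<^sup>2)) \<le> (\<Sum>k<D. 2 / (T * real N * real M))"
    proof (rule sum_mono)
      fix k assume "k \<in> {..<D}"
      then have k: "k < D"
        by simp
      have "2 / (T * real N * real M) * ip (e k) (e k) \<le> 2 / (T * real N * real M) * 1"
        using e01[OF k] P.T by (intro mult_left_mono) auto
      then show "Q.expectation (\<lambda>\<omega>. (W (e k) \<omega>)\<^sup>2) \<le> 2 / (T * real N * real M)"
        using W_second_moment(3)[OF eV[OF k]] by simp
    qed
    moreover have "16 * \<gamma> * (\<Sum>k<D. ip (e k) (e k)) \<le> 16 * (real D / real M)\<^sup>2"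
    proof -
      have "(\<Sum>k<D. ip (e k) (e k)) \<le> (\<Sum>k<D. 1)"
        using e01 by (intro sum_mono) force
      then have "16 * \<gamma> * (\<Sum>k<D. ip (e k) (e k)) \<le> 16 * \<gamma> * real D"
        by (intro mult_left_mono) (auto simp: \<gamma>_def)
      then show ?thesis
        by (simp add: \<gamma>_def power2_eq_square)
    qed
    moreover have "4 * \<gamma> = 4 * real D / (real M)\<^sup>2" "(\<Sum>k<D. 2 / (T * real N * real M)) = 2 * real D / (T * real N * real M)"
      by (simp_all add: \<gamma>_def)
    ultimately show ?thesis
      using \<Xi>_exp by linarith
  qed
  \<comment> \<open>A nonnegative variable of mean 0 vanishes almost surely; this is applied to the
    empirical form and to the square of \<open>W\<close>. As there are finitely many basis vectors,
    one null set suffices.\<close>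
  have null: "AE \<omega> in Q. \<forall>k\<in>{..<D}. ip (e k) (e k) = 0 \<longrightarrow> qM \<omega> (e k) (e k) = 0 \<and> W (e k) \<omega> = 0"
  proof (rule AE_finite_allI)
    fix k assume "k \<in> {..<D}"
    then have k: "k < D"
      by simp
    show "AE \<omega> in Q. ip (e k) (e k) = 0 \<longrightarrow> qM \<omega> (e k) (e k) = 0 \<and> W (e k) \<omega> = 0"
    proof (cases "ip (e k) (e k) = 0")
      case True
      have "AE \<omega> in Q. qM \<omega> (e k) (e k) = 0"
        using qM_expectation[OF eK[OF k] eK[OF k]] True semi_inner.ip_nonneg[OF semi_inner_qM eK[OF k]]
        by (subst integral_nonneg_eq_0_iff_AE[symmetric]) auto
      moreover have "Q.expectation (\<lambda>\<omega>. (W (e k) \<omega>)\<^sup>2) = 0"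
        using W_second_moment(3)[OF eV[OF k]] True by (intro antisym integral_nonneg_AE) auto
      then have "AE \<omega> in Q. (W (e k) \<omega>)\<^sup>2 = 0"
        using W_second_moment(2)[OF eV[OF k]] by (subst (asm) integral_nonneg_eq_0_iff_AE) auto
      ultimately show ?thesis
        by eventually_elim auto
    qed simp
  qed simp
  have "AE \<omega> in Q. ip (\<lambda>r. est \<omega> r - \<psi> r) (\<lambda>r. est \<omega> r - \<psi> r) \<le> U \<omega>"
    using est AE_J_linear null AE_space
  proof eventually_elim
    case (elim \<omega>)
    interpret q: semi_inner "kernels R" "qM \<omega>"
      by (rule semi_inner_qM[OF elim(4)])
    let ?g = "\<lambda>r. est \<omega> r - \<psi> r"
    have gV: "?g \<in> V"
      using elim(1) \<psi>(1) by (intro V_diff) auto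
    have "\<bar>?g r\<bar> \<le> 2 * S0" for r
    proof -
      have "\<bar>est \<omega> r\<bar> \<le> S0"
        using elim(1) by blast
      then show ?thesis
        using \<psi>(2)[of r] by linarith
    qed
    then have g: "?g \<in> ball"
      using gV by (simp add: ball_def)
    define g' where "g' = rep (z ?g)"
    have g': "g' \<in> ball" "z g' = z ?g" "g' \<in> V"
      using rep[OF g] by (auto simp: g'_def ball_def)
    define f where "f = (\<lambda>r. g' r - ?g r)"
    have fV: "f \<in> V"
      unfolding f_def by (rule V_diff[OF g'(3) gV])
    have K: "?g \<in> kernels R" "g' \<in> kernels R" "f \<in> kernels R"
      using gV g'(3) fV V_kernels by auto
    \<comment> \<open>Two numbers with the same integer part differ by at most 1, so each coordinate
      of the rounding error is at most \<open>1 / M\<close>; this is the origin of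
      \<open>\<gamma>\<close>.\<close>
    have f_le: "ip f f \<le> real D / (real M)\<^sup>2"
    proof -
      have "ip f f = (\<Sum>k<D. (ip f (e k))\<^sup>2)"
        by (rule ip.orthobasis_Parseval[OF e fV])
      also have "\<dots> \<le> (\<Sum>k<D. (1 / real M)\<^sup>2)"
      proof (rule sum_mono)
        fix k assume k: "k \<in> {..<D}"
        have "\<lfloor>ip g' (e k) * real M\<rfloor> = \<lfloor>ip ?g (e k) * real M\<rfloor>"
          using fun_cong[OF g'(2), of k] k by (simp add: z_def)
        then have "\<bar>ip g' (e k) * real M - ip ?g (e k) * real M\<bar> \<le> 1"
          by linarith
        moreover have "ip f (e k) = ip g' (e k) - ip ?g (e k)"
          unfolding f_def using k by (intro ip.ip_diff_left K eK) simp
        ultimately have "\<bar>ip f (e k)\<bar> * real M \<le> 1"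
          by (simp add: left_diff_distrib[symmetric] abs_mult)
        then have "\<bar>ip f (e k)\<bar> \<le> 1 / real M"
          using M_pos by (simp add: field_simps)
        then show "(ip f (e k))\<^sup>2 \<le> (1 / real M)\<^sup>2"
          by (metis abs_ge_zero power2_abs power_mono)
      qed
      also have "\<dots> = real D / (real M)\<^sup>2"
        by (simp add: power_divide)
      finally show ?thesis .
    qed
    have t_nonneg: "0 \<le> (\<Sum>k<D. qM \<omega> (e k) (e k))"
      using eK by (intro sum_nonneg q.ip_nonneg) auto
    have "qM \<omega> f f \<le> ip f f * (\<Sum>k<D. qM \<omega> (e k) (e k))"
      using elim(3) by (intro ip.orthobasis_dominated[OF e fV semi_inner_qM[OF elim(4)]]) auto
    also have "\<dots> \<le> real D / (real M)\<^sup>2 * (\<Sum>k<D. qM \<omega> (e k) (e k))"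
      by (rule mult_right_mono[OF f_le t_nonneg])
    finally have qf: "qM \<omega> f f \<le> real D / (real M)\<^sup>2 * (\<Sum>k<D. qM \<omega> (e k) (e k))" .
    have "(\<lambda>r. g' r - f r) = ?g" "(\<lambda>r. ?g r + f r) = g'"
      by (auto simp: f_def)
    then have p: "ip ?g ?g \<le> 2 * ip g' g' + 2 * ip f f" and x': "qM \<omega> g' g' \<le> 2 * qM \<omega> ?g ?g + 2 * qM \<omega> f f"
      using ip.ip_diff_le[OF K(2,3)] q.ip_add_le[OF K(1,3)] by simp_all
    have dev: "ip g' g' / 2 - qM \<omega> g' g' \<le> \<Xi> \<omega>"
      unfolding g'_def using g by (intro \<Xi>) (auto simp: Net_def)
    have x: "qM \<omega> ?g ?g \<le> 4 * ?\<delta> \<omega> + 4 * W ?g \<omega>"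
      using elim(1) by (intro basic_inequality[OF elim(2,4)]) auto
    \<comment> \<open>Young's inequality x y \<le> x^2 / 64 + 16 y^2 in every coordinate. Along
      vectors of length 0 the coordinate is undetermined, but there \<open>W\<close>
      vanishes.\<close>
    have w_le: "W ?g \<omega> \<le> ip ?g ?g / 64 + 16 * (\<Sum>k<D. (W (e k) \<omega>)\<^sup>2)"
    proof -
      obtain c where c: "?g = (\<lambda>r. \<Sum>k<D. c k * e k r)"
        using repr[OF gV] by blast
      have "W ?g \<omega> = (\<Sum>k<D. c k * W (e k) \<omega>)"
        unfolding c using W_sum[OF elim(2,4), of D e c] eV by blast
      also have "\<dots> = (\<Sum>k<D. ip ?g (e k) * W (e k) \<omega>)"
        using ip.orthobasis_coeff[OF e c] e01 elim(3) by (intro sum.cong refl) force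
      also have "\<dots> \<le> (\<Sum>k<D. (ip ?g (e k))\<^sup>2 / 64 + 16 * (W (e k) \<omega>)\<^sup>2)"
      proof (rule sum_mono)
        fix k
        show "ip ?g (e k) * W (e k) \<omega> \<le> (ip ?g (e k))\<^sup>2 / 64 + 16 * (W (e k) \<omega>)\<^sup>2"
          using zero_le_power2[of "ip ?g (e k) / 8 - 4 * W (e k) \<omega>"]
          by (simp add: power2_diff power_divide power_mult_distrib)
      qed
      also have "\<dots> = ip ?g ?g / 64 + 16 * (\<Sum>k<D. (W (e k) \<omega>)\<^sup>2)"
        by (simp add: ip.orthobasis_Parseval[OF e gV] sum.distrib sum_distrib_left sum_divide_distrib)
      finally show ?thesis .
    qed
    show ?case
      using p x' dev x w_le qf f_le unfolding U_def w_def t_def \<gamma>_def by linarith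
  qed
  with U_int U_exp show ?thesis
    by blast
qed

end

section \<open>The rate of convergence\<close>

lemma C11_ext_kernels: "C11_ext R \<subseteq> kernels R"
proof
  fix h assume "h \<in> C11_ext R"
  then have "continuous_on {0..R} h" and zero: "\<And>r. r \<notin> {0..R} \<Longrightarrow> h r = 0"
    by (auto simp: C11_ext_def C11_in_def C1_in_def intro: differentiable_imp_continuous_on)
  then have "truncate R h \<in> kernels R"
    by (intro truncate_in_kernels)
  moreover have "truncate R h = h"
    using zero by (auto simp: truncate_def fun_eq_iff)
  ultimately show "h \<in> kernels R"
    by simp
qed

lemma kernels_sup_norm_upper:
  assumes "h \<in> kernels R"
  shows "\<bar>h r\<bar> \<le> sup_norm {0..} h"
proof -
  obtain c where c: "\<And>r. \<bar>h r\<bar> \<le> c"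
    using assms by (auto simp: kernels_def)
  then have up: "\<bar>h r\<bar> \<le> sup_norm {0..} h" if "r \<ge> 0" for r
    using that by (intro sup_norm_upper) auto
  show ?thesis
  proof (cases "r \<ge> 0")
    case False
    then have "h r = 0"
      using assms by (auto simp: kernels_def)
    then show ?thesis
      using up[of 0] by simp
  qed (rule up)
qed

text \<open>The infimum need not be attained, hence the strict bound \<open>t\<close>. A
  near-minimiser is bounded by \<open>S + t\<close> only. If \<open>t > c\<close>, it is scaled by l
  = (S + c) / (S + t), which moves it by at most (1 - l) (S + t) = t - c, so the total error stays
  below \<open>2 * t\<close>.\<close>

lemma bounded_approximant:
  assumes V: "funs.subspace V" "V \<subseteq> kernels R" and \<phi>: "\<phi> \<in> admissible R S" and "R > 0" "t > 0" "c > 0"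
    and inf: "(INF \<psi>\<in>V. sup_norm {0..} (\<lambda>r. \<psi> r - \<phi> r)) < t"
  shows "\<exists>\<psi>\<in>V. (\<forall>r. \<bar>\<psi> r\<bar> \<le> S + c) \<and> (\<forall>r. \<bar>\<psi> r - truncate R \<phi> r\<bar> \<le> 2 * t)"
proof -
  note tr = truncate_admissible[OF \<phi> \<open>R > 0\<close>]
  have "V \<noteq> {}"
    using funs.subspace_0[OF V(1)] by blast
  have sup_eq: "sup_norm {0..} (\<lambda>r. \<psi> r - \<phi> r) = sup_norm {0..} (\<lambda>r. \<psi> r - truncate R \<phi> r)" for \<psi>
    unfolding sup_norm_def using tr(2) by (intro SUP_cong) auto
  have diff: "(\<lambda>r. \<psi> r - truncate R \<phi> r) \<in> kernels R" if "\<psi> \<in> V" for \<psi>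
    using that V(2) tr(1) by (intro kernels_diff) auto
  have "bdd_below ((\<lambda>\<psi>. sup_norm {0..} (\<lambda>r. \<psi> r - \<phi> r)) ` V)"
    using kernels_sup_norm_upper[OF diff] unfolding sup_eq
    by (intro bdd_belowI2[of _ 0]) (meson abs_ge_zero order_trans)
  then obtain \<psi>0 where \<psi>0: "\<psi>0 \<in> V" "sup_norm {0..} (\<lambda>r. \<psi>0 r - \<phi> r) < t"
    using inf \<open>V \<noteq> {}\<close> by (subst (asm) cINF_less_iff) auto
  have close: "\<bar>\<psi>0 r - truncate R \<phi> r\<bar> \<le> t" for r
    using kernels_sup_norm_upper[OF diff[OF \<psi>0(1)], of r] \<psi>0(2) unfolding sup_eq by simp
  have bound: "\<bar>\<psi>0 r\<bar> \<le> S + t" for r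
    using close[of r] tr(3)[of r] by linarith
  have S: "S \<ge> 0"
    using tr(3)[of 0] by linarith
  show ?thesis
  proof (cases "t \<le> c")
    case True
    have "\<bar>\<psi>0 r\<bar> \<le> S + c" "\<bar>\<psi>0 r - truncate R \<phi> r\<bar> \<le> 2 * t" for r
      using bound[of r] close[of r] True \<open>t > 0\<close> by auto
    then show ?thesis
      using \<psi>0(1) by blast
  next
    case False
    define l where "l = (S + c) / (S + t)"
    have pos: "S + t > 0"
      using S \<open>t > 0\<close> by simp
    have "0 \<le> S + c" "S + c \<le> S + t"
      using S \<open>c > 0\<close> False by auto
    then have l: "0 \<le> l" "l \<le> 1" "l * (S + t) = S + c"
      using pos by (simp_all add: l_def)
    have "(\<lambda>r. l * \<psi>0 r) \<in> V"
      using funs.subspace_scale[OF V(1) \<psi>0(1)] .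
    moreover have "\<bar>l * \<psi>0 r\<bar> \<le> S + c" for r
      using mult_left_mono[OF bound[of r] l(1)] l by (simp add: abs_mult)
    moreover have "\<bar>l * \<psi>0 r - truncate R \<phi> r\<bar> \<le> 2 * t" for r
    proof -
      have "l * \<psi>0 r - \<psi>0 r = (l - 1) * \<psi>0 r"
        by (simp add: left_diff_distrib)
      then have "\<bar>l * \<psi>0 r - \<psi>0 r\<bar> = (1 - l) * \<bar>\<psi>0 r\<bar>"
        using l(2) by (simp add: abs_mult)
      also have "\<dots> \<le> (1 - l) * (S + t)"
        using l bound[of r] by (intro mult_left_mono) auto
      also have "\<dots> = t - c"
        using l by (simp add: left_diff_distrib)
      finally show ?thesis
        using close[of r] \<open>c > 0\<close> by linarith
    qed
    ultimately show ?thesis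
      by (intro bexI[of _ "\<lambda>r. l * \<psi>0 r"]) auto
  qed
qed

text \<open>The risk bound counts the elements of a spanning set; a true basis makes this number the
  dimension, which is what the hypotheses bound.\<close>

lemma finite_dim_basis:
  assumes "finite_dim_subspace V"
  obtains B where "finite B" "V = funs.span B" "card B = funs.dim V"
proof -
  obtain A where A: "funs.subspace V" "finite A" "V = funs.span A"
    using assms by (auto simp: finite_dim_subspace_def)
  obtain B where B: "B \<subseteq> V" "funs.independent B" "V \<subseteq> funs.span B" "card B = funs.dim V"
    using funs.basis_exists by blast
  have "finite B"
    using funs.independent_span_bound[OF A(2) B(2)] B(1) A(3) by auto
  moreover have "V = funs.span B"
    using funs.span_subspace[OF B(1,3) A(1)] by simp
  ultimately show thesis
    using that B(4) by blast
qed

section \<open>Arithmetic of the balance between dimension and sample size\<close>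

locale rate =
  fixes s a b c0 :: real and M :: nat and n D :: real
  assumes s: "s > 0" and a: "a > 0" and b: "b > 0" and c0: "c0 > 0" and M2: "M \<ge> 2"
    and n_lower: "a * (real M / ln (real M)) powr (1 / (2 * s + 1)) \<le> n"
    and n_upper: "n \<le> b * (real M / ln (real M)) powr (1 / (2 * s + 1))"
    and D: "0 \<le> D" "D \<le> c0 * n"
begin

definition y :: real where
  "y = ln (real M) / real M"

definition \<epsilon> :: real where
  "\<epsilon> = y powr (2 * s / (2 * s + 1))"

lemma ln_M: "ln (real M) > 0" "ln 2 \<le> ln (real M)"
  using M2 by auto

lemma y: "0 < y" "y < 1"
  using M2 ln_M ln_less_self[of "real M"] by (auto simp: y_def)

lemma inverse_y: "real M / ln (real M) = y powr (- 1)"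
  using y by (simp add: powr_minus) (simp add: y_def)

lemma scale_eq: "(real M / ln (real M)) powr (1 / (2 * s + 1)) = y powr (- (1 / (2 * s + 1)))"
  unfolding inverse_y powr_powr by simp

lemma n_pos: "n > 0"
  using a y n_lower unfolding scale_eq by (smt (verit) mult_pos_pos powr_gt_zero)

text \<open>The estimation side of the balance: the exponents satisfy -1/(2 s + 1) + 1 = 2 s/(2 s +
  1).\<close>

lemma D_y: "D * y \<le> c0 * b * \<epsilon>"
proof -
  have "D \<le> c0 * (b * y powr (- (1 / (2 * s + 1))))"
    using D(2) n_upper c0 unfolding scale_eq by (meson less_imp_le mult_left_mono order_trans)
  then have "D * y \<le> c0 * (b * y powr (- (1 / (2 * s + 1)))) * y"
    using y by (intro mult_right_mono) auto
  also have "\<dots> = c0 * b * (y powr (- (1 / (2 * s + 1))) * y powr 1)"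
    using y by simp
  also have "y powr (- (1 / (2 * s + 1))) * y powr 1 = y powr (2 * s / (2 * s + 1))"
  proof -
    have "- (1 / (2 * s + 1)) + 1 = 2 * s / (2 * s + 1)"
      using s by (simp add: field_simps)
    then show ?thesis
      by (simp only: powr_add[symmetric])
  qed
  finally show ?thesis
    by (simp add: \<epsilon>_def)
qed

lemma \<epsilon>: "0 < \<epsilon>" "\<epsilon> \<le> 1" "y \<le> \<epsilon>"
proof -
  show "0 < \<epsilon>"
    using y by (simp add: \<epsilon>_def)
  show "\<epsilon> \<le> 1"
    unfolding \<epsilon>_def using y s by (intro powr_le1) auto
  have "y powr 1 \<le> y powr (2 * s / (2 * s + 1))"
    using y s by (intro powr_mono') (auto simp: field_simps)
  then show "y \<le> \<epsilon>"
    using y by (simp add: \<epsilon>_def)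
qed

text \<open>Terms without a logarithm are absorbed by those with one, since \<open>M\<close> is at
  least 2.\<close>

lemma inverse_M: "1 / real M \<le> y / ln 2"
proof -
  have "ln 2 * (1 / real M) \<le> y"
    using ln_M M2 by (simp add: divide_right_mono y_def)
  moreover have "(0::real) < ln 2"
    by simp
  ultimately show ?thesis
    by (metis mult.commute pos_le_divide_eq)
qed

lemma inverse_M_le: "1 / real M \<le> \<epsilon> / ln 2"
  using inverse_M \<epsilon>(3) by (meson divide_right_mono ln_ge_zero order_trans one_le_numeral)

lemma D_M: "D / real M \<le> c0 * b * \<epsilon> / ln 2"
proof -
  have "D * (1 / real M) \<le> D * (y / ln 2)"
    by (intro mult_left_mono inverse_M D)
  also have "\<dots> = D * y / ln 2"
    by simp
  also have "\<dots> \<le> c0 * b * \<epsilon> / ln 2"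
    by (rule divide_right_mono[OF D_y]) simp
  finally show ?thesis
    by simp
qed

lemma D_M_sq: "(D / real M)\<^sup>2 \<le> (c0 * b / ln 2)\<^sup>2 * \<epsilon>"
proof -
  have "0 \<le> D / real M"
    using D by simp
  moreover have "D / real M \<le> c0 * b / ln 2"
    using D_M \<epsilon>(2) c0 b by (rule_tac order_trans[OF D_M]) (simp add: divide_right_mono mult_left_le)
  ultimately have "(D / real M) * (D / real M) \<le> (c0 * b / ln 2) * (c0 * b * \<epsilon> / ln 2)"
    using D_M c0 b by (intro mult_mono) auto
  then show ?thesis
    by (simp add: power2_eq_square)
qed

lemma D_M2: "D / (real M)\<^sup>2 \<le> c0 * b * \<epsilon> / ln 2"
proof -
  have "D / (real M)\<^sup>2 \<le> D / real M"
  proof (rule divide_left_mono)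
    show "real M \<le> (real M)\<^sup>2"
      using M2 by (intro self_le_power) auto
  qed (use M2 D in auto)
  then show ?thesis
    using D_M by linarith
qed

text \<open>The approximation side of the balance. The lower bound on \<open>n\<close> is used here,
  the upper bound in \<open>D_y\<close>.\<close>

lemma n_powr: "(n powr (- s))\<^sup>2 \<le> a powr (- (2 * s)) * \<epsilon>"
proof -
  have "n powr (- (2 * s)) \<le> (a * y powr (- (1 / (2 * s + 1)))) powr (- (2 * s))"
    using n_lower a y(1) s unfolding scale_eq by (intro powr_mono2' mult_pos_pos) simp_all
  also have "\<dots> = a powr (- (2 * s)) * \<epsilon>"
    using a y by (simp add: powr_mult powr_powr \<epsilon>_def)
  finally show ?thesis
    using n_pos by (simp add: power2_eq_square powr_add[symmetric])
qed

text \<open>The logarithm of the net size is a multiple of ln M: the constant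
  \<open>ln (2 * \<beta> + 3)\<close> is converted into one by ln M \<ge> ln 2.\<close>

lemma D_ln:
  assumes \<beta>: "\<beta> \<ge> 0" and L: "l \<le> \<beta> * real M + 1" "l \<ge> 0"
  shows "D * ln (2 * l + 1) / real M \<le> (ln (2 * \<beta> + 3) / ln 2 + 1) * (c0 * b * \<epsilon>)"
proof -
  let ?t = "ln (2 * \<beta> + 3)"
  have t: "?t \<ge> 0"
    using \<beta> by simp
  have "2 * l + 1 \<le> (2 * \<beta> + 3) * real M"
    using L M2 by (simp add: distrib_right)
  then have "ln (2 * l + 1) \<le> ln ((2 * \<beta> + 3) * real M)"
    using L by simp
  also have "\<dots> = ?t + ln (real M)"
    using \<beta> M2 by (simp add: ln_mult)
  also have "\<dots> \<le> (?t / ln 2 + 1) * ln (real M)"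
  proof -
    have "?t / ln 2 * ln 2 \<le> ?t / ln 2 * ln (real M)"
      using t ln_M by (intro mult_left_mono) auto
    then show ?thesis
      by (simp add: distrib_right)
  qed
  finally have "D * ln (2 * l + 1) / real M \<le> D * ((?t / ln 2 + 1) * ln (real M)) / real M"
    using D by (intro divide_right_mono mult_left_mono) auto
  also have "\<dots> = (?t / ln 2 + 1) * (D * y)"
    by (simp add: y_def)
  also have "\<dots> \<le> (?t / ln 2 + 1) * (c0 * b * \<epsilon>)"
    using t by (intro mult_left_mono D_y) auto
  finally show ?thesis .
qed

end

section \<open>Comparison of norm and energy under coercivity\<close>

locale coercive_observation = observation P N d \<sigma> T R S \<phi> \<mu>0 B X
  for P :: "'w measure" and N d :: nat and \<sigma> T R S :: real and \<phi> :: "real \<Rightarrow> real"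
    and \<mu>0 :: "(nat \<times> nat \<Rightarrow> real) measure" and B X :: "real \<Rightarrow> 'w \<Rightarrow> config" +
  fixes H :: "(real \<Rightarrow> real) set" and cL :: real
  assumes \<sigma>: "\<sigma> > 0" and N2: "N \<ge> 2" and cL: "cL > 0" and H: "H \<subseteq> kernels R"
    and coercive: "coercive N d \<sigma> T P X H cL"
begin

text \<open>The condition is stated with expectations of single rows; the drifts are bounded, so
  these can be summed under the expectation. Bounded kernels supported in \<open>[0,R]\<close> meet
  its finiteness premise.\<close>

lemma coercive_le:
  assumes "h \<in> H"
  shows "cL * tri2 h \<le> 1 / (2 * \<sigma>\<^sup>2 * T * real N) * expectation (qf h h)"
proof -
  have hK: "h \<in> kernels R"
    using assms H by blast
  obtain c where c: "\<And>x. \<bar>inner_cfg N d (drift N d h x) (drift N d h x)\<bar> \<le> c"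
    using inner_drift_bound[OF N R hK hK] by blast
  have "(\<Sum>i<N. LINT \<omega>|P. (L2_set (drift N d h (X t \<omega>) i) {..<d})\<^sup>2)
      = expectation (\<lambda>\<omega>. inner_cfg N d (drift N d h (X t \<omega>)) (drift N d h (X t \<omega>)))" if t: "t \<in> {0..T}" for t
  proof -
    have row: "(L2_set (drift N d h (X t \<omega>) i) {..<d})\<^sup>2 = (\<Sum>k<d. drift N d h (X t \<omega>) i k * drift N d h (X t \<omega>) i k)" for \<omega> i
      by (simp add: L2_set_def sum_nonneg power2_eq_square)
    have int: "integrable P (\<lambda>\<omega>. \<Sum>k<d. drift N d h (X t \<omega>) i k * drift N d h (X t \<omega>) i k)" if i: "i < N" for i
    proof (rule integrable_const_bound[of _ c])
      have "(\<Sum>k<d. drift N d h x i k * drift N d h x i k) \<le> inner_cfg N d (drift N d h x) (drift N d h x)" for x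
        unfolding inner_cfg_def using i
        by (intro member_le_sum[where f = "\<lambda>i. \<Sum>k<d. drift N d h x i k * drift N d h x i k"]) (auto intro: sum_nonneg)
      then have "\<bar>\<Sum>k<d. drift N d h x i k * drift N d h x i k\<bar> \<le> c" for x
        using c[of x] by (simp add: abs_of_nonneg sum_nonneg) (meson abs_ge_self order_trans)
      then show "AE \<omega> in P. norm (\<Sum>k<d. drift N d h (X t \<omega>) i k * drift N d h (X t \<omega>) i k) \<le> c"
        by simp
      show "(\<lambda>\<omega>. \<Sum>k<d. drift N d h (X t \<omega>) i k * drift N d h (X t \<omega>) i k) \<in> borel_measurable P"
        using i X_measurable[OF t] kernels_measurable[OF hK]
        by (intro borel_measurable_sum borel_measurable_times drift_measurable) auto
    qed
    show ?thesis
      unfolding row inner_cfg_def using int by (intro Bochner_Integration.integral_sum[symmetric]) auto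
  qed
  then have "(LINT t:{0..T}|lborel. \<Sum>i<N. LINT \<omega>|P. (L2_set (drift N d h (X t \<omega>) i) {..<d})\<^sup>2) = expectation (qf h h)"
    unfolding set_integral_time_interval qf_expectation[OF hK hK]
    by (intro Bochner_Integration.integral_cong) auto
  moreover have "set_integrable \<rho> {0..} (\<lambda>r. \<bar>h r * r\<bar>\<^sup>2)"
    using tri2_integrable[OF N2 hK] by (simp add: set_integrable_def)
  ultimately show ?thesis
    using coercive assms by (auto simp: coercive_def tri_norm_sq mult_ac)
qed

text \<open>Coercivity and the opposite inequality hold for the same element; dividing by its
  positive squared norm leaves a bound in which \<open>T\<close> and \<open>N\<close> have
  cancelled.\<close>

lemma cL_le:
  assumes "h \<in> H" "tri2 h \<noteq> 0"
  shows "cL \<le> 1 / (2 * \<sigma>\<^sup>2)"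
proof -
  have pos: "tri2 h > 0"
    using assms(2) tri2_nonneg[of h] by simp
  have "cL * tri2 h \<le> 1 / (2 * \<sigma>\<^sup>2 * T * real N) * (T * real N * tri2 h)"
    using \<sigma> T N by (intro order_trans[OF coercive_le[OF assms(1)]] mult_left_mono energy_le_tri2 N2 subsetD[OF H] assms(1)) auto
  also have "\<dots> = 1 / (2 * \<sigma>\<^sup>2) * tri2 h"
    using T N by simp
  finally show ?thesis
    by (rule mult_right_le_imp_le) (rule pos)
qed

text \<open>One factor \<open>cL\<close> is spent on coercivity, the other is replaced by its upper
  bound. An element of norm 0 gives no upper bound for \<open>cL\<close>, but then the left side is
  0.\<close>

lemma tri2_le_energy:
  assumes "h \<in> H"
  shows "cL\<^sup>2 * tri2 h \<le> 1 / (2 * \<sigma>\<^sup>2) * (1 / (2 * \<sigma>\<^sup>2 * T * real N) * expectation (qf h h))"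
proof (cases "tri2 h = 0")
  case True
  have "0 \<le> expectation (qf h h)"
    using semi_inner.ip_nonneg[OF semi_inner_expectation_qf] assms H by blast
  then show ?thesis
    using True \<sigma> T by simp
next
  case False
  have "cL\<^sup>2 * tri2 h = cL * (cL * tri2 h)"
    by (simp add: power2_eq_square)
  also have "\<dots> \<le> 1 / (2 * \<sigma>\<^sup>2) * (1 / (2 * \<sigma>\<^sup>2 * T * real N) * expectation (qf h h))"
    by (rule mult_mono[OF cL_le[OF assms False] coercive_le[OF assms]])
      (use cL tri2_nonneg[of h] in auto)
  finally show ?thesis .
qed

text \<open>If no element of \<open>H\<close> is seen by the measure \<open>\<rho>\<close>, the constant \<open>cL\<close> is arbitrary; then \<open>\<phi>\<close>, being a
  limit of such elements, is not seen either.\<close>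

lemma tri2_approximant_le:
  assumes \<psi>: "\<psi> \<in> H" "\<And>r. \<bar>\<psi> r - truncate R \<phi> r\<bar> \<le> e"
    and approx: "\<And>k::nat. k \<ge> 1 \<Longrightarrow> \<exists>\<psi>\<in>H. \<forall>r. \<bar>\<psi> r - truncate R \<phi> r\<bar> \<le> \<eta> k" and \<eta>: "\<eta> \<longlonglongrightarrow> 0"
  shows "cL\<^sup>2 * tri2 (\<lambda>r. \<psi> r - truncate R \<phi> r) \<le> (1 / (2 * \<sigma>\<^sup>2))\<^sup>2 * (e * R)\<^sup>2"
proof (cases "\<exists>h\<in>H. tri2 h \<noteq> 0")
  case True
  then have "cL \<le> 1 / (2 * \<sigma>\<^sup>2)"
    using cL_le by blast
  moreover have "tri2 (\<lambda>r. \<psi> r - truncate R \<phi> r) \<le> (e * R)\<^sup>2"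
    using \<psi> H truncate_admissible(1)[OF adm R] by (intro tri2_bound N2 kernels_diff) auto
  ultimately show ?thesis
    using cL tri2_nonneg by (intro mult_mono power_mono) auto
next
  case False
  let ?\<phi> = "truncate R \<phi>"
  have \<phi>: "?\<phi> \<in> kernels R"
    by (rule truncate_admissible(1)[OF adm R])
  have "tri2 ?\<phi> \<le> 2 * (\<eta> k * R)\<^sup>2" if k: "k \<ge> 1" for k
  proof -
    obtain h where h: "h \<in> H" "\<And>r. \<bar>h r - ?\<phi> r\<bar> \<le> \<eta> k"
      using approx[OF k] by blast
    have hK: "h \<in> kernels R"
      using h H by blast
    have "tri2 ?\<phi> = tri2 (\<lambda>r. h r - (h r - ?\<phi> r))"
      by simp
    also have "\<dots> \<le> 2 * tri2 h + 2 * tri2 (\<lambda>r. h r - ?\<phi> r)"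
      by (rule tri2_add_le(2)[OF N2 hK kernels_diff[OF hK \<phi>]])
    also have "\<dots> \<le> 2 * (\<eta> k * R)\<^sup>2"
      using False h(1) tri2_bound[OF N2 kernels_diff[OF hK \<phi>] h(2)] by simp
    finally show ?thesis .
  qed
  moreover have "(\<lambda>k. 2 * (\<eta> k * R)\<^sup>2) \<longlonglongrightarrow> 2 * (0 * R)\<^sup>2"
    by (intro tendsto_intros \<eta>)
  ultimately have "tri2 ?\<phi> \<le> 0"
    using LIMSEQ_le_const[of "\<lambda>k. 2 * (\<eta> k * R)\<^sup>2" 0 "tri2 ?\<phi>"] by auto
  moreover have "tri2 (\<lambda>r. \<psi> r - ?\<phi> r) \<le> 2 * tri2 \<psi> + 2 * tri2 ?\<phi>"
    using \<psi> H \<phi> by (intro tri2_add_le N2) auto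
  moreover have "tri2 \<psi> = 0"
    using False \<psi> by blast
  ultimately have "tri2 (\<lambda>r. \<psi> r - ?\<phi> r) = 0"
    using tri2_nonneg[of "\<lambda>r. \<psi> r - ?\<phi> r"] by linarith
  then show ?thesis
    by simp
qed

end

text \<open>\<open>C\<close> is fixed before the dimension, the probability spaces, the kernel, the
  hypothesis spaces, \<open>cL\<close> and \<open>M\<close>; it is built from \<sigma>, N, T, R, S0
  together with \<open>c0\<close>, \<open>s\<close> and the constants \<open>a\<close>,
  \<open>b\<close> that quantify the growth of \<open>n\<close>. The expectation is a nonnegative
  integral, so the bound includes finiteness of the risk.\<close>

theorem theorem3p2:
  fixes N :: nat and \<sigma> T R S0 c0 s a b :: real
  assumes "N \<ge> 2" "\<sigma> > 0" "T > 0" "R > 0" "c0 > 0" "s > 0" "a > 0" "b > 0"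
  shows "\<exists>C>0. \<forall>(d::nat) (S::real) (c1::real) (c2::real) (\<gamma>::real) (cL::real)
      (\<phi>::real \<Rightarrow> real) (L::nat \<Rightarrow> (real \<Rightarrow> real) set) (n::nat \<Rightarrow> nat)
      (\<mu>0::(nat \<times> nat \<Rightarrow> real) measure)
      (P::'w measure) (B::real \<Rightarrow> 'w \<Rightarrow> config) (X::real \<Rightarrow> 'w \<Rightarrow> config)
      (Q::'v measure) (Bs::nat \<Rightarrow> real \<Rightarrow> 'v \<Rightarrow> config) (Xs::nat \<Rightarrow> real \<Rightarrow> 'v \<Rightarrow> config)
      (M::nat) (J::nat \<Rightarrow> (real \<Rightarrow> real) \<Rightarrow> 'v \<Rightarrow> real) (est::'v \<Rightarrow> real \<Rightarrow> real).
    d \<ge> 1 \<and> S > 0 \<and> c1 > 0 \<and> c2 > 0 \<and> \<gamma> > 0 \<and> cL > 0 \<and> S0 = c2 + S \<and>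
    \<phi> \<in> admissible R S \<and>
    (\<forall>n\<ge>1. finite_dim_subspace (L n) \<and> L n \<subseteq> C11_ext R \<and>
       (\<forall>\<psi>\<in>L n. sup_norm {0..R} (deriv_in {0..R} \<psi>)
                   \<le> c1 * real (funs.dim (L n)) powr \<gamma> * sup_norm {0..} \<psi>) \<and>
       real (funs.dim (L n)) \<le> c0 * real n \<and>
       (INF \<psi>\<in>L n. sup_norm {0..} (\<lambda>r. \<psi> r - \<phi> r)) \<le> c2 * real n powr (- s)) \<and>
    (\<forall>M\<ge>2. a * (real M / ln (real M)) powr (1 / (2 * s + 1)) \<le> real (n M) \<and>
            real (n M) \<le> b * (real M / ln (real M)) powr (1 / (2 * s + 1))) \<and>
    observed_system N d \<sigma> T \<phi> \<mu>0 P B X \<and>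
    coercive N d \<sigma> T P X (\<Union>n\<in>{1..}. L n) cL \<and>
    M \<ge> 2 \<and>
    (\<forall>m\<in>{1..M}. observed_system N d \<sigma> T \<phi> \<mu>0 Q (Bs m) (Xs m)) \<and>
    independent_copies N d T P X Q M Xs \<and>
    linear_ito_versions N d T Q M Xs (L (n M)) J \<and>
    minimizing_estimator Q (empirical_error N d \<sigma> T M Xs J)
      {\<psi> \<in> L (n M). sup_norm {0..} \<psi> \<le> S0} est
    \<longrightarrow>
    (\<integral>\<^sup>+\<omega>. ennreal ((tri_norm (rho N d T P X) (\<lambda>r. est \<omega> r - \<phi> r))\<^sup>2) \<partial>Q)
      \<le> ennreal (C / cL\<^sup>2 * (ln (real M) / real M) powr (2 * s / (2 * s + 1)))"
proof -
  let ?\<kappa> = "1 / (2 * \<sigma>\<^sup>2)"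
  define bd where "bd = (2 * S0 * R)\<^sup>2 / (2 * \<sigma>\<^sup>2)"
  \<comment> \<open>From the squared approximation error, with \<open>c2\<close> estimated by
    \<open>S0\<close>, so that the constant does not depend on \<open>c2\<close> separately.\<close>
  define A where "A = (4 * S0 * R)\<^sup>2 * a powr (- (2 * s))"
  \<comment> \<open>The summands of the risk bound in their original order, each with its dependence
    on the dimension and \<open>M\<close> replaced by its multiple of the rate.\<close>
  define C1 where "C1 = 64 * (?\<kappa> * A) + 2048 * (c0 * b / ln 2 / (T * real N)) + 16 * (c0 * b / ln 2)\<^sup>2
    + 8 * (bd * ((ln (2 * sqrt bd + 3) / ln 2 + 1) * (c0 * b) + 1 / ln 2)) + 4 * (c0 * b / ln 2)"
  \<comment> \<open>Both parts of the decomposition into \<open>est - \<psi>\<close> and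
    \<open>\<psi> - \<phi>\<close> carry a factor 2; the summand 1 makes \<open>C\<close>
    positive.\<close>
  define C where "C = 2 * ?\<kappa> * C1 + 2 * ?\<kappa>\<^sup>2 * A + 1"
  have bd: "bd \<ge> 0" and A: "A \<ge> 0"
    by (auto simp: bd_def A_def)
  have "0 \<le> C1"
    unfolding C1_def using assms bd A by (intro add_nonneg_nonneg mult_nonneg_nonneg divide_nonneg_pos) auto
  then have C_pos: "C > 0"
    unfolding C_def using A by (intro add_nonneg_pos add_nonneg_nonneg mult_nonneg_nonneg) auto
  show ?thesis
  proof (intro exI[of _ C] conjI allI impI C_pos, elim conjE)
    fix d :: nat and S c1 c2 \<gamma> cL :: real and \<phi> :: "real \<Rightarrow> real" and L :: "nat \<Rightarrow> (real \<Rightarrow> real) set" and n :: "nat \<Rightarrow> nat"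
      and \<mu>0 :: "(nat \<times> nat \<Rightarrow> real) measure" and P :: "'w measure" and B X :: "real \<Rightarrow> 'w \<Rightarrow> config"
      and Q :: "'v measure" and Bs Xs :: "nat \<Rightarrow> real \<Rightarrow> 'v \<Rightarrow> config" and M :: nat
      and J :: "nat \<Rightarrow> (real \<Rightarrow> real) \<Rightarrow> 'v \<Rightarrow> real" and est :: "'v \<Rightarrow> real \<Rightarrow> real"
    assume S: "S > 0" "c2 > 0" "S0 = c2 + S" and cL: "cL > 0" and adm: "\<phi> \<in> admissible R S"
      and L: "\<forall>n\<ge>1. finite_dim_subspace (L n) \<and> L n \<subseteq> C11_ext R \<and>
        (\<forall>\<psi>\<in>L n. sup_norm {0..R} (deriv_in {0..R} \<psi>) \<le> c1 * real (funs.dim (L n)) powr \<gamma> * sup_norm {0..} \<psi>) \<and>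
        real (funs.dim (L n)) \<le> c0 * real n \<and>
        (INF \<psi>\<in>L n. sup_norm {0..} (\<lambda>r. \<psi> r - \<phi> r)) \<le> c2 * real n powr (- s)"
      and n: "\<forall>M\<ge>2. a * (real M / ln (real M)) powr (1 / (2 * s + 1)) \<le> real (n M) \<and>
        real (n M) \<le> b * (real M / ln (real M)) powr (1 / (2 * s + 1))"
      and obs: "observed_system N d \<sigma> T \<phi> \<mu>0 P B X"
      and coer: "coercive N d \<sigma> T P X (\<Union>n\<in>{1..}. L n) cL"
      and M: "M \<ge> 2"
      and copies: "\<forall>m\<in>{1..M}. observed_system N d \<sigma> T \<phi> \<mu>0 Q (Bs m) (Xs m)"
      and indep: "independent_copies N d T P X Q M Xs"
      and J: "linear_ito_versions N d T Q M Xs (L (n M)) J"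
      and min: "minimizing_estimator Q (empirical_error N d \<sigma> T M Xs J) {\<psi> \<in> L (n M). sup_norm {0..} \<psi> \<le> S0} est"
    let ?V = "L (n M)" and ?H = "\<Union>n\<in>{1..}. L n" and ?\<phi> = "truncate R \<phi>"
    have S0: "S0 > 0" "c2 \<le> S0"
      using S by auto
    have LK: "L k \<subseteq> kernels R" and sub: "funs.subspace (L k)" if "k \<ge> 1" for k
      using L that C11_ext_kernels[of R] unfolding finite_dim_subspace_def by blast+
    have "0 < a * (real M / ln (real M)) powr (1 / (2 * s + 1))"
      using \<open>a > 0\<close> M by simp
    also have "\<dots> \<le> real (n M)"
      using n M by blast
    finally have n1: "n M \<ge> 1"
      by simp
    have VK: "?V \<subseteq> kernels R"
      by (rule LK[OF n1])
    interpret r: rate s a b c0 M "real (n M)" "real (funs.dim ?V)"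
      using assms M n L n1 by unfold_locales auto
    have N0: "N > 0"
      using \<open>N \<ge> 2\<close> by simp
    interpret P: prob_space P
      using obs unfolding observed_system_def by (elim conjE)
    interpret P: observation P N d \<sigma> T R S \<phi> \<mu>0 B X
      by unfold_locales (fact obs adm assms N0)+
    have "observed_system N d \<sigma> T \<phi> \<mu>0 Q (Bs 1) (Xs 1)"
      using copies M by simp
    then interpret Q: prob_space Q
      unfolding observed_system_def by (elim conjE)
    interpret H: coercive_observation P N d \<sigma> T R S \<phi> \<mu>0 B X ?H cL
    proof unfold_locales
      show "?H \<subseteq> kernels R"
        using LK by blast
    qed (fact assms cL coer)+
    \<comment> \<open>One factor 2 pays for the infimum not being attained, the other for scaling
      the approximant into the ball of radius \<open>S0\<close>.\<close>
    define \<eta> where "\<eta> k = 4 * c2 * real k powr (- s)" for k :: nat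
    have approx: "\<exists>\<psi>\<in>L k. (\<forall>r. \<bar>\<psi> r\<bar> \<le> S + c2) \<and> (\<forall>r. \<bar>\<psi> r - ?\<phi> r\<bar> \<le> \<eta> k)" if k: "k \<ge> 1" for k
    proof -
      have t: "2 * c2 * real k powr (- s) > 0"
        using S k by simp
      have "(INF \<psi>\<in>L k. sup_norm {0..} (\<lambda>r. \<psi> r - \<phi> r)) \<le> c2 * real k powr (- s)"
        using L k by blast
      also have "\<dots> < 2 * c2 * real k powr (- s)"
        using t by simp
      finally show ?thesis
        using bounded_approximant[OF sub[OF k] LK[OF k] adm \<open>R > 0\<close> t \<open>c2 > 0\<close>] by (simp add: \<eta>_def mult.assoc)
    qed
    obtain \<psi> where \<psi>: "\<psi> \<in> ?V" "\<And>r. \<bar>\<psi> r\<bar> \<le> S0" "\<And>r. \<bar>\<psi> r - ?\<phi> r\<bar> \<le> \<eta> (n M)"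
      using approx[OF n1] S(3) by (auto simp: add.commute)
    have "finite_dim_subspace ?V"
      using L n1 by blast
    then obtain basis where basis: "finite basis" "?V = funs.span basis" "card basis = funs.dim ?V"
      by (rule finite_dim_basis)
    have est: "AE \<omega> in Q. est \<omega> \<in> ?V \<and> (\<forall>r. \<bar>est \<omega> r\<bar> \<le> S0) \<and>
        empirical_error N d \<sigma> T M Xs J (est \<omega>) \<omega> \<le> empirical_error N d \<sigma> T M Xs J \<psi> \<omega>"
    proof -
      have "\<psi> \<in> {\<psi> \<in> ?V. sup_norm {0..} \<psi> \<le> S0}"
        using \<psi> by (auto intro: sup_norm_least)
      moreover have "AE \<omega> in Q. est \<omega> \<in> {\<psi> \<in> ?V. sup_norm {0..} \<psi> \<le> S0} \<and>
          (\<forall>\<psi>\<in>{\<psi> \<in> ?V. sup_norm {0..} \<psi> \<le> S0}. empirical_error N d \<sigma> T M Xs J (est \<omega>) \<omega> \<le> empirical_error N d \<sigma> T M Xs J \<psi> \<omega>)"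
        using min by (simp add: minimizing_estimator_def)
      ultimately show ?thesis
      proof (elim AE_mp, intro AE_I2 impI)
        fix \<omega> assume *: "\<psi> \<in> {\<psi> \<in> ?V. sup_norm {0..} \<psi> \<le> S0}"
          "est \<omega> \<in> {\<psi> \<in> ?V. sup_norm {0..} \<psi> \<le> S0} \<and>
          (\<forall>\<psi>\<in>{\<psi> \<in> ?V. sup_norm {0..} \<psi> \<le> S0}. empirical_error N d \<sigma> T M Xs J (est \<omega>) \<omega> \<le> empirical_error N d \<sigma> T M Xs J \<psi> \<omega>)"
        then have "est \<omega> \<in> ?V" "sup_norm {0..} (est \<omega>) \<le> S0"
          "empirical_error N d \<sigma> T M Xs J (est \<omega>) \<omega> \<le> empirical_error N d \<sigma> T M Xs J \<psi> \<omega>"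
          by blast+
        moreover have "\<bar>est \<omega> r\<bar> \<le> S0" for r
          using kernels_sup_norm_upper[of "est \<omega>" R r] calculation(1,2) VK by (meson order_trans subsetD)
        ultimately show "est \<omega> \<in> ?V \<and> (\<forall>r. \<bar>est \<omega> r\<bar> \<le> S0) \<and>
          empirical_error N d \<sigma> T M Xs J (est \<omega>) \<omega> \<le> empirical_error N d \<sigma> T M Xs J \<psi> \<omega>"
          by blast
      qed
    qed
    interpret lrn: learning P N d \<sigma> T R S \<phi> \<mu>0 B X Q Bs Xs M ?V basis S0 J est \<psi>
    proof unfold_locales
      show "observed_system N d \<sigma> T \<phi> \<mu>0 Q (Bs m) (Xs m)" if "m \<in> {1..M}" for m
        using copies that by blast
      show "AE \<omega> in Q. est \<omega> \<in> ?V \<and> (\<forall>r. \<bar>est \<omega> r\<bar> \<le> S0) \<and>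
        empirical_error N d \<sigma> T M Xs J (est \<omega>) \<omega> \<le> empirical_error N d \<sigma> T M Xs J \<psi> \<omega>"
        by (rule est)
    qed (use indep M assms S0 basis VK J \<psi> in simp_all)
    have bd_eq: "lrn.bd = bd"
      by (simp add: lrn.bd_def bd_def)
    \<comment> \<open>The smallest net size that covers all coordinates; rounding up costs at most
      1.\<close>
    let ?l = "nat \<lceil>sqrt bd * real M\<rceil>"
    have l: "sqrt bd * real M \<le> real ?l" "real ?l \<le> sqrt bd * real M + 1"
    proof -
      have "0 \<le> sqrt bd * real M"
        using bd by simp
      then show "sqrt bd * real M \<le> real ?l" "real ?l \<le> sqrt bd * real M + 1"
        by linarith+
    qed
    obtain U where U: "integrable Q U"
      "AE \<omega> in Q. lrn.ip (\<lambda>r. est \<omega> r - \<psi> r) (\<lambda>r. est \<omega> r - \<psi> r) \<le> U \<omega>"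
      "Q.expectation U \<le> 64 * lrn.ip (\<lambda>r. \<psi> r - ?\<phi> r) (\<lambda>r. \<psi> r - ?\<phi> r) + 2048 * real (funs.dim ?V) / (T * real N * real M)
        + 16 * (real (funs.dim ?V) / real M)\<^sup>2 + 8 * (bd / real M * (real (funs.dim ?V) * ln (2 * real ?l + 1) + 1))
        + 4 * real (funs.dim ?V) / (real M)\<^sup>2"
      using lrn.excess_risk[of ?l] l(1) unfolding bd_eq basis(3) by blast
    let ?D = "real (funs.dim ?V)"
    have \<phi>K: "?\<phi> \<in> kernels R" and dK: "(\<lambda>r. \<psi> r - ?\<phi> r) \<in> kernels R"
      using truncate_admissible(1)[OF adm \<open>R > 0\<close>] \<psi>(1) VK by (auto intro: kernels_diff)
    have \<eta>_le: "(\<eta> (n M) * R)\<^sup>2 \<le> A * r.\<epsilon>"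
    proof -
      have "(\<eta> (n M) * R)\<^sup>2 = (4 * c2 * R)\<^sup>2 * (real (n M) powr (- s))\<^sup>2"
        by (simp add: \<eta>_def power_mult_distrib)
      also have "\<dots> \<le> (4 * S0 * R)\<^sup>2 * (a powr (- (2 * s)) * r.\<epsilon>)"
        using S0 S \<open>R > 0\<close> by (intro mult_mono power_mono r.n_powr) auto
      finally show ?thesis
        by (simp add: A_def)
    qed
    have ip_\<psi>: "lrn.ip (\<lambda>r. \<psi> r - ?\<phi> r) (\<lambda>r. \<psi> r - ?\<phi> r) \<le> ?\<kappa> * (A * r.\<epsilon>)"
    proof -
      have "lrn.ip (\<lambda>r. \<psi> r - ?\<phi> r) (\<lambda>r. \<psi> r - ?\<phi> r) \<le> lrn.\<kappa> * (T * real N * P.tri2 (\<lambda>r. \<psi> r - ?\<phi> r))"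
        unfolding lrn.ip_def using lrn.\<kappa>_pos by (intro mult_left_mono P.energy_le_tri2[OF assms(1) dK]) simp
      also have "\<dots> = ?\<kappa> * P.tri2 (\<lambda>r. \<psi> r - ?\<phi> r)"
        using assms by (simp add: lrn.\<kappa>_def)
      also have "\<dots> \<le> ?\<kappa> * (A * r.\<epsilon>)"
        using P.tri2_bound[OF assms(1) dK \<psi>(3)] \<eta>_le by (intro mult_left_mono) auto
      finally show ?thesis .
    qed
    have U_le: "Q.expectation U \<le> C1 * r.\<epsilon>"
    proof -
      have 1: "2048 * ?D / (T * real N * real M) \<le> 2048 * (c0 * b / ln 2 / (T * real N)) * r.\<epsilon>"
      proof -
        have "2048 / (T * real N) * (?D / real M) \<le> 2048 / (T * real N) * (c0 * b * r.\<epsilon> / ln 2)"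
          using assms by (intro mult_left_mono r.D_M) auto
        then show ?thesis
          by (simp add: mult_ac)
      qed
      have 2: "bd / real M * (?D * ln (2 * real ?l + 1) + 1)
          \<le> bd * ((ln (2 * sqrt bd + 3) / ln 2 + 1) * (c0 * b) + 1 / ln 2) * r.\<epsilon>"
      proof -
        have "bd / real M * (?D * ln (2 * real ?l + 1) + 1) = bd * (?D * ln (2 * real ?l + 1) / real M + 1 / real M)"
          by (simp add: add_divide_distrib distrib_left)
        also have "\<dots> \<le> bd * ((ln (2 * sqrt bd + 3) / ln 2 + 1) * (c0 * b * r.\<epsilon>) + r.\<epsilon> / ln 2)"
          using bd by (intro mult_left_mono add_mono r.D_ln[OF _ l(2) of_nat_0_le_iff] r.inverse_M_le) auto
        finally show ?thesis
          by (simp add: algebra_simps)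
      qed
      have 3: "4 * ?D / (real M)\<^sup>2 \<le> 4 * (c0 * b / ln 2) * r.\<epsilon>"
        using r.D_M2 by simp
      have "C1 * r.\<epsilon> = 64 * (?\<kappa> * (A * r.\<epsilon>)) + 2048 * (c0 * b / ln 2 / (T * real N)) * r.\<epsilon> + 16 * ((c0 * b / ln 2)\<^sup>2 * r.\<epsilon>)
        + 8 * (bd * ((ln (2 * sqrt bd + 3) / ln 2 + 1) * (c0 * b) + 1 / ln 2) * r.\<epsilon>) + 4 * (c0 * b / ln 2) * r.\<epsilon>"
        unfolding C1_def by (simp only: distrib_right mult.assoc)
      then show ?thesis
        using U(3) ip_\<psi> 1 2 3 r.D_M_sq by linarith
    qed
    have \<psi>H: "\<psi> \<in> ?H"
      using \<psi>(1) n1 by auto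
    have "\<eta> \<longlonglongrightarrow> 4 * c2 * 0"
      unfolding \<eta>_def using \<open>s > 0\<close>
      by (intro tendsto_mult tendsto_const tendsto_neg_powr[OF _ filterlim_real_sequentially]) auto
    then have \<eta>_lim: "\<eta> \<longlonglongrightarrow> 0"
      by simp
    have approxH: "\<exists>\<psi>\<in>?H. \<forall>r. \<bar>\<psi> r - ?\<phi> r\<bar> \<le> \<eta> k" if "k \<ge> 1" for k
      using approx[OF that] that by auto
    \<comment> \<open>The approximation error has to be multiplied by \<open>cL\<^sup>2\<close> too,
      although \<open>\<psi> - \<phi>\<close> need not lie in a hypothesis space; the bound on
      \<open>cL\<close> is taken from elsewhere in the spaces.\<close>
    have tri_\<psi>: "cL\<^sup>2 * P.tri2 (\<lambda>r. \<psi> r - ?\<phi> r) \<le> ?\<kappa>\<^sup>2 * (A * r.\<epsilon>)"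
      using H.tri2_approximant_le[OF \<psi>H \<psi>(3) approxH \<eta>_lim] \<eta>_le
      by (meson mult_left_mono order_trans zero_le_power2)
    let ?F = "\<lambda>\<omega>. (2 * ?\<kappa> * U \<omega> + 2 * ?\<kappa>\<^sup>2 * (A * r.\<epsilon>)) / cL\<^sup>2"
    have bound: "AE \<omega> in Q. (tri_norm (rho N d T P X) (\<lambda>r. est \<omega> r - \<phi> r))\<^sup>2 \<le> ?F \<omega>"
      using est U(2)
    proof eventually_elim
      case (elim \<omega>)
      let ?g = "\<lambda>r. est \<omega> r - \<psi> r"
      have gV: "?g \<in> ?V"
        using elim(1) \<psi>(1) by (intro lrn.V_diff) auto
      have "(tri_norm (rho N d T P X) (\<lambda>r. est \<omega> r - \<phi> r))\<^sup>2 = P.tri2 (\<lambda>r. ?g r + (\<psi> r - ?\<phi> r))"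
        unfolding P.tri_norm_sq by (intro P.tri2_cong) (simp add: truncate_admissible(2)[OF adm \<open>R > 0\<close>])
      also have "\<dots> \<le> 2 * P.tri2 ?g + 2 * P.tri2 (\<lambda>r. \<psi> r - ?\<phi> r)"
        using gV VK by (intro P.tri2_add_le[OF assms(1)] dK) auto
      finally have tri: "(tri_norm (rho N d T P X) (\<lambda>r. est \<omega> r - \<phi> r))\<^sup>2 \<le> 2 * P.tri2 ?g + 2 * P.tri2 (\<lambda>r. \<psi> r - ?\<phi> r)" .
      have "cL\<^sup>2 * P.tri2 ?g \<le> ?\<kappa> * lrn.ip ?g ?g"
        unfolding lrn.ip_def lrn.\<kappa>_def using gV n1 by (intro H.tri2_le_energy) auto
      also have "\<dots> \<le> ?\<kappa> * U \<omega>"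
        using elim(2) by (intro mult_left_mono) auto
      finally have "cL\<^sup>2 * (2 * P.tri2 ?g + 2 * P.tri2 (\<lambda>r. \<psi> r - ?\<phi> r)) \<le> 2 * ?\<kappa> * U \<omega> + 2 * ?\<kappa>\<^sup>2 * (A * r.\<epsilon>)"
        using tri_\<psi> by (simp add: distrib_left)
      moreover have "cL\<^sup>2 * (tri_norm (rho N d T P X) (\<lambda>r. est \<omega> r - \<phi> r))\<^sup>2 \<le> cL\<^sup>2 * (2 * P.tri2 ?g + 2 * P.tri2 (\<lambda>r. \<psi> r - ?\<phi> r))"
        by (rule mult_left_mono[OF tri]) simp
      ultimately have "cL\<^sup>2 * (tri_norm (rho N d T P X) (\<lambda>r. est \<omega> r - \<phi> r))\<^sup>2 \<le> 2 * ?\<kappa> * U \<omega> + 2 * ?\<kappa>\<^sup>2 * (A * r.\<epsilon>)"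
        by (rule order_trans[rotated])
      then show ?case
        using cL by (subst pos_le_divide_eq) (auto simp: mult.commute)
    qed
    have F_int: "integrable Q ?F"
      using U(1) by simp
    have "(\<integral>\<^sup>+\<omega>. ennreal ((tri_norm (rho N d T P X) (\<lambda>r. est \<omega> r - \<phi> r))\<^sup>2) \<partial>Q) \<le> (\<integral>\<^sup>+\<omega>. ennreal (?F \<omega>) \<partial>Q)"
      using bound by (intro nn_integral_mono_AE) (auto intro: ennreal_leI)
    also have "\<dots> = ennreal (Q.expectation ?F)"
    proof (rule nn_integral_eq_integral[OF F_int])
      \<comment> \<open>\<open>?F\<close> is nonnegative almost surely because it dominates a square
        there.\<close>
      show "AE \<omega> in Q. 0 \<le> ?F \<omega>"
        using bound by eventually_elim (rule order_trans[OF zero_le_power2])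
    qed
    also have "\<dots> \<le> ennreal (C / cL\<^sup>2 * (ln (real M) / real M) powr (2 * s / (2 * s + 1)))"
    proof (rule ennreal_leI)
      have "Q.expectation ?F = (2 * ?\<kappa> * Q.expectation U + 2 * ?\<kappa>\<^sup>2 * (A * r.\<epsilon>)) / cL\<^sup>2"
        using U(1) by (simp add: Q.prob_space)
      also have "\<dots> \<le> (2 * ?\<kappa> * (C1 * r.\<epsilon>) + 2 * ?\<kappa>\<^sup>2 * (A * r.\<epsilon>)) / cL\<^sup>2"
        by (intro divide_right_mono add_right_mono mult_left_mono U_le) auto
      also have "\<dots> = (2 * ?\<kappa> * C1 + 2 * ?\<kappa>\<^sup>2 * A) * r.\<epsilon> / cL\<^sup>2"
        by (simp only: distrib_right mult.assoc)
      also have "\<dots> \<le> C * r.\<epsilon> / cL\<^sup>2"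
        using r.\<epsilon>(1) by (intro divide_right_mono mult_right_mono) (auto simp: C_def)
      finally show "Q.expectation ?F \<le> C / cL\<^sup>2 * (ln (real M) / real M) powr (2 * s / (2 * s + 1))"
        by (simp add: r.\<epsilon>_def r.y_def)
    qed
    finally show "(\<integral>\<^sup>+\<omega>. ennreal ((tri_norm (rho N d T P X) (\<lambda>r. est \<omega> r - \<phi> r))\<^sup>2) \<partial>Q)
      \<le> ennreal (C / cL\<^sup>2 * (ln (real M) / real M) powr (2 * s / (2 * s + 1)))" .
  qed
qed

end
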